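(* There exists a Banach space $Y$ with a basis such that the quotient space $Y^{**}/Y$ is an infinite-dimensional reflexive separable Banach space, but $Y^*$ does not contain closed norming subspaces of infinite codimension.
   Context: "Basis" means Schauder basis. A Banach space $Y$ is identified with its canonical image in $Y^{**}$. A subspace $M\subset Y^*$ is norming if there exists $c>0$ such that $\sup_{0\ne f\in M}|f(y)|/\|f\|\ge c\|y\|$ for all $y\in Y$. *)

theory Defs
  imports "HOL-Analysis.Analysis" "HOL-Algebra.Module" "HOL-Algebra.AbelCoset"
begin

text \<open>
  Real normed spaces as objects: a module over the field of real numbers together with a norm.
  The carrier-based form is needed because the space is existentially quantified and because
  duals and quotients of it are again spaces. The ring fields \<open>mult\<close> and \<open>one\<close> inherited from
  the record \<open>module\<close> play no role.
\<close>

definition real_ring :: "real ring" where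
  "real_ring = \<lparr>carrier = UNIV, mult = (*), one = 1, zero = 0, add = (+)\<rparr>"

record 'a normed_vs = "(real, 'a) module" +
  vnorm :: "'a \<Rightarrow> real"

locale normed_space = module real_ring X for X :: "'a normed_vs" (structure) +
  assumes vnorm_eq_0_iff: "x \<in> carrier X \<Longrightarrow> vnorm X x = 0 \<longleftrightarrow> x = \<zero>\<^bsub>X\<^esub>"
    and vnorm_triangle:
      "x \<in> carrier X \<Longrightarrow> y \<in> carrier X \<Longrightarrow> vnorm X (x \<oplus>\<^bsub>X\<^esub> y) \<le> vnorm X x + vnorm X y"
    and vnorm_smult: "x \<in> carrier X \<Longrightarrow> vnorm X (a \<odot>\<^bsub>X\<^esub> x) = \<bar>a\<bar> * vnorm X x"

text \<open>The value outside the carrier is fixed because the locale \<open>Metric_space\<close> requires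
  nonnegativity and symmetry of the distance on the whole type.\<close>

definition vdist :: "'a normed_vs \<Rightarrow> 'a \<Rightarrow> 'a \<Rightarrow> real" where
  "vdist X x y = (if x \<in> carrier X \<and> y \<in> carrier X then vnorm X (x \<ominus>\<^bsub>X\<^esub> y) else 0)"

definition norm_topology :: "'a normed_vs \<Rightarrow> 'a topology" where
  "norm_topology X = Metric_space.mtopology (carrier X) (vdist X)"

definition banach_space :: "'a normed_vs \<Rightarrow> bool" where
  "banach_space X \<longleftrightarrow> normed_space X \<and> Metric_space.mcomplete (carrier X) (vdist X)"

definition schauder_basis :: "'a normed_vs \<Rightarrow> (nat \<Rightarrow> 'a) \<Rightarrow> bool" where
  "schauder_basis X e \<longleftrightarrow>
     range e \<subseteq> carrier X \<and>
     (\<forall>x\<in>carrier X. \<exists>!a :: nat \<Rightarrow> real.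
        limitin (norm_topology X) (\<lambda>n. \<Oplus>\<^bsub>X\<^esub>i\<in>{..<n}. a i \<odot>\<^bsub>X\<^esub> e i) x sequentially)"

definition finite_dimensional :: "'a normed_vs \<Rightarrow> bool" where
  "finite_dimensional X \<longleftrightarrow>
     (\<exists>B. finite B \<and> B \<subseteq> carrier X \<and>
        (\<forall>x\<in>carrier X. \<exists>c :: 'a \<Rightarrow> real. x = (\<Oplus>\<^bsub>X\<^esub>b\<in>B. c b \<odot>\<^bsub>X\<^esub> b)))"

text \<open>Functionals are normalised to \<open>undefined\<close> outside the carrier, so that they are determined
  by their values on the space.\<close>

definition bounded_functionals :: "'a normed_vs \<Rightarrow> ('a \<Rightarrow> real) set" where
  "bounded_functionals X =
     {f \<in> extensional (carrier X).
        (\<forall>x\<in>carrier X. \<forall>y\<in>carrier X. f (x \<oplus>\<^bsub>X\<^esub> y) = f x + f y) \<and>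
        (\<forall>a. \<forall>x\<in>carrier X. f (a \<odot>\<^bsub>X\<^esub> x) = a * f x) \<and>
        (\<exists>C. \<forall>x\<in>carrier X. \<bar>f x\<bar> \<le> C * vnorm X x)}"

definition dual_space :: "'a normed_vs \<Rightarrow> ('a \<Rightarrow> real) normed_vs" where
  "dual_space X =
     \<lparr>carrier = bounded_functionals X,
      mult = (\<lambda>_ _. undefined),
      one = undefined,
      zero = (\<lambda>x\<in>carrier X. 0),
      add = (\<lambda>f g. \<lambda>x\<in>carrier X. f x + g x),
      smult = (\<lambda>a f. \<lambda>x\<in>carrier X. a * f x),
      vnorm = (\<lambda>f. SUP x\<in>{x \<in> carrier X. vnorm X x \<le> 1}. \<bar>f x\<bar>)\<rparr>"

abbreviation bidual_space :: "'a normed_vs \<Rightarrow> (('a \<Rightarrow> real) \<Rightarrow> real) normed_vs" where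
  "bidual_space X \<equiv> dual_space (dual_space X)"

definition canonical_embedding :: "'a normed_vs \<Rightarrow> 'a \<Rightarrow> ('a \<Rightarrow> real) \<Rightarrow> real" where
  "canonical_embedding X x = (\<lambda>f\<in>carrier (dual_space X). f x)"

definition canonical_image :: "'a normed_vs \<Rightarrow> (('a \<Rightarrow> real) \<Rightarrow> real) set" where
  "canonical_image X = canonical_embedding X ` carrier X"

definition reflexive_space :: "'a normed_vs \<Rightarrow> bool" where
  "reflexive_space X \<longleftrightarrow> canonical_image X = carrier (bidual_space X)"

text \<open>The quotient by a subspace \<open>H\<close>, with the quotient norm. Adding \<open>H\<close> in the scalar
  multiplication matters only for the scalar \<open>0\<close>.\<close>

definition quotient_space :: "'a normed_vs \<Rightarrow> 'a set \<Rightarrow> 'a set normed_vs" where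
  "quotient_space X H =
     \<lparr>carrier = a_rcosets\<^bsub>X\<^esub> H,
      mult = (\<lambda>_ _. undefined),
      one = undefined,
      zero = H,
      add = (\<lambda>A B. A <+>\<^bsub>X\<^esub> B),
      smult = (\<lambda>a A. H <+>\<^bsub>X\<^esub> ((\<lambda>x. a \<odot>\<^bsub>X\<^esub> x) ` A)),
      vnorm = (\<lambda>A. INF x\<in>A. vnorm X x)\<rparr>"

text \<open>Inserting \<open>0\<close> makes the supremum over the empty set, which arises for the zero subspace,
  equal to \<open>0\<close>.\<close>

definition norming :: "'a normed_vs \<Rightarrow> ('a \<Rightarrow> real) set \<Rightarrow> bool" where
  "norming X M \<longleftrightarrow>
     (\<exists>c>0. \<forall>x\<in>carrier X.
        Sup (insert 0 {\<bar>f x\<bar> / vnorm (dual_space X) f | f. f \<in> M \<and> f \<noteq> \<zero>\<^bsub>dual_space X\<^esub>})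
          \<ge> c * vnorm X x)"

abbreviation infinite_codimension :: "'a normed_vs \<Rightarrow> 'a set \<Rightarrow> bool" where
  "infinite_codimension X M \<equiv> \<not> finite_dimensional (quotient_space X M)"

end

theory Submission
  imports Defs
begin

text \<open>
  Let \<open>Y\<close> consist of the paths \<open>x\<close> in \<open>\<ell>\<^sup>2\<close> tending to \<open>0\<close> with \<open>x\<^sub>n\<close> supported on the first \<open>n\<close> coordinates,
  normed by the \<open>3/2\<close>-variation (a \<open>J\<close>-sum in the sense of James and Bellenot). The variation is
  written in dual form, as a supremum over weights \<open>c\<close> with \<open>\<Sum> c\<^sup>3 \<le> 1\<close>, which makes the triangle
  inequality trivial. The coordinate decomposition of \<open>Y\<close> is shrinking, since \<open>k\<close> normalised disjoint
  blocks have a sum of norm \<open>O(k\<^bsup>2/3\<^esup>) = o(k)\<close>. Hence \<open>Y\<^sup>*\<^sup>*\<close> is the space of all such paths of bounded variation, and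
  taking limits identifies \<open>Y\<^sup>*\<^sup>*/Y\<close> with \<open>\<ell>\<^sup>2\<close>.

  If \<open>M\<close> is closed and norming, then the limit map is bounded below on the annihilator of \<open>M\<close> in \<open>Y\<^sup>*\<^sup>*\<close>.
  If in addition \<open>M\<close> has infinite codimension, the annihilator contains elements with normalised
  limit vanishing up to any given time. Adding \<open>k\<close> of these, each starting after the earlier paths have
  settled and taken with a suitable sign, gives an element whose limit has norm at most \<open>\<surd>k\<close> but whose
  variation is at least of order \<open>k\<^bsup>2/3\<^esup>\<close>, a contradiction.
\<close>


text \<open>The exponent is squeezed from two sides. It exceeds \<open>1\<close>, so that sums of
  \<open>k\<close> blocks grow more slowly than \<open>k\<close> and no functional can charge
  infinitely many blocks equally. It stays below \<open>2\<close>, so that variation outgrows the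
  rate \<open>\<surd>k\<close> at which limits in a Hilbert space can be made to grow. The value
  \<open>3/2\<close> has the integer \<open>3\<close> as conjugate exponent, and for
  \<open>k = j\<^sup>3\<close> all roots disappear. Restricting time \<open>n\<close> to
  \<open>n\<close> coordinates makes every evaluation finite-dimensional: this yields a basis, and
  lets finitely many functionals force a path to vanish up to a given time, while the limit can
  still be any vector of l2. Hitting every limit is the delicate point. The truncations of a vector
  of l2 form a path with the right limit, but its \<open>3/2\<close>-variation may be infinite. Only
  finitely supported vectors are lifted directly; the others follow by successive approximation. The
  limit map is bounded below on the annihilator of \<open>M\<close> because its kernel is
  \<open>Y\<close>: an annihilating element near \<open>Y\<close> would give a vector of
  \<open>Y\<close> on which \<open>M\<close> is small, against norming.\<close>

section \<open>Typed models of carrier-based normed spaces\<close>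

text \<open>Limits, spans and bounded linear maps are available for types in
  \<open>real_normed_vector\<close>, not for carriers; a linear bijection \<open>\<rho>\<close>
  transports them. The two norms need only be equivalent, because the quotient norm on the bidual
  modulo \<open>Y\<close> is compared with that of \<open>l2\<close> only up to constants.
  Equivalence does not give the norm laws for \<open>vnorm\<close>, so these are assumed
  separately.\<close>

locale normed_rep =
  fixes X :: "'a normed_vs" and \<rho> :: "'x::real_normed_vector \<Rightarrow> 'a"
  assumes bij: "bij_betw \<rho> UNIV (carrier X)"
    and rep_zero: "\<rho> 0 = \<zero>\<^bsub>X\<^esub>"
    and rep_add: "\<rho> (x + y) = \<rho> x \<oplus>\<^bsub>X\<^esub> \<rho> y"
    and rep_scale: "\<rho> (a *\<^sub>R x) = a \<odot>\<^bsub>X\<^esub> \<rho> x"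
    and rep_triangle: "vnorm X (\<rho> (x + y)) \<le> vnorm X (\<rho> x) + vnorm X (\<rho> y)"
    and rep_homogeneous: "vnorm X (\<rho> (a *\<^sub>R x)) = \<bar>a\<bar> * vnorm X (\<rho> x)"
    and rep_lower: "\<exists>c. \<forall>x. norm x \<le> c * vnorm X (\<rho> x)"
    and rep_upper: "\<exists>C. \<forall>x. vnorm X (\<rho> x) \<le> C * norm x"
begin

definition unrep :: "'a \<Rightarrow> 'x" where "unrep = inv_into UNIV \<rho>"

lemma rep_carrier [simp]: "\<rho> x \<in> carrier X"
  using bij by (auto simp: bij_betw_def)

lemma unrep_rep [simp]: "unrep (\<rho> x) = x"
  using bij by (simp add: unrep_def bij_betw_def)

lemma rep_unrep [simp]: "a \<in> carrier X \<Longrightarrow> \<rho> (unrep a) = a"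
  using bij by (simp add: unrep_def bij_betw_def f_inv_into_f)

lemma rep_inject [simp]: "\<rho> x = \<rho> y \<longleftrightarrow> x = y"
  by (metis unrep_rep)

lemma carrier_eq: "carrier X = range \<rho>"
  using bij by (simp add: bij_betw_def)

lemma unrep_cases [case_names rep]:
  assumes "a \<in> carrier X" obtains x where "a = \<rho> x"
  using rep_unrep[OF assms] that by metis

lemma all_carrier_iff: "(\<forall>a\<in>carrier X. P a) \<longleftrightarrow> (\<forall>x. P (\<rho> x))"
  by (auto simp: carrier_eq)

lemma lower_pos: obtains c where "c > 0" "\<And>x. norm x \<le> c * vnorm X (\<rho> x)"
proof -
  obtain c where c: "\<And>x. norm x \<le> c * vnorm X (\<rho> x)" using rep_lower by blast
  have "vnorm X (\<rho> x) \<ge> 0" for x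
    using rep_triangle[of x "- x"] rep_homogeneous[of "-1" x] rep_homogeneous[of 0 0] by simp
  then have "norm x \<le> max c 1 * vnorm X (\<rho> x)" for x
    using c[of x] mult_right_mono[of c "max c 1" "vnorm X (\<rho> x)"] by simp
  then show ?thesis using that[of "max c 1"] by auto
qed

lemma upper_pos: obtains C where "C > 0" "\<And>x. vnorm X (\<rho> x) \<le> C * norm x"
proof -
  obtain C where C: "\<And>x. vnorm X (\<rho> x) \<le> C * norm x" using rep_upper by blast
  have "vnorm X (\<rho> x) \<le> max C 1 * norm x" for x
    using C[of x] mult_right_mono[of C "max C 1" "norm x"] by simp
  then show ?thesis using that[of "max C 1"] by auto
qed

lemma vnorm_rep_nonneg: "vnorm X (\<rho> x) \<ge> 0"
  by (rule lower_pos) (metis norm_ge_zero order_trans zero_le_mult_iff not_le)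

lemma vnorm_rep_eq_0_iff: "vnorm X (\<rho> x) = 0 \<longleftrightarrow> x = 0"
proof
  assume "vnorm X (\<rho> x) = 0"
  then show "x = 0" by (metis lower_pos mult_zero_right norm_le_zero_iff)
next
  show "x = 0 \<Longrightarrow> vnorm X (\<rho> x) = 0" using rep_homogeneous[of 0 0] by simp
qed

lemma vnorm_rep_zero [simp]: "vnorm X (\<rho> 0) = 0"
  by (simp add: vnorm_rep_eq_0_iff)

lemma module: "module real_ring X"
proof -
  have cr: "cring real_ring"
    by (unfold_locales) (auto simp: real_ring_def algebra_simps Units_def intro!: exI[of _ "- _"])
  have ag: "abelian_group X"
  proof (rule abelian_groupI)
    fix a b c assume "a \<in> carrier X" "b \<in> carrier X" "c \<in> carrier X"
    then obtain x y z where "a = \<rho> x" "b = \<rho> y" "c = \<rho> z" by (metis unrep_cases)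
    then show "a \<oplus>\<^bsub>X\<^esub> b \<oplus>\<^bsub>X\<^esub> c = a \<oplus>\<^bsub>X\<^esub> (b \<oplus>\<^bsub>X\<^esub> c)"
      by (simp add: add.assoc flip: rep_add)
  next
    fix a b assume "a \<in> carrier X" "b \<in> carrier X"
    then obtain x y where "a = \<rho> x" "b = \<rho> y" by (metis unrep_cases)
    then show "a \<oplus>\<^bsub>X\<^esub> b \<in> carrier X" "a \<oplus>\<^bsub>X\<^esub> b = b \<oplus>\<^bsub>X\<^esub> a"
      by (simp_all add: add.commute flip: rep_add)
  next
    fix a assume "a \<in> carrier X"
    then obtain x where a: "a = \<rho> x" by (metis unrep_cases)
    then show "\<zero>\<^bsub>X\<^esub> \<oplus>\<^bsub>X\<^esub> a = a" by (simp flip: rep_add rep_zero)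
    show "\<exists>b\<in>carrier X. b \<oplus>\<^bsub>X\<^esub> a = \<zero>\<^bsub>X\<^esub>"
      by (rule bexI[of _ "\<rho> (- x)"]) (simp_all add: a flip: rep_add rep_zero)
  qed (simp flip: rep_zero)
  show ?thesis
  proof (rule moduleI[OF cr ag])
    fix a b :: real and u assume "u \<in> carrier X"
    then obtain x where u: "u = \<rho> x" by (metis unrep_cases)
    show "a \<odot>\<^bsub>X\<^esub> u \<in> carrier X" by (simp add: u flip: rep_scale)
    show "(a \<oplus>\<^bsub>real_ring\<^esub> b) \<odot>\<^bsub>X\<^esub> u = (a \<odot>\<^bsub>X\<^esub> u) \<oplus>\<^bsub>X\<^esub> (b \<odot>\<^bsub>X\<^esub> u)"
      by (simp add: u real_ring_def scaleR_add_left flip: rep_scale rep_add)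
    show "(a \<otimes>\<^bsub>real_ring\<^esub> b) \<odot>\<^bsub>X\<^esub> u = a \<odot>\<^bsub>X\<^esub> (b \<odot>\<^bsub>X\<^esub> u)"
      by (simp add: u real_ring_def flip: rep_scale)
    show "\<one>\<^bsub>real_ring\<^esub> \<odot>\<^bsub>X\<^esub> u = u"
      by (simp add: u real_ring_def flip: rep_scale)
  next
    fix a :: real and u v assume "u \<in> carrier X" "v \<in> carrier X"
    then obtain x y where "u = \<rho> x" "v = \<rho> y" by (metis unrep_cases)
    then show "a \<odot>\<^bsub>X\<^esub> (u \<oplus>\<^bsub>X\<^esub> v) = (a \<odot>\<^bsub>X\<^esub> u) \<oplus>\<^bsub>X\<^esub> (a \<odot>\<^bsub>X\<^esub> v)"
      by (simp add: scaleR_add_right flip: rep_scale rep_add)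
  qed
qed

sublocale module real_ring X by (rule module)

lemma normed_space: "normed_space X"
proof (intro normed_space.intro module normed_space_axioms.intro)
  fix a u v assume "u \<in> carrier X" "v \<in> carrier X"
  then obtain x y where "u = \<rho> x" "v = \<rho> y" by (metis unrep_cases)
  then show "vnorm X (u \<oplus>\<^bsub>X\<^esub> v) \<le> vnorm X u + vnorm X v"
    using rep_triangle by (simp add: rep_add)
next
  fix u assume "u \<in> carrier X"
  then obtain x where u: "u = \<rho> x" by (metis unrep_cases)
  show "(vnorm X u = 0) = (u = \<zero>\<^bsub>X\<^esub>)" by (simp add: u vnorm_rep_eq_0_iff flip: rep_zero)
  show "vnorm X (a \<odot>\<^bsub>X\<^esub> u) = \<bar>a\<bar> * vnorm X u" for a
    by (simp add: u rep_homogeneous flip: rep_scale)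
qed

lemma rep_minus: "\<rho> (- x) = \<ominus>\<^bsub>X\<^esub> \<rho> x"
  by (rule M.minus_equality[symmetric]) (simp_all flip: rep_add rep_zero)

lemma rep_diff: "\<rho> (x - y) = \<rho> x \<ominus>\<^bsub>X\<^esub> \<rho> y"
  by (simp add: a_minus_def flip: rep_minus rep_add)

lemma vdist_rep: "vdist X (\<rho> x) (\<rho> y) = vnorm X (\<rho> (x - y))"
  by (simp add: vdist_def rep_diff)

lemma metric: "Metric_space (carrier X) (vdist X)"
proof
  show "0 \<le> vdist X a b" for a b
  proof (cases "a \<in> carrier X \<and> b \<in> carrier X")
    case True
    then show ?thesis by (elim conjE unrep_cases) (simp add: vdist_rep vnorm_rep_nonneg)
  qed (auto simp: vdist_def)
  show "vdist X a b = vdist X b a" for a b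
  proof (cases "a \<in> carrier X \<and> b \<in> carrier X")
    case True
    then obtain x y where "a = \<rho> x" "b = \<rho> y" by (metis unrep_cases)
    then show ?thesis using rep_homogeneous[of "-1" "x - y"] by (simp add: vdist_rep)
  qed (auto simp: vdist_def)
  fix a b c assume "a \<in> carrier X" "b \<in> carrier X" "c \<in> carrier X"
  then obtain x y z where abc: "a = \<rho> x" "b = \<rho> y" "c = \<rho> z" by (metis unrep_cases)
  show "(vdist X a b = 0) = (a = b)" by (simp add: abc vdist_rep vnorm_rep_eq_0_iff)
  show "vdist X a c \<le> vdist X a b + vdist X b c"
    using rep_triangle[of "x - y" "y - z"] by (simp add: abc vdist_rep)
qed

sublocale MS: Metric_space "carrier X" "vdist X" by (rule metric)

lemma limitin_rep:
  "limitin (norm_topology X) (\<lambda>i. \<rho> (u i)) (\<rho> x) F \<longleftrightarrow> (u \<longlongrightarrow> x) F"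
proof
  assume *: "limitin (norm_topology X) (\<lambda>i. \<rho> (u i)) (\<rho> x) F"
  show "(u \<longlongrightarrow> x) F"
  proof (rule tendstoI)
    fix e :: real assume e: "e > 0"
    obtain c where c: "c > 0" "\<And>x. norm x \<le> c * vnorm X (\<rho> x)" by (rule lower_pos) blast
    have "\<forall>\<^sub>F i in F. vdist X (\<rho> (u i)) (\<rho> x) < e / c"
      using * e c(1) by (simp add: norm_topology_def MS.limitin_metric)
    then show "\<forall>\<^sub>F i in F. dist (u i) x < e"
    proof eventually_elim
      case (elim i)
      have "norm (u i - x) \<le> c * vnorm X (\<rho> (u i - x))" by (rule c(2))
      also have "\<dots> < e" using elim c(1) by (simp add: vdist_rep field_simps)
      finally show ?case by (simp add: dist_norm)
    qed
  qed
next
  assume *: "(u \<longlongrightarrow> x) F"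
  obtain C where C: "C > 0" "\<And>x. vnorm X (\<rho> x) \<le> C * norm x" by (rule upper_pos) blast
  have "\<forall>\<^sub>F i in F. vdist X (\<rho> (u i)) (\<rho> x) < e" if e: "e > 0" for e
  proof -
    have "\<forall>\<^sub>F i in F. dist (u i) x < e / C" using tendstoD[OF *] e C(1) by simp
    then show ?thesis
    proof eventually_elim
      case (elim i)
      have "vnorm X (\<rho> (u i - x)) \<le> C * norm (u i - x)" by (rule C(2))
      also have "\<dots> < e" using elim C(1) by (simp add: dist_norm field_simps)
      finally show ?case by (simp add: vdist_rep)
    qed
  qed
  then show "limitin (norm_topology X) (\<lambda>i. \<rho> (u i)) (\<rho> x) F"
    by (simp add: norm_topology_def MS.limitin_metric)
qed

lemma finsum_rep: "finite A \<Longrightarrow> (\<Oplus>\<^bsub>X\<^esub>i\<in>A. \<rho> (f i)) = \<rho> (\<Sum>i\<in>A. f i)"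
proof (induction A rule: finite_induct)
  case (insert i A)
  then show ?case by (subst M.finsum_insert) (auto simp: rep_add)
qed (simp add: rep_zero)

lemma finite_dimensional_imp:
  assumes "finite_dimensional X"
  shows "\<exists>B :: 'x set. finite B \<and> span B = UNIV"
proof -
  obtain B where B: "finite B" "B \<subseteq> carrier X"
    and ex: "\<And>a. a \<in> carrier X \<Longrightarrow> \<exists>c :: 'a \<Rightarrow> real. a = (\<Oplus>\<^bsub>X\<^esub>b\<in>B. c b \<odot>\<^bsub>X\<^esub> b)"
    using assms unfolding finite_dimensional_def by blast
  have "x \<in> span (unrep ` B)" for x
  proof -
    obtain c where "\<rho> x = (\<Oplus>\<^bsub>X\<^esub>b\<in>B. c b \<odot>\<^bsub>X\<^esub> b)" using ex[of "\<rho> x"] by auto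
    also have "\<dots> = (\<Oplus>\<^bsub>X\<^esub>b\<in>B. \<rho> (c b *\<^sub>R unrep b))"
      using B by (intro M.finsum_cong') (auto simp: rep_scale subset_iff real_ring_def intro!: smult_closed)
    also have "\<dots> = \<rho> (\<Sum>b\<in>B. c b *\<^sub>R unrep b)" by (rule finsum_rep[OF B(1)])
    finally show ?thesis by (auto intro: span_sum span_scale span_base)
  qed
  then show ?thesis using B(1) by (intro exI[of _ "unrep ` B"]) auto
qed

lemma separable:
  assumes D: "countable D" "closure D = (UNIV :: 'x set)"
  shows "separable_space (norm_topology X)"
  unfolding separable_space_def
proof (intro exI conjI)
  show "countable (\<rho> ` D)" using D(1) by simp
  show "\<rho> ` D \<subseteq> topspace (norm_topology X)" by (auto simp: norm_topology_def)
  show "norm_topology X closure_of (\<rho> ` D) = topspace (norm_topology X)"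
  proof
    show "topspace (norm_topology X) \<subseteq> norm_topology X closure_of (\<rho> ` D)"
    proof
      fix a assume "a \<in> topspace (norm_topology X)"
      then obtain x where a: "a = \<rho> x" by (auto simp: norm_topology_def elim: unrep_cases)
      obtain u where u: "\<And>n. u n \<in> D" "u \<longlonglongrightarrow> x"
        using D(2) closure_sequential[of x D] by auto
      show "a \<in> norm_topology X closure_of (\<rho> ` D)"
      proof (rule limitin_closedin)
        show "limitin (norm_topology X) (\<lambda>n. \<rho> (u n)) a sequentially" using u(2) by (simp add: a limitin_rep)
        have "\<rho> ` D \<subseteq> norm_topology X closure_of (\<rho> ` D)"
          by (rule closure_of_subset) (auto simp: norm_topology_def)
        then show "\<forall>\<^sub>F n in sequentially. \<rho> (u n) \<in> norm_topology X closure_of (\<rho> ` D)"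
          using u(1) by (intro always_eventually) auto
      qed auto
    qed
  qed (rule closure_of_subset_topspace)
qed

text \<open>Boundedness is unaffected by passing to an equivalent norm, so duality on the carrier
  reduces to library functionals on the model. The constants may be negative, hence the absolute
  values in the proof.\<close>

lemma functional_iff:
  "f \<in> bounded_functionals X \<longleftrightarrow> f \<in> extensional (carrier X) \<and> bounded_linear (\<lambda>x. f (\<rho> x))"
proof (cases "f \<in> extensional (carrier X)")
  case True
  have "(\<exists>C. \<forall>x. \<bar>f (\<rho> x)\<bar> \<le> C * vnorm X (\<rho> x)) \<longleftrightarrow> (\<exists>K. \<forall>x. norm (f (\<rho> x)) \<le> norm x * K)"
  proof
    assume "\<exists>C. \<forall>x. \<bar>f (\<rho> x)\<bar> \<le> C * vnorm X (\<rho> x)"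
    then obtain C where C: "\<And>x. \<bar>f (\<rho> x)\<bar> \<le> C * vnorm X (\<rho> x)" by blast
    obtain U where U: "U > 0" "\<And>x. vnorm X (\<rho> x) \<le> U * norm x" by (rule upper_pos) blast
    have "norm (f (\<rho> x)) \<le> norm x * (\<bar>C\<bar> * U)" for x
    proof -
      have "\<bar>f (\<rho> x)\<bar> \<le> \<bar>C\<bar> * vnorm X (\<rho> x)"
        using C[of x] mult_right_mono[OF abs_ge_self[of C] vnorm_rep_nonneg[of x]] by linarith
      also have "\<dots> \<le> \<bar>C\<bar> * (U * norm x)" by (intro mult_left_mono U) auto
      finally show ?thesis by (simp add: mult_ac)
    qed
    then show "\<exists>K. \<forall>x. norm (f (\<rho> x)) \<le> norm x * K" by blast
  next
    assume "\<exists>K. \<forall>x. norm (f (\<rho> x)) \<le> norm x * K"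
    then obtain K where K: "\<And>x. norm (f (\<rho> x)) \<le> norm x * K" by blast
    obtain c where c: "c > 0" "\<And>x. norm x \<le> c * vnorm X (\<rho> x)" by (rule lower_pos) blast
    have "\<bar>f (\<rho> x)\<bar> \<le> (c * \<bar>K\<bar>) * vnorm X (\<rho> x)" for x
    proof -
      have "\<bar>f (\<rho> x)\<bar> \<le> norm x * \<bar>K\<bar>"
        using K[of x] mult_left_mono[OF abs_ge_self[of K] norm_ge_zero[of x]] unfolding real_norm_def by linarith
      also have "\<dots> \<le> (c * vnorm X (\<rho> x)) * \<bar>K\<bar>" by (intro mult_right_mono c) auto
      finally show ?thesis by (simp add: mult_ac)
    qed
    then show "\<exists>C. \<forall>x. \<bar>f (\<rho> x)\<bar> \<le> C * vnorm X (\<rho> x)" by blast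
  qed
  then show ?thesis using True
    by (auto simp: bounded_functionals_def all_carrier_iff bounded_linear_def bounded_linear_axioms_def
        linear_iff simp flip: rep_add rep_scale)
qed (auto simp: bounded_functionals_def)

lemma functional_vnorm_bdd_above:
  assumes "f \<in> bounded_functionals X"
  shows "bdd_above ((\<lambda>a. \<bar>f a\<bar>) ` {a \<in> carrier X. vnorm X a \<le> 1})"
proof -
  obtain C where C: "\<And>a. a \<in> carrier X \<Longrightarrow> \<bar>f a\<bar> \<le> C * vnorm X a"
    using assms unfolding bounded_functionals_def by blast
  show ?thesis
  proof (rule bdd_aboveI2)
    fix a assume a: "a \<in> {a \<in> carrier X. vnorm X a \<le> 1}"
    then have "vnorm X a \<ge> 0" by (metis (no_types, lifting) mem_Collect_eq unrep_cases vnorm_rep_nonneg)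
    have "\<bar>f a\<bar> \<le> C * vnorm X a" using C a by auto
    also have "\<dots> \<le> \<bar>C\<bar> * vnorm X a" using \<open>vnorm X a \<ge> 0\<close> by (intro mult_right_mono) auto
    also have "\<dots> \<le> \<bar>C\<bar> * 1" using a by (intro mult_left_mono) auto
    finally show "\<bar>f a\<bar> \<le> \<bar>C\<bar>" by simp
  qed
qed

lemma functional_le_dual_vnorm:
  assumes f: "f \<in> bounded_functionals X"
  shows "\<bar>f (\<rho> x)\<bar> \<le> vnorm (dual_space X) f * vnorm X (\<rho> x)"
proof (cases "x = 0")
  case True
  have "linear (\<lambda>x. f (\<rho> x))" using f by (simp add: functional_iff bounded_linear.linear)
  then have "f (\<rho> x) = 0" using True linear_0 by blast
  then show ?thesis using True vnorm_rep_eq_0_iff[of x] by simp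
next
  case False
  define r where "r = vnorm X (\<rho> x)"
  have r: "r > 0" using False vnorm_rep_nonneg[of x] vnorm_rep_eq_0_iff[of x] by (simp add: r_def less_eq_real_def)
  have "linear (\<lambda>x. f (\<rho> x))" using f by (simp add: functional_iff bounded_linear.linear)
  then have fr: "f (\<rho> ((1 / r) *\<^sub>R x)) = f (\<rho> x) / r"
    using linear_scale[of "\<lambda>x. f (\<rho> x)" "1 / r" x] by simp
  have "vnorm X (\<rho> ((1 / r) *\<^sub>R x)) = 1"
    unfolding rep_homogeneous using r by (simp add: r_def)
  then have "\<bar>f (\<rho> ((1 / r) *\<^sub>R x))\<bar> \<le> (SUP a\<in>{a \<in> carrier X. vnorm X a \<le> 1}. \<bar>f a\<bar>)"
    by (intro cSUP_upper functional_vnorm_bdd_above f) auto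
  then show ?thesis using r unfolding fr by (simp add: dual_space_def field_simps r_def)
qed

lemma dual_vnorm_le:
  assumes "\<And>x. \<bar>f (\<rho> x)\<bar> \<le> K * vnorm X (\<rho> x)" "K \<ge> 0"
  shows "vnorm (dual_space X) f \<le> K"
  unfolding dual_space_def normed_vs.simps
proof (rule cSUP_least)
  have "\<rho> 0 \<in> {a \<in> carrier X. vnorm X a \<le> 1}" by simp
  then show "{a \<in> carrier X. vnorm X a \<le> 1} \<noteq> {}" by (metis empty_iff)
  fix a assume a: "a \<in> {a \<in> carrier X. vnorm X a \<le> 1}"
  then have "\<bar>f a\<bar> \<le> K * vnorm X a" using assms(1)[of "unrep a"] by simp
  also have "\<dots> \<le> K * 1" using a assms(2) by (intro mult_left_mono) auto
  finally show "\<bar>f a\<bar> \<le> K" by simp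
qed

lemma canonical_embedding_functional:
  "canonical_embedding X (\<rho> x) \<in> bounded_functionals (dual_space X)"
  unfolding bounded_functionals_def[of "dual_space X"]
proof (intro CollectI conjI ballI allI)
  show "canonical_embedding X (\<rho> x) \<in> extensional (carrier (dual_space X))"
    by (simp add: canonical_embedding_def)
  fix f assume f: "f \<in> carrier (dual_space X)"
  then have bf: "bounded_linear (\<lambda>x. f (\<rho> x))" by (simp add: dual_space_def functional_iff)
  {
    fix g assume g: "g \<in> carrier (dual_space X)"
    then have bg: "bounded_linear (\<lambda>x. g (\<rho> x))" by (simp add: dual_space_def functional_iff)
    have "f \<oplus>\<^bsub>dual_space X\<^esub> g \<in> carrier (dual_space X)"
      using bounded_linear_add[OF bf bg] by (simp add: dual_space_def functional_iff)
    then show "canonical_embedding X (\<rho> x) (f \<oplus>\<^bsub>dual_space X\<^esub> g) =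
        canonical_embedding X (\<rho> x) f + canonical_embedding X (\<rho> x) g"
      using f g by (simp add: canonical_embedding_def) (simp add: dual_space_def)
  }
  have "a \<odot>\<^bsub>dual_space X\<^esub> f \<in> carrier (dual_space X)" for a
    using bounded_linear_const_mult[OF bf] by (simp add: dual_space_def functional_iff)
  then show "canonical_embedding X (\<rho> x) (a \<odot>\<^bsub>dual_space X\<^esub> f) = a * canonical_embedding X (\<rho> x) f" for a
    using f by (simp add: canonical_embedding_def) (simp add: dual_space_def)
next
  show "\<exists>C. \<forall>f\<in>carrier (dual_space X). \<bar>canonical_embedding X (\<rho> x) f\<bar> \<le> C * vnorm (dual_space X) f"
    by (rule exI[of _ "vnorm X (\<rho> x)"])
      (use functional_le_dual_vnorm[of _ x] in \<open>auto simp: canonical_embedding_def dual_space_def mult.commute\<close>)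
qed

end

text \<open>Reflexivity is invariant under isomorphism, so it suffices that the model is a Hilbert
  space satisfying Riesz representation; the norm of \<open>X\<close> itself need not come from an
  inner product.\<close>

locale hilbert_rep = normed_rep X \<rho> for X :: "'a normed_vs" and \<rho> :: "'x::real_inner \<Rightarrow> 'a" +
  assumes riesz: "bounded_linear f \<Longrightarrow> \<exists>v :: 'x. \<forall>x. f x = inner x v"
begin

lemma reflexive: "reflexive_space X"
  unfolding reflexive_space_def
proof
  show "canonical_image X \<subseteq> carrier (bidual_space X)"
    using canonical_embedding_functional by (auto simp: canonical_image_def carrier_eq dual_space_def[of "dual_space X"])
  show "carrier (bidual_space X) \<subseteq> canonical_image X"
  proof
    fix \<Phi> assume "\<Phi> \<in> carrier (bidual_space X)"
    then have ext: "\<Phi> \<in> extensional (carrier (dual_space X))"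
      and add: "\<And>f g. f \<in> carrier (dual_space X) \<Longrightarrow> g \<in> carrier (dual_space X) \<Longrightarrow> \<Phi> (f \<oplus>\<^bsub>dual_space X\<^esub> g) = \<Phi> f + \<Phi> g"
      and scale: "\<And>a f. f \<in> carrier (dual_space X) \<Longrightarrow> \<Phi> (a \<odot>\<^bsub>dual_space X\<^esub> f) = a * \<Phi> f"
      and "\<exists>C. \<forall>f\<in>carrier (dual_space X). \<bar>\<Phi> f\<bar> \<le> C * vnorm (dual_space X) f"
      unfolding dual_space_def[of "dual_space X"] bounded_functionals_def[of "dual_space X"] normed_vs.simps partial_object.simps
      by blast+
    then obtain C where C: "\<And>f. f \<in> carrier (dual_space X) \<Longrightarrow> \<bar>\<Phi> f\<bar> \<le> C * vnorm (dual_space X) f" by blast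
    \<comment> \<open>\<open>F v\<close> is the functional represented by \<open>v\<close>. Riesz is
      used twice: on \<open>v \<mapsto> \<Phi> (F v)\<close>, which produces the point
      \<open>x\<close>, and on an arbitrary functional, which shows that it is some
      \<open>F v\<close>.\<close>
    define F where "F v = (\<lambda>a\<in>carrier X. inner (unrep a) v)" for v
    have Fr [simp]: "F v (\<rho> x) = inner x v" for v x by (simp add: F_def)
    have Fc: "F v \<in> carrier (dual_space X)" for v
      by (simp add: dual_space_def functional_iff bounded_linear_inner_left) (simp add: F_def)
    obtain c where c: "c > 0" "\<And>x. norm x \<le> c * vnorm X (\<rho> x)" by (rule lower_pos) blast
    have Fn: "vnorm (dual_space X) (F v) \<le> norm v * c" for v
    proof (rule dual_vnorm_le)
      fix x
      have "\<bar>inner x v\<bar> \<le> norm x * norm v" by (rule Cauchy_Schwarz_ineq2)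
      also have "\<dots> \<le> (c * vnorm X (\<rho> x)) * norm v" by (intro mult_right_mono c) auto
      finally show "\<bar>F v (\<rho> x)\<bar> \<le> norm v * c * vnorm X (\<rho> x)" by (simp add: mult_ac)
    qed (use c in auto)
    have Fnn: "vnorm (dual_space X) (F v) \<ge> 0" for v
      unfolding dual_space_def normed_vs.simps
    proof (rule cSUP_upper2)
      show "bdd_above ((\<lambda>a. \<bar>F v a\<bar>) ` {a \<in> carrier X. vnorm X a \<le> 1})"
        using Fc[of v] by (intro functional_vnorm_bdd_above) (simp add: dual_space_def)
      show "\<rho> 0 \<in> {a \<in> carrier X. vnorm X a \<le> 1}" by simp
    qed simp
    have "bounded_linear (\<lambda>v. \<Phi> (F v))"
    proof (rule bounded_linear_intro)
      fix v w
      have "F (v + w) = F v \<oplus>\<^bsub>dual_space X\<^esub> F w"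
        by (auto simp: F_def dual_space_def inner_add_right fun_eq_iff)
      then show "\<Phi> (F (v + w)) = \<Phi> (F v) + \<Phi> (F w)" by (simp add: add Fc)
    next
      fix a v
      have "F (a *\<^sub>R v) = a \<odot>\<^bsub>dual_space X\<^esub> F v"
        by (auto simp: F_def dual_space_def fun_eq_iff)
      then show "\<Phi> (F (a *\<^sub>R v)) = a *\<^sub>R \<Phi> (F v)" by (simp add: scale Fc)
    next
      fix v
      have "\<bar>\<Phi> (F v)\<bar> \<le> C * vnorm (dual_space X) (F v)" by (rule C[OF Fc])
      also have "\<dots> \<le> \<bar>C\<bar> * vnorm (dual_space X) (F v)" using Fnn by (intro mult_right_mono) auto
      also have "\<dots> \<le> \<bar>C\<bar> * (norm v * c)" by (intro mult_left_mono Fn) auto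
      finally show "norm (\<Phi> (F v)) \<le> norm v * (\<bar>C\<bar> * c)" by (simp add: mult_ac)
    qed
    then obtain x where x: "\<And>v. \<Phi> (F v) = inner v x" using riesz by blast
    have "\<Phi> = canonical_embedding X (\<rho> x)"
    proof (rule extensionalityI[OF ext])
      show "canonical_embedding X (\<rho> x) \<in> extensional (carrier (dual_space X))"
        by (simp add: canonical_embedding_def)
      fix f assume f: "f \<in> carrier (dual_space X)"
      then have fe: "f \<in> extensional (carrier X)" and "bounded_linear (\<lambda>x. f (\<rho> x))"
        by (simp_all add: dual_space_def functional_iff)
      then obtain v where v: "\<And>y. f (\<rho> y) = inner y v" using riesz by blast
      have "f = F v"
        by (rule extensionalityI[OF fe, of "F v"]) (auto simp: carrier_eq v F_def)
      then show "\<Phi> f = canonical_embedding X (\<rho> x) f"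
        using f by (simp add: x canonical_embedding_def inner_commute)
    qed
    then show "\<Phi> \<in> canonical_image X" by (auto simp: canonical_image_def)
  qed
qed

end

locale banach_rep = normed_rep X \<rho> for X :: "'a normed_vs" and \<rho> :: "'x::banach \<Rightarrow> 'a"
begin

lemma banach_space: "banach_space X"
  unfolding banach_space_def MS.mcomplete_def
proof (intro conjI allI impI normed_space)
  fix \<sigma> assume C: "MS.MCauchy \<sigma>"
  then have car: "\<sigma> n \<in> carrier X" for n by (auto simp: MS.MCauchy_def)
  define u where "u n = unrep (\<sigma> n)" for n
  have \<sigma>: "\<sigma> = (\<lambda>n. \<rho> (u n))" using car by (simp add: u_def fun_eq_iff)
  obtain c where c: "c > 0" "\<And>x. norm x \<le> c * vnorm X (\<rho> x)" by (rule lower_pos) blast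
  have "Cauchy u"
  proof (rule metric_CauchyI)
    fix e :: real assume e: "e > 0"
    then have "e / c > 0" using c(1) by simp
    then obtain N where N: "\<And>m n. N \<le> m \<Longrightarrow> N \<le> n \<Longrightarrow> vdist X (\<sigma> m) (\<sigma> n) < e / c"
      using C unfolding MS.MCauchy_def by blast
    have "dist (u m) (u n) < e" if "N \<le> m" "N \<le> n" for m n
    proof -
      have "norm (u m - u n) \<le> c * vnorm X (\<rho> (u m - u n))" by (rule c(2))
      also have "\<dots> < e" using N[OF that] c(1) by (simp add: \<sigma> vdist_rep field_simps)
      finally show ?thesis by (simp add: dist_norm)
    qed
    then show "\<exists>M. \<forall>m\<ge>M. \<forall>n\<ge>M. dist (u m) (u n) < e" by blast
  qed
  then obtain x where "u \<longlonglongrightarrow> x" by (metis Cauchy_convergent convergent_def)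
  then have "limitin (norm_topology X) \<sigma> (\<rho> x) sequentially" by (simp add: \<sigma> limitin_rep)
  then show "\<exists>x. limitin MS.mtopology \<sigma> x sequentially" by (auto simp: norm_topology_def)
qed

end

text \<open>The dual norm is a supremum over the unit ball of \<open>X\<close>, so it equals the
  operator norm on the model only when the model is isometric.\<close>

locale iso_rep = normed_rep X \<rho> for X :: "'a normed_vs" and \<rho> :: "'x::real_normed_vector \<Rightarrow> 'a" +
  assumes rep_norm [simp]: "vnorm X (\<rho> x) = norm x"
begin

definition dual_rep :: "('x \<Rightarrow>\<^sub>L real) \<Rightarrow> 'a \<Rightarrow> real" where
  "dual_rep f = (\<lambda>a\<in>carrier X. blinfun_apply f (unrep a))"

lemma dual_rep_apply [simp]: "dual_rep f (\<rho> x) = blinfun_apply f x"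
  by (simp add: dual_rep_def)

lemma dual_rep_functional: "dual_rep f \<in> bounded_functionals X"
  by (simp add: functional_iff blinfun.bounded_linear_right) (simp add: dual_rep_def)

lemma functional_cases:
  assumes "f \<in> bounded_functionals X" obtains g where "f = dual_rep g"
proof
  have f: "f \<in> extensional (carrier X)" "bounded_linear (\<lambda>x. f (\<rho> x))"
    using assms by (simp_all add: functional_iff)
  show "f = dual_rep (Blinfun (\<lambda>x. f (\<rho> x)))"
    by (rule extensionalityI[OF f(1)]) (simp_all add: dual_rep_def bounded_linear_Blinfun_apply f(2))
qed

lemma dual_rep_norm: "vnorm (dual_space X) (dual_rep f) = norm f"
proof (rule antisym)
  show "vnorm (dual_space X) (dual_rep f) \<le> norm f"
    by (rule dual_vnorm_le) (use norm_blinfun[of f] in auto)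
  have *: "\<bar>blinfun_apply f x\<bar> \<le> vnorm (dual_space X) (dual_rep f) * norm x" for x
    using functional_le_dual_vnorm[OF dual_rep_functional, of f x] by simp
  show "norm f \<le> vnorm (dual_space X) (dual_rep f)"
  proof (rule norm_blinfun_bound)
    have "\<bar>dual_rep f (\<rho> 0)\<bar> \<le> (SUP a\<in>{a \<in> carrier X. vnorm X a \<le> 1}. \<bar>dual_rep f a\<bar>)"
      by (intro cSUP_upper functional_vnorm_bdd_above dual_rep_functional) simp
    then show "0 \<le> vnorm (dual_space X) (dual_rep f)" by (simp add: dual_space_def)
  qed (use * in simp)
qed

text \<open>The dual satisfies the same locale, so the construction iterates: a second application
  models the bidual by \<open>blinfun\<close> over \<open>blinfun\<close>.\<close>

lemma dual: "iso_rep (dual_space X) dual_rep"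
proof unfold_locales
  show "bij_betw dual_rep UNIV (carrier (dual_space X))"
    unfolding bij_betw_def
  proof
    show "inj dual_rep"
      by (rule injI, rule blinfun_eqI) (metis dual_rep_apply)
    show "range dual_rep = carrier (dual_space X)"
      using dual_rep_functional by (auto simp: dual_space_def elim: functional_cases)
  qed
  show "dual_rep 0 = \<zero>\<^bsub>dual_space X\<^esub>"
    by (auto simp: dual_space_def dual_rep_def fun_eq_iff)
  show "dual_rep (f + g) = dual_rep f \<oplus>\<^bsub>dual_space X\<^esub> dual_rep g" for f g
    by (auto simp: dual_space_def dual_rep_def fun_eq_iff blinfun.add_left)
  show "dual_rep (a *\<^sub>R f) = a \<odot>\<^bsub>dual_space X\<^esub> dual_rep f" for a f
    by (auto simp: dual_space_def dual_rep_def fun_eq_iff blinfun.scaleR_left)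
  show "vnorm (dual_space X) (dual_rep (f + g)) \<le> vnorm (dual_space X) (dual_rep f) + vnorm (dual_space X) (dual_rep g)" for f g
    by (simp add: dual_rep_norm norm_triangle_ineq)
  show "vnorm (dual_space X) (dual_rep (a *\<^sub>R f)) = \<bar>a\<bar> * vnorm (dual_space X) (dual_rep f)" for a f
    by (simp add: dual_rep_norm)
  show "\<exists>c. \<forall>f. norm f \<le> c * vnorm (dual_space X) (dual_rep f)"
    "\<exists>C. \<forall>f. vnorm (dual_space X) (dual_rep f) \<le> C * norm f"
    by (auto simp: dual_rep_norm intro!: exI[of _ 1])
  show "vnorm (dual_space X) (dual_rep f) = norm f" for f by (rule dual_rep_norm)
qed

section \<open>Cosets and quotients by subspaces\<close>

definition coset :: "'x set \<Rightarrow> 'x \<Rightarrow> 'a set" where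
  "coset S x = \<rho> ` {y. y - x \<in> S}"

lemma coset_eq: "\<rho> ` S +>\<^bsub>X\<^esub> \<rho> x = coset S x"
proof -
  have "\<rho> ` S +>\<^bsub>X\<^esub> \<rho> x = \<rho> ` ((\<lambda>s. s + x) ` S)"
    by (auto simp: a_r_coset_def' simp flip: rep_add)
  also have "(\<lambda>s. s + x) ` S = {y. y - x \<in> S}" by (force simp: image_iff)
  finally show ?thesis by (simp add: coset_def)
qed

lemma carrier_quotient: "carrier (quotient_space X (\<rho> ` S)) = range (coset S)"
  by (auto simp: quotient_space_def A_RCOSETS_def' carrier_eq coset_eq)

lemma coset_self: "subspace S \<Longrightarrow> coset S 0 = \<rho> ` S"
  by (simp add: coset_def)

lemma coset_add:
  assumes "subspace S"
  shows "coset S x <+>\<^bsub>X\<^esub> coset S y = coset S (x + y)"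
proof -
  have "coset S x <+>\<^bsub>X\<^esub> coset S y = \<rho> ` {u + v | u v. u - x \<in> S \<and> v - y \<in> S}"
    by (auto simp: set_add_def' coset_def simp flip: rep_add)
  also have "{u + v | u v. u - x \<in> S \<and> v - y \<in> S} = {w. w - (x + y) \<in> S}"
  proof (intro equalityI subsetI)
    fix w assume "w \<in> {u + v | u v. u - x \<in> S \<and> v - y \<in> S}"
    then obtain u v where uv: "w = u + v" "u - x \<in> S" "v - y \<in> S" by blast
    have "(u - x) + (v - y) \<in> S" using assms uv by (intro subspace_add)
    then show "w \<in> {w. w - (x + y) \<in> S}" using uv by (simp add: algebra_simps)
  next
    fix w assume "w \<in> {w. w - (x + y) \<in> S}"
    then have "w = (w - y) + y \<and> w - y - x \<in> S \<and> y - y \<in> S"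
      using subspace_0[OF assms] by (simp add: algebra_simps)
    then show "w \<in> {u + v | u v. u - x \<in> S \<and> v - y \<in> S}" by blast
  qed
  finally show ?thesis by (simp add: coset_def)
qed

lemma coset_scale:
  assumes S: "subspace S"
  shows "\<rho> ` S <+>\<^bsub>X\<^esub> ((\<lambda>u. a \<odot>\<^bsub>X\<^esub> u) ` coset S x) = coset S (a *\<^sub>R x)"
proof -
  have "\<rho> ` S <+>\<^bsub>X\<^esub> ((\<lambda>u. a \<odot>\<^bsub>X\<^esub> u) ` coset S x) = \<rho> ` {s + a *\<^sub>R u | s u. s \<in> S \<and> u - x \<in> S}"
    by (auto simp: set_add_def' coset_def simp flip: rep_add rep_scale)
  also have "{s + a *\<^sub>R u | s u. s \<in> S \<and> u - x \<in> S} = {w. w - a *\<^sub>R x \<in> S}"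
  proof (intro equalityI subsetI)
    fix w assume "w \<in> {s + a *\<^sub>R u | s u. s \<in> S \<and> u - x \<in> S}"
    then obtain s u where su: "w = s + a *\<^sub>R u" "s \<in> S" "u - x \<in> S" by blast
    have "s + a *\<^sub>R (u - x) \<in> S" using S su by (intro subspace_add subspace_scale)
    then show "w \<in> {w. w - a *\<^sub>R x \<in> S}" using su by (simp add: algebra_simps)
  next
    fix w assume "w \<in> {w. w - a *\<^sub>R x \<in> S}"
    then have "w = (w - a *\<^sub>R x) + a *\<^sub>R x \<and> w - a *\<^sub>R x \<in> S \<and> x - x \<in> S"
      using subspace_0[OF S] by simp
    then show "w \<in> {s + a *\<^sub>R u | s u. s \<in> S \<and> u - x \<in> S}" by blast
  qed
  finally show ?thesis by (simp add: coset_def)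
qed

lemma quotient_add [simp]:
  "subspace S \<Longrightarrow> coset S x \<oplus>\<^bsub>quotient_space X (\<rho> ` S)\<^esub> coset S y = coset S (x + y)"
  by (simp add: quotient_space_def coset_add)

lemma quotient_scale [simp]:
  "subspace S \<Longrightarrow> a \<odot>\<^bsub>quotient_space X (\<rho> ` S)\<^esub> coset S x = coset S (a *\<^sub>R x)"
  by (simp add: quotient_space_def coset_scale)

lemma quotient_zero: "subspace S \<Longrightarrow> \<zero>\<^bsub>quotient_space X (\<rho> ` S)\<^esub> = coset S 0"
  by (simp add: quotient_space_def coset_self)

lemma quotient_finsum:
  assumes S: "subspace S" and A: "finite A"
  shows "(\<Oplus>\<^bsub>quotient_space X (\<rho> ` S)\<^esub>i\<in>A. coset S (f i)) = coset S (\<Sum>i\<in>A. f i)"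
proof -
  interpret Q: abelian_monoid "quotient_space X (\<rho> ` S)"
    by (rule abelian_monoidI) (auto simp: carrier_quotient quotient_zero S add_ac)
  show ?thesis
    using A by (induction A rule: finite_induct) (auto simp: quotient_zero S carrier_quotient)
qed

lemma coset_eqI:
  assumes "subspace S" "x - y \<in> S"
  shows "coset S x = coset S y"
proof -
  have "z - x \<in> S \<longleftrightarrow> z - y \<in> S" for z
    using subspace_add[OF assms(1), of "z - x" "x - y"] subspace_diff[OF assms(1), of "z - y" "x - y"] assms(2)
    by auto
  then show ?thesis by (simp add: coset_def)
qed

lemma coset_eqD:
  assumes "subspace S" "coset S x = coset S y"
  shows "x - y \<in> S"
proof -
  have "\<rho> x \<in> coset S x" using subspace_0[OF assms(1)] by (simp add: coset_def)
  then show ?thesis unfolding assms(2) by (auto simp: coset_def)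
qed

text \<open>Modulo \<open>S\<close> the span of \<open>B \<union> S\<close> is generated by the
  cosets of \<open>B\<close>.\<close>

lemma finite_dimensional_quotient:
  assumes S: "subspace S" and B: "finite B" "span (B \<union> S) = UNIV"
  shows "finite_dimensional (quotient_space X (\<rho> ` S))"
proof -
  \<comment> \<open>\<open>finite_dimensional\<close> sums over a set of cosets, so two generators
    with the same coset would be merged into one term. Keeping one representative per coset makes
    reindexing exact, and the discarded generators differ from kept ones by elements of
    \<open>S\<close>.\<close>
  obtain B0 where B0: "B0 \<subseteq> B" "inj_on (coset S) B0" "coset S ` B = coset S ` B0"
    by (metis subset_image_inj subset_refl)
  have fin: "finite B0" using B0(1) B(1) finite_subset by blast
  have "B \<subseteq> span (B0 \<union> S)"
  proof
    fix b assume "b \<in> B"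
    then obtain b0 where b0: "b0 \<in> B0" "coset S b = coset S b0" using B0(3) by (metis imageE imageI)
    then have "b0 + (b - b0) \<in> span (B0 \<union> S)"
      by (intro span_add span_base UnI1 UnI2 coset_eqD[OF S]) auto
    then show "b \<in> span (B0 \<union> S)" by simp
  qed
  then have "span (B \<union> S) \<subseteq> span (B0 \<union> S)"
    by (intro span_minimal) (auto intro: span_base)
  then have sp: "span (B0 \<union> S) = UNIV" using B(2) by auto
  show ?thesis
    unfolding finite_dimensional_def
  proof (rule exI[of _ "coset S ` B0"], intro conjI ballI)
    show "finite (coset S ` B0)" using fin by simp
    show "coset S ` B0 \<subseteq> carrier (quotient_space X (\<rho> ` S))" by (auto simp: carrier_quotient)
    fix A assume "A \<in> carrier (quotient_space X (\<rho> ` S))"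
    then obtain x where A: "A = coset S x" by (auto simp: carrier_quotient)
    have "x \<in> span (B0 \<union> S)" using sp by simp
    then obtain u s where us: "x = u + s" "u \<in> span B0" "s \<in> S"
      unfolding span_Un using S by (auto simp: span_eq_iff[THEN iffD2])
    then obtain c where c: "u = (\<Sum>b\<in>B0. c b *\<^sub>R b)" using span_finite[OF fin] by auto
    define g where "g = inv_into B0 (coset S)"
    have g: "g (coset S b) = b" if "b \<in> B0" for b using that B0(2) by (simp add: g_def)
    have "A = coset S u" unfolding A using us by (intro coset_eqI S) simp
    also have "u = (\<Sum>\<beta>\<in>coset S ` B0. c (g \<beta>) *\<^sub>R g \<beta>)"
      unfolding c by (simp add: sum.reindex[OF B0(2)] g)
    also have "coset S \<dots> = (\<Oplus>\<^bsub>quotient_space X (\<rho> ` S)\<^esub>\<beta>\<in>coset S ` B0. coset S (c (g \<beta>) *\<^sub>R g \<beta>))"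
      using fin by (simp add: quotient_finsum[OF S])
    also have "\<dots> = (\<Oplus>\<^bsub>quotient_space X (\<rho> ` S)\<^esub>\<beta>\<in>coset S ` B0. c (g \<beta>) \<odot>\<^bsub>quotient_space X (\<rho> ` S)\<^esub> \<beta>)"
    proof -
      interpret Q: abelian_monoid "quotient_space X (\<rho> ` S)"
        by (rule abelian_monoidI) (auto simp: carrier_quotient quotient_zero S add_ac)
      show ?thesis by (rule Q.finsum_cong') (auto simp: S g carrier_quotient)
    qed
    finally show "\<exists>c. A = (\<Oplus>\<^bsub>quotient_space X (\<rho> ` S)\<^esub>\<beta>\<in>coset S ` B0. c \<beta> \<odot>\<^bsub>quotient_space X (\<rho> ` S)\<^esub> \<beta>)"
      by (rule exI[of _ "\<lambda>\<beta>. c (g \<beta>)"])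
  qed
qed

text \<open>First isomorphism theorem with norms: the coset attached to \<open>z\<close> is the
  fibre of \<open>T\<close> over \<open>z\<close>. Boundedness of \<open>T\<close> bounds
  \<open>norm z\<close> by the quotient norm, and the lift with constant \<open>K\<close> gives the
  reverse estimate.\<close>

lemma quotient_by_kernel:
  fixes T :: "'x \<Rightarrow> 'z::real_normed_vector"
  assumes T: "bounded_linear T" and lift: "\<And>z. \<exists>x. T x = z \<and> norm x \<le> K * norm z"
  shows "normed_rep (quotient_space X (\<rho> ` {x. T x = 0})) (\<lambda>z. \<rho> ` {x. T x = z})"
    (is "normed_rep ?W ?\<tau>")
proof -
  interpret T: bounded_linear T by fact
  let ?S = "{x. T x = 0}"
  have S: "subspace ?S" by (auto simp: subspace_def T.add T.scale T.zero)
  have \<tau>: "?\<tau> (T x) = coset ?S x" for x by (simp add: coset_def T.diff)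
  have surj: "\<exists>x. z = T x" for z using lift[of z] by metis
  define q where "q z = (INF x\<in>{x. T x = z}. norm x)" for z
  have ne: "{x. T x = z} \<noteq> {}" for z using surj[of z] by auto
  have bb: "bdd_below (norm ` {x. T x = z})" for z by (rule bdd_belowI2[of _ 0]) simp
  have q_le: "q z \<le> norm x" if "T x = z" for x z
    unfolding q_def by (rule cINF_lower[OF bb]) (use that in simp)
  have q_ge: "c \<le> q z" if "\<And>x. T x = z \<Longrightarrow> c \<le> norm x" for c z
    unfolding q_def by (rule cINF_greatest[OF ne]) (use that in simp)
  have vn: "vnorm ?W (?\<tau> z) = q z" for z
    by (simp add: quotient_space_def q_def image_image)
  have q0: "q 0 = 0" using q_le[of 0 0] q_ge[of 0 0] by (simp add: T.zero)
  have qs: "q (a *\<^sub>R z) \<le> \<bar>a\<bar> * q z" for a z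
  proof (cases "a = 0")
    case False
    have "q (a *\<^sub>R z) / \<bar>a\<bar> \<le> q z"
    proof (rule q_ge)
      fix x assume "T x = z"
      then have "q (a *\<^sub>R z) \<le> norm (a *\<^sub>R x)" by (intro q_le) (simp add: T.scale)
      then show "q (a *\<^sub>R z) / \<bar>a\<bar> \<le> norm x" using False by (simp add: field_simps)
    qed
    then show ?thesis using False by (simp add: field_simps)
  qed (simp add: q0)
  show ?thesis
  proof
    show "bij_betw ?\<tau> UNIV (carrier ?W)"
      unfolding bij_betw_def
    proof
      show "inj ?\<tau>"
      proof (rule injI)
        fix z w assume "?\<tau> z = ?\<tau> w"
        moreover obtain x where "z = T x" using surj by blast
        ultimately have "\<rho> x \<in> ?\<tau> w" by auto
        then show "z = w" using \<open>z = T x\<close> by auto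
      qed
      show "range ?\<tau> = carrier ?W"
      proof -
        have "range T = UNIV" using surj by blast
        then have "range ?\<tau> = ?\<tau> ` range T" by simp
        also have "\<dots> = range (\<lambda>x. coset ?S x)" by (simp only: image_image \<tau>)
        finally show ?thesis by (simp only: carrier_quotient)
      qed
    qed
    show "?\<tau> 0 = \<zero>\<^bsub>?W\<^esub>" by (simp add: quotient_space_def)
    show "?\<tau> (z + w) = ?\<tau> z \<oplus>\<^bsub>?W\<^esub> ?\<tau> w" for z w
    proof -
      obtain x y where "z = T x" "w = T y" using surj by metis
      then show ?thesis using \<tau>[of x] \<tau>[of y] \<tau>[of "x + y"] S by (simp add: T.add)
    qed
    show "?\<tau> (a *\<^sub>R z) = a \<odot>\<^bsub>?W\<^esub> ?\<tau> z" for a z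
    proof -
      obtain x where "z = T x" using surj by metis
      then show ?thesis using \<tau>[of x] \<tau>[of "a *\<^sub>R x"] S by (simp add: T.scale)
    qed
    show "vnorm ?W (?\<tau> (z + w)) \<le> vnorm ?W (?\<tau> z) + vnorm ?W (?\<tau> w)" for z w
    proof -
      have "q (z + w) - norm y \<le> q z" if "T y = w" for y
      proof (rule q_ge)
        fix x assume "T x = z"
        then have "q (z + w) \<le> norm (x + y)" using that by (intro q_le) (simp add: T.add)
        also have "\<dots> \<le> norm x + norm y" by (rule norm_triangle_ineq)
        finally show "q (z + w) - norm y \<le> norm x" by simp
      qed
      then have "q (z + w) - q z \<le> q w" by (intro q_ge) (simp add: algebra_simps)
      then show ?thesis by (simp add: vn)
    qed
    show "vnorm ?W (?\<tau> (a *\<^sub>R z)) = \<bar>a\<bar> * vnorm ?W (?\<tau> z)" for a z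
    proof (cases "a = 0")
      case False
      have "\<bar>a\<bar> * q z \<le> q (a *\<^sub>R z)" using qs[of "1 / a" "a *\<^sub>R z"] False by (simp add: field_simps)
      then show ?thesis using qs[of a z] by (simp add: vn)
    qed (simp add: vn q0)
    obtain C where C: "C > 0" "\<And>x. norm (T x) \<le> norm x * C" using T.pos_bounded by blast
    have "norm z \<le> C * q z" for z
    proof -
      have "norm z / C \<le> q z" by (rule q_ge) (use C in \<open>auto simp: field_simps\<close>)
      then show ?thesis using C(1) by (simp add: field_simps)
    qed
    then show "\<exists>c. \<forall>z. norm z \<le> c * vnorm ?W (?\<tau> z)" by (auto simp: vn)
    have "q z \<le> K * norm z" for z using lift[of z] q_le by (meson order_trans)
    then show "\<exists>C. \<forall>z. vnorm ?W (?\<tau> z) \<le> C * norm z" by (auto simp: vn)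
  qed
qed

end

section \<open>Separation of points from closed subspaces\<close>

text \<open>Partially defined functionals are represented by their graphs.\<close>

definition dominated_ext :: "('a::real_vector \<Rightarrow> real) \<Rightarrow> ('a \<times> real) set \<Rightarrow> bool" where
  "dominated_ext p G \<longleftrightarrow> subspace G \<and> (\<forall>(x, r)\<in>G. r \<le> p x)"

text \<open>Both \<open>(0, r - s)\<close> and \<open>(0, s - r)\<close> lie in the graph and are
  dominated by \<open>p 0 = 0\<close>. Domination thus makes a subspace single-valued by itself,
  which is why \<open>dominated_ext\<close> does not ask for it.\<close>

lemma dominated_ext_unique:
  assumes p: "p (0::'a::real_vector) = (0::real)" and G: "dominated_ext p G" "(x, r) \<in> G" "(x, s) \<in> G"
  shows "r = s"
proof -
  have "(0, r - s) \<in> G" "(0, s - r) \<in> G"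
    using subspace_diff[of G "(x, r)" "(x, s)"] subspace_diff[of G "(x, s)" "(x, r)"] G
    by (auto simp: dominated_ext_def)
  moreover have "b \<le> p a" if "(a, b) \<in> G" for a b using G(1) that by (auto simp: dominated_ext_def)
  ultimately have "r - s \<le> 0" "s - r \<le> 0" using p by metis+
  then show ?thesis by simp
qed

text \<open>Extension by one dimension. The value at \<open>z\<close> has to lie above all
  \<open>r - p (x - z)\<close> and below all \<open>p (y + z) - s\<close>; subadditivity says that
  the first family lies below the second, and \<open>c\<close> is the supremum of the first.\<close>

lemma dominated_ext_step:
  fixes p :: "'a::real_vector \<Rightarrow> real"
  assumes sub: "\<And>x y. p (x + y) \<le> p x + p y"
    and hom: "\<And>a x. a > 0 \<Longrightarrow> p (a *\<^sub>R x) = a * p x"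
    and G: "dominated_ext p G"
  shows "\<exists>c. dominated_ext p (span (insert (z, c) G))"
proof -
  have sG: "subspace G" and dG: "\<And>x r. (x, r) \<in> G \<Longrightarrow> r \<le> p x" using G by (auto simp: dominated_ext_def)
  define L where "L = (\<lambda>(x, r). r - p (x - z)) ` G"
  have le: "r - p (x - z) \<le> p (y + z) - s" if "(x, r) \<in> G" "(y, s) \<in> G" for x r y s
  proof -
    have "(x + y, r + s) \<in> G" using subspace_add[OF sG that] by simp
    then have "r + s \<le> p (x + y)" by (rule dG)
    also have "\<dots> \<le> p (x - z) + p (y + z)" using sub[of "x - z" "y + z"] by simp
    finally show ?thesis by linarith
  qed
  have "(0, 0) \<in> G" using subspace_0[OF sG] by (simp add: zero_prod_def)
  then have ne: "L \<noteq> {}" by (auto simp: L_def)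
  have bdd: "bdd_above L" using le[OF _ \<open>(0, 0) \<in> G\<close>] by (auto simp: L_def intro!: bdd_aboveI2)
  define c where "c = Sup L"
  have lo: "r - p (x - z) \<le> c" if "(x, r) \<in> G" for x r
    unfolding c_def by (rule cSup_upper[OF _ bdd]) (use that in \<open>force simp: L_def\<close>)
  have up: "c \<le> p (y + z) - s" if "(y, s) \<in> G" for y s
    unfolding c_def by (rule cSup_least[OF ne]) (use le that in \<open>auto simp: L_def\<close>)
  have "r \<le> p x" if "(x, r) \<in> span (insert (z, c) G)" for x r
  proof -
    from that obtain t where "(x, r) - t *\<^sub>R (z, c) \<in> span G" by (auto simp: span_insert)
    then have m: "(x - t *\<^sub>R z, r - t * c) \<in> G" using sG by (simp add: span_eq_iff[THEN iffD2])
    consider "t = 0" | "t > 0" | "t < 0" by linarith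
    then show ?thesis
    proof cases
      case 1 then show ?thesis using m dG by simp
    next
      case 2
      have "c \<le> p ((1 / t) *\<^sub>R (x - t *\<^sub>R z) + z) - (r - t * c) / t"
        using up[of "(1 / t) *\<^sub>R (x - t *\<^sub>R z)" "(r - t * c) / t"] subspace_scale[OF sG m, of "1 / t"] by simp
      also have "(1 / t) *\<^sub>R (x - t *\<^sub>R z) + z = (1 / t) *\<^sub>R x"
        using 2 by (simp add: scaleR_diff_right)
      also have "p ((1 / t) *\<^sub>R x) = p x / t" using 2 hom[of "1 / t" x] by simp
      finally show ?thesis using 2 by (simp add: field_simps)
    next
      case 3
      define s where "s = - t"
      have s: "s > 0" "t = - s" using 3 by (auto simp: s_def)
      have "(r + s * c) / s - p ((1 / s) *\<^sub>R (x + s *\<^sub>R z) - z) \<le> c"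
        using lo[of "(1 / s) *\<^sub>R (x + s *\<^sub>R z)" "(r + s * c) / s"] subspace_scale[OF sG m, of "1 / s"] s by simp
      also have "(1 / s) *\<^sub>R (x + s *\<^sub>R z) - z = (1 / s) *\<^sub>R x"
        using s by (simp add: scaleR_add_right)
      also have "p ((1 / s) *\<^sub>R x) = p x / s" using s hom[of "1 / s" x] by simp
      finally show ?thesis using s by (simp add: field_simps)
    qed
  qed
  then have "dominated_ext p (span (insert (z, c) G))" by (auto simp: dominated_ext_def)
  then show ?thesis by blast
qed

text \<open>Zorn's lemma on dominated graphs containing the line through \<open>(z, p z)\<close>; on
  the negative half of that line domination is \<open>- p z \<le> p (- z)\<close>. Attaining
  \<open>p z\<close> is what makes the functional nontrivial when \<open>p\<close> is a
  distance.\<close>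

theorem hahn_banach_dominated:
  fixes p :: "'a::real_vector \<Rightarrow> real"
  assumes sub: "\<And>x y. p (x + y) \<le> p x + p y"
    and hom: "\<And>a x. a > 0 \<Longrightarrow> p (a *\<^sub>R x) = a * p x" and p0: "p 0 = 0"
  shows "\<exists>f. linear f \<and> (\<forall>x. f x \<le> p x) \<and> f z = p z"
proof -
  have pm: "- p z \<le> p (- z)" using sub[of z "- z"] p0 by simp
  define G0 where "G0 = span {(z, p z)}"
  have "r \<le> p x" if xr: "(x, r) \<in> G0" for x r
  proof -
    obtain t where t: "x = t *\<^sub>R z" "r = t * p z" using xr by (auto simp: G0_def span_singleton)
    consider "t = 0" | "t > 0" | "t < 0" by linarith
    then show ?thesis
    proof cases
      case 3
      then have "p x = (- t) * p (- z)" using hom[of "- t" "- z"] t by simp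
      moreover have "(- t) * (- p z) \<le> (- t) * p (- z)" using 3 pm by (intro mult_left_mono) auto
      ultimately show ?thesis using t by simp
    qed (use t p0 hom in auto)
  qed
  then have G0: "dominated_ext p G0" by (auto simp: dominated_ext_def G0_def)
  define A where "A = {G. dominated_ext p G \<and> G0 \<subseteq> G}"
  have "\<exists>M\<in>A. \<forall>X\<in>A. M \<subseteq> X \<longrightarrow> X = M"
  proof (rule subset_Zorn_nonempty)
    show "A \<noteq> {}" using G0 by (auto simp: A_def)
    fix C assume C: "C \<noteq> {}" "subset.chain A C"
    have s: "subspace G" "G0 \<subseteq> G" "\<And>x r. (x, r) \<in> G \<Longrightarrow> r \<le> p x" if "G \<in> C" for G
      using that C(2) unfolding subset_chain_def A_def dominated_ext_def by blast+
    have tot: "G \<subseteq> H \<or> H \<subseteq> G" if "G \<in> C" "H \<in> C" for G H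
      using that C(2) unfolding subset_chain_def by blast
    have "subspace (\<Union>C)"
    proof (rule subspaceI)
      show "0 \<in> \<Union>C" 
      proof -
        obtain G where "G \<in> C" using C(1) by blast
        then show ?thesis using subspace_0[OF s(1)] by blast
      qed
      show "x + y \<in> \<Union>C" if "x \<in> \<Union>C" "y \<in> \<Union>C" for x y
      proof -
        from that obtain G H where GH: "G \<in> C" "H \<in> C" "x \<in> G" "y \<in> H" by blast
        then have "x + y \<in> G \<or> x + y \<in> H"
          using tot[OF GH(1,2)] s(1)[OF GH(1)] s(1)[OF GH(2)] subspace_add by blast
        then show ?thesis using GH by blast
      qed
      show "c *\<^sub>R x \<in> \<Union>C" if "x \<in> \<Union>C" for c x
      proof -
        obtain G where "G \<in> C" "x \<in> G" using \<open>x \<in> \<Union>C\<close> by blast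
        then show ?thesis using subspace_scale[OF s(1)] by blast
      qed
    qed
    then show "\<Union>C \<in> A" using s C(1) by (auto simp: A_def dominated_ext_def)
  qed
  then obtain M where MA: "M \<in> A" and maxA: "\<And>X. X \<in> A \<Longrightarrow> M \<subseteq> X \<Longrightarrow> X = M" by auto
  then have M: "dominated_ext p M" "G0 \<subseteq> M" by (auto simp: A_def)
  have max: "X = M" if "dominated_ext p X" "M \<subseteq> X" for X
    by (rule maxA) (use that M in \<open>auto simp: A_def\<close>)
  have "\<exists>r. (x, r) \<in> M" for x
  proof -
    obtain c where c: "dominated_ext p (span (insert (x, c) M))"
      using dominated_ext_step[OF sub hom M(1)] by blast
    \<comment> \<open>Maximality: extending by \<open>x\<close> adds nothing, so \<open>x\<close>
      already lies in the domain.\<close>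
    have "span (insert (x, c) M) = M"
      by (rule max[OF c]) (meson span_superset subset_insertI order_trans)
    then show ?thesis by (metis insertI1 span_base)
  qed
  then obtain f where f: "\<And>x. (x, f x) \<in> M" by metis
  have u: "r = f x" if "(x, r) \<in> M" for x r
    using dominated_ext_unique[OF p0 M(1) that f] .
  have sM: "subspace M" using M(1) by (simp add: dominated_ext_def)
  have "linear f"
  proof (rule linearI)
    show "f (x + y) = f x + f y" for x y
      using u[of "x + y" "f x + f y"] subspace_add[OF sM f[of x] f[of y]] by simp
    show "f (a *\<^sub>R x) = a *\<^sub>R f x" for a x
      using u[of "a *\<^sub>R x" "a * f x"] subspace_scale[OF sM f[of x], of a] by simp
  qed
  moreover have "f x \<le> p x" for x using M(1) f by (auto simp: dominated_ext_def)
  moreover have "f z = p z"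
    using u[of z "p z"] M(2) by (auto simp: G0_def intro: span_base)
  ultimately show ?thesis by blast
qed

section \<open>Separation by means of the distance to a subspace\<close>

lemma infdist_subspace_triangle:
  fixes M :: "'a::real_normed_vector set"
  assumes "subspace M"
  shows "infdist (x + y) M \<le> infdist x M + infdist y M"
proof -
  have ne: "M \<noteq> {}" using subspace_0[OF assms] by auto
  have "infdist (x + y) M \<le> infdist x M + infdist y M + e" if "e > 0" for e
  proof -
    have "\<exists>a\<in>M. dist z a < infdist z M + e / 2" for z
    proof -
      have "bdd_below (dist z ` M)" by (rule bdd_belowI2[of _ 0]) simp
      moreover have "(INF a\<in>M. dist z a) < infdist z M + e / 2" using that ne by (simp add: infdist_notempty)
      ultimately show ?thesis using ne by (simp add: cINF_less_iff)
    qed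
    then obtain a b where ab: "a \<in> M" "b \<in> M" "dist x a < infdist x M + e / 2" "dist y b < infdist y M + e / 2"
      by blast
    have "infdist (x + y) M \<le> dist (x + y) (a + b)"
      by (intro infdist_le subspace_add assms ab)
    also have "\<dots> \<le> dist x a + dist y b" by (rule dist_triangle_add)
    finally show ?thesis using ab by linarith
  qed
  then show ?thesis using field_le_epsilon by blast
qed

text \<open>Hahn-Banach with the distance to \<open>M\<close> as dominating function. It is zero on
  \<open>M\<close>, at most the norm, and positive at \<open>z\<close> because \<open>M\<close> is
  closed; applied to \<open>x\<close> and \<open>- x\<close>, domination gives both vanishing on
  \<open>M\<close> and boundedness.\<close>

lemma separate_closed_subspace:
  fixes M :: "'a::real_normed_vector set"
  assumes M: "subspace M" "closed M" and z: "z \<notin> M"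
  shows "\<exists>f. bounded_linear f \<and> (\<forall>x\<in>M. f x = (0::real)) \<and> f z = 1"
proof -
  have ne: "M \<noteq> {}" using subspace_0[OF M(1)] by auto
  have hom: "infdist (a *\<^sub>R x) M = a * infdist x M" if a: "a > 0" for a x
  proof (rule antisym)
    have le: "infdist (b *\<^sub>R y) M \<le> b * infdist y M" if b: "b > 0" for b y
    proof -
      have "infdist (b *\<^sub>R y) M / b \<le> (INF m\<in>M. dist y m)"
      proof (rule cINF_greatest[OF ne])
        fix m assume "m \<in> M"
        then have "infdist (b *\<^sub>R y) M \<le> dist (b *\<^sub>R y) (b *\<^sub>R m)"
          by (intro infdist_le subspace_scale M)
        also have "\<dots> = b * dist y m"
          using b by (simp add: dist_norm flip: scaleR_diff_right)
        finally show "infdist (b *\<^sub>R y) M / b \<le> dist y m" using b by (simp add: field_simps)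
      qed
      then show ?thesis using b ne by (simp add: infdist_notempty field_simps)
    qed
    show "infdist (a *\<^sub>R x) M \<le> a * infdist x M" by (rule le[OF a])
    show "a * infdist x M \<le> infdist (a *\<^sub>R x) M"
      using le[of "1 / a" "a *\<^sub>R x"] a by (simp add: field_simps)
  qed
  define d where "d = infdist z M"
  have d: "d > 0" unfolding d_def using M(2) ne z by (rule infdist_pos_not_in_closed)
  obtain f where f: "linear f" "\<And>x. f x \<le> infdist x M" "f z = infdist z M"
    using hahn_banach_dominated[of "\<lambda>x. infdist x M" z, OF infdist_subspace_triangle[OF M(1)] hom]
      subspace_0[OF M(1)] by auto
  interpret f: linear f by fact
  have dn: "infdist x M \<le> norm x" for x
    using infdist_le[OF subspace_0[OF M(1)], of x] by simp
  have "\<bar>f x\<bar> \<le> norm x * 1" for x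
    using f(2)[of x] f(2)[of "- x"] dn[of x] dn[of "- x"] by (simp add: f.neg)
  then have bl: "bounded_linear f"
    by (intro bounded_linear_intro[of f 1] f.add f.scale) auto
  have "f x = 0" if "x \<in> M" for x
    using f(2)[of x] f(2)[of "- x"] that subspace_neg[OF M(1) that] by (simp add: f.neg)
  moreover have "bounded_linear (\<lambda>x. f x / d)"
    using bounded_linear_compose[OF bounded_linear_divide bl] .
  ultimately show ?thesis using d f(3)
    by (intro exI[of _ "\<lambda>x. f x / d"]) (simp add: d_def)
qed

text \<open>A functional that vanishes on \<open>M\<close> and is \<open>1\<close> at
  \<open>z\<close> reads off the coefficient of \<open>z\<close>, so the enlarged space is the
  preimage of \<open>M\<close> under the continuous map
  \<open>x \<mapsto> x - f x *\<^sub>R z\<close>.\<close>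

lemma closed_subspace_insert:
  fixes M :: "'a::real_normed_vector set"
  assumes M: "subspace M" "closed M"
  shows "closed (span (insert z M))"
proof (cases "z \<in> M")
  case True
  then show ?thesis using M by (simp add: insert_absorb span_eq_iff[THEN iffD2])
next
  case False
  then obtain f where f: "bounded_linear f" "\<And>x. x \<in> M \<Longrightarrow> f x = (0::real)" "f z = 1"
    using separate_closed_subspace[OF M] by blast
  interpret f: bounded_linear f by fact
  have sM: "span M = M" using M by (simp add: span_eq_iff)
  have mem: "x \<in> span (insert z M) \<longleftrightarrow> x - f x *\<^sub>R z \<in> M" for x
  proof
    assume "x \<in> span (insert z M)"
    then obtain k where k: "x - k *\<^sub>R z \<in> M" unfolding span_breakdown_eq sM by blast
    then have "f x = k" using f(2)[OF k] f(3) by (simp add: f.diff f.scale)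
    with k show "x - f x *\<^sub>R z \<in> M" by simp
  qed (auto simp: span_breakdown_eq sM)
  then have "span (insert z M) = (\<lambda>x. x - f x *\<^sub>R z) -` M" by auto
  also have "closed \<dots>"
    by (intro continuous_closed_vimage M continuous_intros f.isCont)
  finally show ?thesis .
qed

lemma closed_subspace_union_finite:
  fixes M :: "'a::real_normed_vector set"
  assumes "finite B" "subspace M" "closed M"
  shows "closed (span (B \<union> M))"
  using assms(1)
proof (induction B)
  case empty
  then show ?case using assms(2,3) by (simp add: span_eq_iff[THEN iffD2])
next
  case (insert b B)
  have "span (insert b (span (B \<union> M))) = span (insert b (B \<union> M))"
    by (simp add: span_insert span_span)
  then show ?case using closed_subspace_insert[OF subspace_span insert.IH, of b] by simp
qed

section \<open>Square-summable sequences\<close>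

typedef l2 = "{f :: nat \<Rightarrow> real. summable (\<lambda>i. (f i)\<^sup>2)}"
  morphisms l2_nth Abs_l2
  by (rule exI[of _ "\<lambda>_. 0"]) simp

setup_lifting type_definition_l2

lemma summable_mult_of_squares:
  fixes f g :: "nat \<Rightarrow> real"
  assumes "summable (\<lambda>i. (f i)\<^sup>2)" "summable (\<lambda>i. (g i)\<^sup>2)"
  shows "summable (\<lambda>i. f i * g i)"
proof (rule summable_comparison_test')
  show "summable (\<lambda>i. (f i)\<^sup>2 + (g i)\<^sup>2)"
    using assms by (rule summable_add)
  show "norm (f i * g i) \<le> (f i)\<^sup>2 + (g i)\<^sup>2" if "i \<ge> 0" for i
  proof -
    have "2 * (\<bar>f i\<bar> * \<bar>g i\<bar>) \<le> (f i)\<^sup>2 + (g i)\<^sup>2" "0 \<le> \<bar>f i\<bar> * \<bar>g i\<bar>"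
      using sum_squares_bound[of "\<bar>f i\<bar>" "\<bar>g i\<bar>"] by simp_all
    then show ?thesis unfolding real_norm_def abs_mult by linarith
  qed
qed

lemma summable_add_squares:
  fixes f g :: "nat \<Rightarrow> real"
  assumes "summable (\<lambda>i. (f i)\<^sup>2)" "summable (\<lambda>i. (g i)\<^sup>2)"
  shows "summable (\<lambda>i. (f i + g i)\<^sup>2)"
  using summable_add[OF summable_add[OF assms] summable_mult[OF summable_mult_of_squares[OF assms], of 2]]
  by (simp add: power2_sum algebra_simps)

instantiation l2 :: real_vector
begin

lift_definition zero_l2 :: l2 is "\<lambda>_. 0" by simp
lift_definition plus_l2 :: "l2 \<Rightarrow> l2 \<Rightarrow> l2" is "\<lambda>f g i. f i + g i"
  by (rule summable_add_squares)
lift_definition uminus_l2 :: "l2 \<Rightarrow> l2" is "\<lambda>f i. - f i" by simp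
lift_definition minus_l2 :: "l2 \<Rightarrow> l2 \<Rightarrow> l2" is "\<lambda>f g i. f i - g i"
  subgoal for f g using summable_add_squares[of f "\<lambda>i. - g i"] by simp
  done
lift_definition scaleR_l2 :: "real \<Rightarrow> l2 \<Rightarrow> l2" is "\<lambda>a f i. a * f i"
  by (simp add: power_mult_distrib summable_mult)

instance
  by standard (transfer; simp add: algebra_simps fun_eq_iff)+

end

lemma l2_eqI: "(\<And>i. l2_nth x i = l2_nth y i) \<Longrightarrow> x = y"
  by transfer auto

lemma l2_nth_simps [simp]:
  "l2_nth 0 i = 0"
  "l2_nth (x + y) i = l2_nth x i + l2_nth y i"
  "l2_nth (x - y) i = l2_nth x i - l2_nth y i"
  "l2_nth (- x) i = - l2_nth x i"
  "l2_nth (a *\<^sub>R x) i = a * l2_nth x i"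
  by (transfer; simp)+

lemma l2_nth_sum [simp]: "l2_nth (\<Sum>k\<in>A. f k) i = (\<Sum>k\<in>A. l2_nth (f k) i)"
  by (induction A rule: infinite_finite_induct) auto

lemma summable_l2_squares: "summable (\<lambda>i. (l2_nth x i)\<^sup>2)"
  using l2_nth by auto

lemma summable_l2_mult: "summable (\<lambda>i. l2_nth x i * l2_nth y i)"
  by (intro summable_mult_of_squares summable_l2_squares)

instantiation l2 :: real_inner
begin

definition inner_l2 :: "l2 \<Rightarrow> l2 \<Rightarrow> real" where
  "inner_l2 x y = (\<Sum>i. l2_nth x i * l2_nth y i)"
definition norm_l2 :: "l2 \<Rightarrow> real" where "norm_l2 x = sqrt (inner x x)"
definition dist_l2 :: "l2 \<Rightarrow> l2 \<Rightarrow> real" where "dist_l2 x y = norm (x - y)"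
definition sgn_l2 :: "l2 \<Rightarrow> l2" where "sgn_l2 x = x /\<^sub>R norm x"
definition uniformity_l2 :: "(l2 \<times> l2) filter" where
  "uniformity_l2 = (INF e\<in>{0<..}. principal {(x, y). dist x y < e})"
definition open_l2 :: "l2 set \<Rightarrow> bool" where
  "open_l2 U \<longleftrightarrow> (\<forall>x\<in>U. eventually (\<lambda>(x', y). x' = x \<longrightarrow> y \<in> U) uniformity)"

instance
proof
  fix x y z :: l2 and r :: real
  show "inner x y = inner y x" by (simp add: inner_l2_def mult.commute)
  show "inner (x + y) z = inner x z + inner y z"
    by (simp add: inner_l2_def distrib_right suminf_add summable_l2_mult)
  show "inner (r *\<^sub>R x) y = r * inner x y"
    by (simp add: inner_l2_def mult.assoc suminf_mult summable_l2_mult)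
  show "0 \<le> inner x x"
    by (simp add: inner_l2_def suminf_nonneg summable_l2_mult)
  show "inner x x = 0 \<longleftrightarrow> x = 0"
    using suminf_eq_zero_iff[OF summable_l2_mult[of x x]]
    by (auto simp: inner_l2_def intro!: l2_eqI)
qed (simp_all add: norm_l2_def dist_l2_def sgn_l2_def uniformity_l2_def open_l2_def)

end

lemma norm_l2_power2: "(norm x)\<^sup>2 = (\<Sum>i. (l2_nth x i)\<^sup>2)"
  unfolding power2_norm_eq_inner by (simp add: inner_l2_def power2_eq_square)

lemma sum_squares_le_norm_l2: "finite A \<Longrightarrow> (\<Sum>i\<in>A. (l2_nth x i)\<^sup>2) \<le> (norm x)\<^sup>2"
  unfolding norm_l2_power2 by (intro sum_le_suminf summable_l2_squares) auto

lemma abs_l2_nth_le: "\<bar>l2_nth x i\<bar> \<le> norm x"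
  using sum_squares_le_norm_l2[of "{i}" x] power2_le_iff_abs_le[of "norm x" "l2_nth x i"] by simp

lemma bounded_linear_l2_nth: "bounded_linear (\<lambda>x. l2_nth x i)"
  by (rule bounded_linear_intro[where K = 1]) (auto simp: abs_l2_nth_le)

lemma l2_normI:
  assumes "\<And>n. (\<Sum>i<n. (f i)\<^sup>2) \<le> C\<^sup>2" "C \<ge> 0"
  shows "\<exists>x. (\<forall>i. l2_nth x i = f i) \<and> norm x \<le> C"
proof -
  have s: "summable (\<lambda>i. (f i)\<^sup>2)"
    by (rule summableI_nonneg_bounded[of _ "C\<^sup>2"]) (use assms in auto)
  define x where "x = Abs_l2 f"
  have x: "l2_nth x i = f i" for i using s by (simp add: x_def Abs_l2_inverse)
  have "(norm x)\<^sup>2 \<le> C\<^sup>2"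
    unfolding norm_l2_power2 x by (rule suminf_le_const[OF s assms(1)])
  with assms(2) x show ?thesis by (auto simp: power2_le_iff_abs_le)
qed

instance l2 :: banach
proof
  fix X :: "nat \<Rightarrow> l2" assume C: "Cauchy X"
  have "convergent (\<lambda>k. l2_nth (X k) i)" for i
    using bounded_linear.Cauchy[OF bounded_linear_l2_nth C] by (simp add: Cauchy_convergent)
  then obtain f where f: "\<And>i. (\<lambda>k. l2_nth (X k) i) \<longlonglongrightarrow> f i"
    unfolding convergent_def by metis
  \<comment> \<open>Only finite partial sums pass to the coordinatewise limit; a bound uniform in
    \<open>n\<close> then puts the difference into l2 with the same norm bound.\<close>
  have close: "\<exists>x. (\<forall>i. l2_nth x i = f i - l2_nth (X m) i) \<and> norm x \<le> e"
    if e: "e > 0" and m: "\<And>k. k \<ge> m \<Longrightarrow> norm (X k - X m) \<le> e" for e m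
  proof (rule l2_normI)
    fix n
    have "(\<lambda>k. \<Sum>i<n. (l2_nth (X k - X m) i)\<^sup>2) \<longlonglongrightarrow> (\<Sum>i<n. (f i - l2_nth (X m) i)\<^sup>2)"
      unfolding l2_nth_simps by (intro tendsto_intros f)
    moreover have "(\<Sum>i<n. (l2_nth (X k - X m) i)\<^sup>2) \<le> e\<^sup>2" if "k \<ge> m" for k
      using sum_squares_le_norm_l2[of "{..<n}" "X k - X m"] power_mono[OF m[OF that], of 2] by force
    ultimately show "(\<Sum>i<n. (f i - l2_nth (X m) i)\<^sup>2) \<le> e\<^sup>2"
      by (intro LIMSEQ_le_const2) auto
  qed (use e in auto)
  obtain m0 where "\<And>k. k \<ge> m0 \<Longrightarrow> norm (X k - X m0) < 1"
    using C unfolding Cauchy_iff by (metis order_refl zero_less_one)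
  then have "\<And>k. k \<ge> m0 \<Longrightarrow> norm (X k - X m0) \<le> 1" by (simp add: less_imp_le)
  from close[of 1 m0, OF _ this] obtain x0 where "\<And>i. l2_nth x0 i = f i - l2_nth (X m0) i"
    by auto
  then have x: "l2_nth (x0 + X m0) i = f i" for i by simp
  have "X \<longlonglongrightarrow> x0 + X m0"
  proof (rule LIMSEQ_I)
    fix r :: real assume "r > 0"
    then obtain M where M: "\<And>k l. k \<ge> M \<Longrightarrow> l \<ge> M \<Longrightarrow> norm (X k - X l) < r / 2"
      using C unfolding Cauchy_iff by (meson half_gt_zero)
    have "norm (X k - (x0 + X m0)) < r" if "k \<ge> M" for k
    proof -
      obtain y where y: "\<And>i. l2_nth y i = f i - l2_nth (X k) i" "norm y \<le> r / 2"
      proof -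
        have "norm (X l - X k) \<le> r / 2" if "l \<ge> k" for l
          using M[of l k] that \<open>k \<ge> M\<close> by simp
        from close[OF _ this] \<open>r > 0\<close> have "\<exists>y. (\<forall>i. l2_nth y i = f i - l2_nth (X k) i) \<and> norm y \<le> r / 2"
          by simp
        then show ?thesis using that by blast
      qed
      have "y = x0 + X m0 - X k" by (rule l2_eqI) (use x y in simp)
      with y(2) \<open>r > 0\<close> show ?thesis by (simp add: norm_minus_commute)
    qed
    then show "\<exists>M. \<forall>k\<ge>M. norm (X k - (x0 + X m0)) < r" by blast
  qed
  then show "convergent X" by (rule convergentI)
qed

section \<open>Unit vectors, truncations and duality in l2\<close>

lift_definition l2_unit :: "nat \<Rightarrow> l2" is "\<lambda>n i. if i = n then 1 else 0"
  subgoal for n by (rule summable_finite[of "{n}"]) auto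
  done

lemma l2_nth_unit [simp]: "l2_nth (l2_unit n) i = (if i = n then 1 else 0)"
  by transfer simp

lift_definition l2_trunc :: "nat \<Rightarrow> l2 \<Rightarrow> l2" is "\<lambda>n f i. if i < n then f i else 0"
  subgoal for n f by (rule summable_finite[of "{..<n}"]) auto
  done

lemma l2_nth_trunc [simp]: "l2_nth (l2_trunc n x) i = (if i < n then l2_nth x i else 0)"
  by transfer simp

lemma l2_trunc_eq_sum: "l2_trunc n x = (\<Sum>i<n. l2_nth x i *\<^sub>R l2_unit i)"
proof (rule l2_eqI)
  fix j
  have "(\<Sum>i<n. l2_nth (l2_nth x i *\<^sub>R l2_unit i) j) = (\<Sum>i<n. if i = j then l2_nth x j else 0)"
    by (intro sum.cong) auto
  then show "l2_nth (l2_trunc n x) j = l2_nth (\<Sum>i<n. l2_nth x i *\<^sub>R l2_unit i) j" by simp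
qed

lemma norm_l2_trunc_le: "norm (l2_trunc n x) \<le> norm x"
proof -
  have "(norm (l2_trunc n x))\<^sup>2 \<le> (norm x)\<^sup>2"
    unfolding norm_l2_power2 by (intro suminf_le summable_l2_squares) auto
  then show ?thesis by (simp add: power2_le_iff_abs_le)
qed

lemma inner_l2_unit: "inner x (l2_unit n) = l2_nth x n"
proof -
  have "(\<lambda>i. l2_nth x i * l2_nth (l2_unit n) i) sums (\<Sum>i\<in>{n}. l2_nth x i * l2_nth (l2_unit n) i)"
    by (rule sums_finite) auto
  then show ?thesis by (simp add: inner_l2_def sums_iff)
qed

lemma norm_l2_unit [simp]: "norm (l2_unit n) = 1"
  by (simp add: norm_eq_sqrt_inner inner_l2_unit)

lemma l2_trunc_tendsto: "(\<lambda>n. l2_trunc n x) \<longlonglongrightarrow> x"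
proof -
  have "(norm (x - l2_trunc n x))\<^sup>2 = (\<Sum>i. (l2_nth x (i + n))\<^sup>2)" for n
  proof -
    have "(\<Sum>i. (l2_nth (x - l2_trunc n x) i)\<^sup>2) = (\<Sum>i. (l2_nth (x - l2_trunc n x) (i + n))\<^sup>2) + (\<Sum>i<n. (l2_nth (x - l2_trunc n x) i)\<^sup>2)"
      by (rule suminf_split_initial_segment[OF summable_l2_squares])
    then show ?thesis by (simp add: norm_l2_power2)
  qed
  moreover have "(\<lambda>n. \<Sum>i. (l2_nth x (i + n))\<^sup>2) \<longlonglongrightarrow> 0"
    by (rule suminf_exist_split2[OF summable_l2_squares])
  ultimately have "(\<lambda>n. (norm (x - l2_trunc n x))\<^sup>2) \<longlonglongrightarrow> 0" by simp
  then have "(\<lambda>n. norm (x - l2_trunc n x)) \<longlonglongrightarrow> 0"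
    using tendsto_real_sqrt by fastforce
  then have "(\<lambda>n. norm (l2_trunc n x - x)) \<longlonglongrightarrow> 0" by (simp only: norm_minus_commute)
  then have "(\<lambda>n. l2_trunc n x - x) \<longlonglongrightarrow> 0" by (rule tendsto_norm_zero_cancel)
  then show ?thesis by (rule LIM_zero_cancel)
qed

text \<open>Testing \<open>f\<close> on the vector \<open>w\<close> of its own first
  \<open>n\<close> coefficients gives \<open>f w = (norm w)\<^sup>2\<close>, hence
  \<open>norm w \<le> K\<close>. The coefficients are therefore square-summable, and density of
  truncations finishes the proof.\<close>

lemma l2_riesz:
  fixes f :: "l2 \<Rightarrow> real"
  assumes "bounded_linear f"
  shows "\<exists>v. \<forall>x. f x = inner x v"
proof -
  interpret f: bounded_linear f by fact
  obtain K where K: "K \<ge> 0" "\<And>x. norm (f x) \<le> norm x * K" using f.nonneg_bounded by blast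
  have *: "f (\<Sum>i<n. g i *\<^sub>R l2_unit i) = (\<Sum>i<n. g i * f (l2_unit i))" for g :: "nat \<Rightarrow> real" and n
    by (simp add: f.sum f.scale)
  have "(\<Sum>i<n. (f (l2_unit i))\<^sup>2) \<le> K\<^sup>2" for n
  proof -
    define w where "w = (\<Sum>i<n. f (l2_unit i) *\<^sub>R l2_unit i)"
    define s where "s = (\<Sum>i<n. (f (l2_unit i))\<^sup>2)"
    have nth: "l2_nth w i = (if i < n then f (l2_unit i) else 0)" for i
    proof -
      have "(\<Sum>j<n. l2_nth (f (l2_unit j) *\<^sub>R l2_unit j) i) = (\<Sum>j<n. if j = i then f (l2_unit i) else 0)"
        by (intro sum.cong) auto
      then show ?thesis by (simp add: w_def)
    qed
    have "(\<lambda>i. (l2_nth w i)\<^sup>2) sums (\<Sum>i<n. (l2_nth w i)\<^sup>2)"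
      by (rule sums_finite) (auto simp: nth)
    then have "(norm w)\<^sup>2 = s" by (simp add: norm_l2_power2 sums_iff nth s_def)
    moreover have "f w = s" by (simp add: w_def * s_def power2_eq_square)
    ultimately have "(norm w)\<^sup>2 \<le> norm w * K" using K(2)[of w] by simp
    then have "norm w \<le> K" using K(1) by (cases "norm w = 0") (auto simp: power2_eq_square)
    then show ?thesis using \<open>(norm w)\<^sup>2 = s\<close> power_mono[of "norm w" K 2] by (simp add: s_def)
  qed
  from l2_normI[OF this K(1)] obtain v where v: "\<And>i. l2_nth v i = f (l2_unit i)" by blast
  have "f x = inner x v" for x
  proof (rule LIMSEQ_unique)
    show "(\<lambda>n. f (l2_trunc n x)) \<longlonglongrightarrow> f x" by (intro f.tendsto l2_trunc_tendsto)
    have "f (l2_trunc n x) = inner (l2_trunc n x) v" for n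
      unfolding l2_trunc_eq_sum
      by (simp add: * inner_sum_left inner_commute[of "l2_unit _"] inner_l2_unit v)
    then show "(\<lambda>n. f (l2_trunc n x)) \<longlonglongrightarrow> inner x v"
      by (simp add: tendsto_inner l2_trunc_tendsto)
  qed
  then show ?thesis by blast
qed

lemma l2_countable_dense: "\<exists>D :: l2 set. countable D \<and> closure D = UNIV"
proof -
  define g where "g qs = (\<Sum>i<length qs. of_rat (qs ! i) *\<^sub>R l2_unit i)" for qs :: "rat list"
  have "x \<in> closure (range g)" for x
  proof (rule closure_approachable[THEN iffD2], intro allI impI)
    fix e :: real assume e: "e > 0"
    obtain n where n: "dist (l2_trunc n x) x < e / 2"
      using l2_trunc_tendsto[of x] e unfolding lim_sequentially by (meson half_gt_zero order_refl)
    \<comment> \<open>The \<open>+ 1\<close> makes the total error \<open>n * d\<close> strictly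
      smaller than \<open>e / 2\<close>, also for \<open>n = 0\<close>.\<close>
    define d where "d = e / (2 * (real n + 1))"
    have d: "d > 0" using e by (simp add: d_def)
    have "\<exists>q. \<bar>l2_nth x i - of_rat q\<bar> < d" for i
    proof -
      obtain q where "l2_nth x i - d < of_rat q" "of_rat q < l2_nth x i + d"
        using of_rat_dense[of "l2_nth x i - d" "l2_nth x i + d"] d by auto
      then show ?thesis by (intro exI[of _ q]) auto
    qed
    then obtain q where q: "\<And>i. \<bar>l2_nth x i - of_rat (q i)\<bar> < d" by metis
    have "dist (g (map q [0..<n])) (l2_trunc n x) = norm (\<Sum>i<n. (of_rat (q i) - l2_nth x i) *\<^sub>R l2_unit i)"
      by (simp add: dist_norm g_def l2_trunc_eq_sum sum_subtractf algebra_simps)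
    also have "\<dots> \<le> (\<Sum>i<n. norm ((of_rat (q i) - l2_nth x i) *\<^sub>R l2_unit i))" by (rule norm_sum)
    also have "\<dots> \<le> (\<Sum>i<n. d)" using q by (intro sum_mono) (simp add: abs_minus_commute less_imp_le)
    also have "\<dots> < e / 2" using e by (simp add: d_def field_simps)
    finally have "dist (g (map q [0..<n])) x < e"
      using n dist_triangle[of "g (map q [0..<n])" x "l2_trunc n x"] by linarith
    then show "\<exists>y\<in>range g. dist y x < e" by blast
  qed
  then show ?thesis by (intro exI[of _ "range g"]) auto
qed

lemma l2_span_finite_neq:
  assumes "finite (B :: l2 set)"
  shows "span B \<noteq> UNIV"
proof
  assume s: "span B = UNIV"
  have "pairwise orthogonal (range l2_unit)"
    by (auto simp: pairwise_def orthogonal_def inner_l2_unit)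
  moreover have "0 \<notin> range l2_unit"
    by (metis norm_l2_unit norm_zero rangeE zero_neq_one)
  ultimately have "independent (range l2_unit)" by (rule pairwise_orthogonal_independent)
  with assms s have "finite (range l2_unit)" by (auto dest: independent_span_bound)
  moreover have "inj l2_unit"
    by (rule injI) (metis l2_nth_unit zero_neq_one)
  ultimately show False using finite_imageD infinite_UNIV_nat by blast
qed

section \<open>Weighted variation of paths\<close>

definition nonoverlapping :: "(nat \<times> nat) set \<Rightarrow> bool" where
  "nonoverlapping I \<longleftrightarrow> finite I \<and> (\<forall>p\<in>I. fst p < snd p) \<and>
     (\<forall>p\<in>I. \<forall>q\<in>I. p \<noteq> q \<longrightarrow> snd p \<le> fst q \<or> snd q \<le> fst p)"

definition weighted :: "(nat \<times> nat) set \<Rightarrow> (nat \<times> nat \<Rightarrow> real) \<Rightarrow> bool" where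
  "weighted I c \<longleftrightarrow> nonoverlapping I \<and> (\<forall>p\<in>I. 0 \<le> c p) \<and> (\<Sum>p\<in>I. c p ^ 3) \<le> 1"

definition wvar :: "(nat \<times> nat) set \<Rightarrow> (nat \<times> nat \<Rightarrow> real) \<Rightarrow> (nat \<Rightarrow> 'a::real_normed_vector) \<Rightarrow> real" where
  "wvar I c x = (\<Sum>p\<in>I. c p * norm (x (snd p) - x (fst p)))"

text \<open>A bound instead of a supremum, since a general path may have infinite variation; the
  supremum is formed only for the norm of \<open>jy\<close>.\<close>

definition var_le :: "(nat \<Rightarrow> 'a::real_normed_vector) \<Rightarrow> real \<Rightarrow> bool" where
  "var_le x B \<longleftrightarrow> (\<forall>I c. weighted I c \<longrightarrow> wvar I c x \<le> B)"

lemma nonoverlapping_subset: "nonoverlapping I \<Longrightarrow> J \<subseteq> I \<Longrightarrow> nonoverlapping J"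
  unfolding nonoverlapping_def by (meson finite_subset subsetD)

lemma nonoverlapping_finite: "nonoverlapping I \<Longrightarrow> finite I"
  by (simp add: nonoverlapping_def)

lemma weighted_subset:
  assumes "weighted I c" "J \<subseteq> I"
  shows "weighted J c"
proof -
  have "(\<Sum>p\<in>J. c p ^ 3) \<le> (\<Sum>p\<in>I. c p ^ 3)"
    using assms by (intro sum_mono2) (auto simp: weighted_def nonoverlapping_def)
  then show ?thesis using assms nonoverlapping_subset[of I J] by (auto simp: weighted_def)
qed

lemma weighted_le_1:
  assumes "weighted I c" "p \<in> I"
  shows "0 \<le> c p" "c p \<le> 1"
proof -
  show c0: "0 \<le> c p" using assms by (auto simp: weighted_def)
  have "c p ^ 3 \<le> (\<Sum>p\<in>I. c p ^ 3)"
    using assms by (intro member_le_sum) (auto simp: weighted_def nonoverlapping_def)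
  then have "c p ^ Suc 2 \<le> 1 ^ Suc 2" using assms by (simp add: weighted_def numeral_3_eq_3)
  then show "c p \<le> 1" by (rule power_le_imp_le_base) simp
qed

lemma weighted_singleton: "a < b \<Longrightarrow> weighted {(a, b)} (\<lambda>_. 1)"
  by (simp add: weighted_def nonoverlapping_def)

lemma wvar_add_le:
  assumes "\<And>p. p \<in> I \<Longrightarrow> 0 \<le> c p"
  shows "wvar I c (\<lambda>n. x n + y n) \<le> wvar I c x + wvar I c y"
  unfolding wvar_def sum.distrib[symmetric] distrib_left[symmetric]
  by (intro sum_mono mult_left_mono assms) (auto simp: add_diff_add intro: norm_triangle_ineq)

lemma wvar_scale: "wvar I c (\<lambda>n. a *\<^sub>R x n) = \<bar>a\<bar> * wvar I c x"
  by (simp add: wvar_def sum_distrib_left mult_ac flip: scaleR_diff_right)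

lemma wvar_weight_scale: "wvar I (\<lambda>p. a * c p) x = a * wvar I c x"
  by (simp add: wvar_def sum_distrib_left mult_ac)

lemma var_le_add:
  assumes "var_le x A" "var_le y B"
  shows "var_le (\<lambda>n. x n + y n) (A + B)"
  unfolding var_le_def
proof (intro allI impI)
  fix I c assume w: "weighted I c"
  have "wvar I c (\<lambda>n. x n + y n) \<le> wvar I c x + wvar I c y"
    by (rule wvar_add_le) (use weighted_le_1[OF w] in auto)
  also have "\<dots> \<le> A + B" using assms w by (intro add_mono) (auto simp: var_le_def)
  finally show "wvar I c (\<lambda>n. x n + y n) \<le> A + B" .
qed

lemma var_le_scale: "var_le x A \<Longrightarrow> var_le (\<lambda>n. a *\<^sub>R x n) (\<bar>a\<bar> * A)"
  unfolding var_le_def wvar_scale by (simp add: mult_left_mono)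

lemma var_le_increment: "var_le x B \<Longrightarrow> a < b \<Longrightarrow> norm (x b - x a) \<le> B"
  using weighted_singleton[of a b] unfolding var_le_def by (fastforce simp: wvar_def)

lemma wvar_le_scaled:
  assumes x: "var_le x B" and I: "nonoverlapping I" "\<And>p. p \<in> I \<Longrightarrow> 0 \<le> c p"
    and s: "(\<Sum>p\<in>I. c p ^ 3) \<le> s ^ 3" "s > 0"
  shows "wvar I c x \<le> s * B"
proof -
  have "weighted I (\<lambda>p. (1 / s) * c p)"
    using I s by (auto simp: weighted_def power_divide simp flip: sum_divide_distrib)
  then have "wvar I (\<lambda>p. (1 / s) * c p) x \<le> B" using x by (simp add: var_le_def)
  then show ?thesis unfolding wvar_weight_scale using s(2) by (simp add: field_simps)
qed

text \<open>Linearisation of the cube root by \<open>s \<le> s\<^sup>3 / r\<^sup>2 + r\<close>: unlike the root, the right-hand side is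
  additive over disjoint families.\<close>

lemma wvar_le_linear:
  assumes x: "var_le x B" and I: "nonoverlapping I" "\<And>p. p \<in> I \<Longrightarrow> 0 \<le> c p" and r: "r > 0" and B: "B \<ge> 0"
  shows "wvar I c x \<le> ((\<Sum>p\<in>I. c p ^ 3) / r\<^sup>2 + r) * B"
proof -
  define S where "S = (\<Sum>p\<in>I. c p ^ 3)"
  have S0: "S \<ge> 0" unfolding S_def using I by (intro sum_nonneg) auto
  show ?thesis
  proof (cases "S \<le> r ^ 3")
    case True
    have "wvar I c x \<le> r * B" by (rule wvar_le_scaled[OF x I]) (use True r in \<open>auto simp: S_def\<close>)
    also have "\<dots> \<le> (S / r\<^sup>2 + r) * B" using S0 B by (intro mult_right_mono) auto
    finally show ?thesis by (simp add: S_def)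
  next
    case False
    then have "S > 0" using r by (smt (verit) zero_less_power)
    define s where "s = root 3 S"
    have s: "s > 0" "s ^ 3 = S" using \<open>S > 0\<close> by (simp_all add: s_def)
    have "r < s" using False s r by (smt (verit) power_mono)
    then have "r\<^sup>2 * s \<le> s\<^sup>2 * s" using r by (intro mult_right_mono power_mono) auto
    then have "s \<le> S / r\<^sup>2" using r s(2) by (simp add: field_simps power2_eq_square power3_eq_cube)
    have "wvar I c x \<le> s * B" by (rule wvar_le_scaled[OF x I]) (use s in \<open>auto simp: S_def\<close>)
    also have "\<dots> \<le> (S / r\<^sup>2 + r) * B" using \<open>s \<le> S / r\<^sup>2\<close> r B by (intro mult_right_mono) auto
    finally show ?thesis by (simp add: S_def)
  qed
qed

text \<open>The half-open intervals from \<open>fst p\<close> (excluded) to \<open>snd p\<close>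
  (included) are disjoint, so at most one contains \<open>k\<close>. Cutting a path at
  \<open>k\<close> thus disturbs a single increment.\<close>

lemma card_crossing_le_1:
  assumes "nonoverlapping I"
  shows "(\<Sum>p\<in>I. of_bool (fst p < k \<and> k \<le> snd p)) \<le> (1 :: real)"
proof -
  have fin: "finite I" using assms by (simp add: nonoverlapping_def)
  have "p = q" if "p \<in> I" "q \<in> I" "fst p < k" "k \<le> snd p" "fst q < k" "k \<le> snd q" for p q
  proof (rule ccontr)
    assume "p \<noteq> q"
    then have "snd p \<le> fst q \<or> snd q \<le> fst p" using assms that(1,2) unfolding nonoverlapping_def by blast
    then show False using that(3-6) by linarith
  qed
  then have "card {p \<in> I. fst p < k \<and> k \<le> snd p} \<le> 1"
    using fin by (auto simp: card_le_Suc0_iff_eq)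
  then show ?thesis using fin by (simp add: Int_def flip: of_nat_sum)
qed

lemma tail_weighted_small:
  assumes x: "var_le x B" and e: "e > 0"
  shows "\<exists>m. \<forall>I c. weighted I c \<longrightarrow> (\<forall>p\<in>I. m \<le> fst p) \<longrightarrow> wvar I c x \<le> e"
proof (rule ccontr)
  assume "\<not> ?thesis"
  then have far: "\<exists>I c. weighted I c \<and> (\<forall>p\<in>I. m \<le> fst p) \<and> wvar I c x > e" for m
    by (meson not_le)
  have claim: "\<exists>I c M. nonoverlapping I \<and> (\<forall>p\<in>I. 0 \<le> c p \<and> snd p \<le> M) \<and> (\<Sum>p\<in>I. c p ^ 3) \<le> real k \<and>
      real k * e \<le> wvar I c x" for k
  proof (induction k)
    case 0
    show ?case by (rule exI[of _ "{}"]) (simp add: nonoverlapping_def wvar_def)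
  next
    case (Suc k)
    then obtain I c M where I: "nonoverlapping I" "\<And>p. p \<in> I \<Longrightarrow> 0 \<le> c p \<and> snd p \<le> M"
      "(\<Sum>p\<in>I. c p ^ 3) \<le> real k" "real k * e \<le> wvar I c x" by blast
    obtain J d where J: "weighted J d" "\<And>p. p \<in> J \<Longrightarrow> M \<le> fst p" "wvar J d x > e" using far[of M] by blast
    have no: "nonoverlapping J" using J(1) by (simp add: weighted_def)
    have fin: "finite I" "finite J" using I(1) no by (auto simp: nonoverlapping_def)
    have lt: "fst p < snd p" if "p \<in> I" for p using I(1) that by (auto simp: nonoverlapping_def)
    have disj: "p \<notin> J" if "p \<in> I" for p using lt[OF that] I(2)[OF that] J(2)[of p] by auto
    then have disj': "I \<inter> J = {}" by blast
    define g where "g p = (if p \<in> I then c p else d p)" for p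
    have gI: "g p = c p" if "p \<in> I" for p using that by (simp add: g_def)
    have gJ: "g p = d p" if "p \<in> J" for p using that disj[of p] unfolding g_def by metis
    have "snd p \<le> fst q" if "p \<in> I" "q \<in> J" for p q using I(2)[OF that(1)] J(2)[OF that(2)] by simp
    then have 1: "nonoverlapping (I \<union> J)" using I(1) no unfolding nonoverlapping_def by (metis Un_iff finite_Un)
    have 2: "(\<Sum>p\<in>I \<union> J. g p ^ 3) \<le> real (Suc k)"
      using I(3) J(1) by (simp add: sum.union_disjoint[OF fin disj'] gI gJ weighted_def)
    have 3: "real (Suc k) * e \<le> wvar (I \<union> J) g x"
      using I(4) J(3) by (simp add: wvar_def sum.union_disjoint[OF fin disj'] gI gJ algebra_simps)
    have 4: "0 \<le> g p \<and> snd p \<le> max M (Max (snd ` (I \<union> J)))" if "p \<in> I \<union> J" for p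
    proof -
      have "snd p \<le> Max (snd ` (I \<union> J))" using fin that by (intro Max_ge) auto
      moreover have "0 \<le> g p" using that I(2)[of p] weighted_le_1(1)[OF J(1), of p] by (auto simp: g_def)
      ultimately show ?thesis by simp
    qed
    show ?case using 1 2 3 4 by blast
  qed
  have "e * real (j * j) \<le> B" if j: "j > 0" for j :: nat
  proof -
    obtain I c M where I: "nonoverlapping I" "\<And>p. p \<in> I \<Longrightarrow> 0 \<le> c p \<and> snd p \<le> M"
      "(\<Sum>p\<in>I. c p ^ 3) \<le> real (j ^ 3)" "real (j ^ 3) * e \<le> wvar I c x" using claim[of "j ^ 3"] by blast
    have "wvar I c x \<le> real j * B"
      by (rule wvar_le_scaled[OF x I(1)]) (use I j in auto)
    then have "real j * (e * real (j * j)) \<le> real j * B" using I(4) by (simp add: power3_eq_cube mult_ac)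
    then show ?thesis using j by simp
  qed
  note bound = this
  obtain j :: nat where j: "real j > B / e" using reals_Archimedean2 by blast
  have "B \<ge> 0" using x unfolding var_le_def by (force simp: weighted_def nonoverlapping_def wvar_def)
  then have "0 \<le> B / e" using e by simp
  then have j0: "j > 0" using j by (intro gr0I) auto
  then have jB: "e * real (j * j) \<le> B" by (rule bound)
  have "real j \<le> real (j * j)" using j0 by simp
  then have "e * real j \<le> e * real (j * j)" using e by (intro mult_left_mono) auto
  moreover have "B < e * real j" using j e by (simp add: field_simps)
  ultimately show False using jB by linarith
qed

text \<open>Tail smallness applied to a single interval of weight \<open>1\<close>. This is what
  gives elements of the bidual a limit.\<close>

lemma var_le_Cauchy:
  assumes "var_le x B"
  shows "Cauchy x"
proof (rule metric_CauchyI)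
  fix e :: real assume e: "e > 0"
  obtain m where m: "\<And>I c. weighted I c \<Longrightarrow> (\<forall>p\<in>I. m \<le> fst p) \<Longrightarrow> wvar I c x \<le> e / 2"
    using tail_weighted_small[OF assms, of "e / 2"] e by auto
  have *: "dist (x a) (x b) < e" if "m \<le> a" "a < b" for a b
    using m[OF weighted_singleton[OF that(2)]] that(1) e by (simp add: wvar_def dist_norm norm_minus_commute)
  have "dist (x a) (x b) < e" if "m \<le> a" "m \<le> b" for a b
    using *[of a b] *[of b a] that e by (cases a b rule: linorder_cases) (auto simp: dist_commute)
  then show "\<exists>M. \<forall>a\<ge>M. \<forall>b\<ge>M. dist (x a) (x b) < e" by blast
qed

section \<open>Cutting paths at a given time\<close>

definition head :: "nat \<Rightarrow> (nat \<Rightarrow> 'a::real_normed_vector) \<Rightarrow> nat \<Rightarrow> 'a" where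
  "head m x n = (if n < m then x n else 0)"

lemma sum_crossing_le:
  fixes d :: real
  assumes "nonoverlapping I" "d \<ge> 0"
  shows "(\<Sum>p\<in>I. of_bool (fst p < k \<and> k \<le> snd p) * d) \<le> d"
  using mult_right_mono[OF card_crossing_le_1[OF assms(1), of k] assms(2)]
  by (simp flip: sum_distrib_right)

lemma wvar_filter:
  "finite I \<Longrightarrow> (\<Sum>p\<in>I. if P p then c p * norm (x (snd p) - x (fst p)) else 0) = wvar {p \<in> I. P p} c x"
  unfolding wvar_def by (simp add: sum.inter_filter)

text \<open>Intervals before the cut are unchanged and those after it contribute nothing; the one
  crossing interval sees a value of norm at most \<open>d\<close> with weight at most
  \<open>1\<close>.\<close>

lemma wvar_head_le:
  assumes w: "weighted I c" and d: "\<And>n. n < m \<Longrightarrow> norm (x n) \<le> d" "d \<ge> 0"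
  shows "wvar I c (head m x) \<le> wvar {p \<in> I. snd p < m} c x + d"
proof -
  have no: "nonoverlapping I" using w by (simp add: weighted_def)
  have "c p * norm (head m x (snd p) - head m x (fst p)) \<le>
      (if snd p < m then c p * norm (x (snd p) - x (fst p)) else 0) + of_bool (fst p < m \<and> m \<le> snd p) * d"
    if p: "p \<in> I" for p
  proof -
    have lt: "fst p < snd p" using no p by (simp add: nonoverlapping_def)
    consider "snd p < m" | "m \<le> fst p" | "fst p < m" "m \<le> snd p" by linarith
    then show ?thesis
    proof cases
      case 3
      have "c p * norm (x (fst p)) \<le> 1 * d"
        by (intro mult_mono d 3 weighted_le_1[OF w p]) auto
      then show ?thesis using 3 by (simp add: head_def)
    qed (use lt d in \<open>auto simp: head_def\<close>)
  qed
  then have "wvar I c (head m x) \<le> wvar {p \<in> I. snd p < m} c x + (\<Sum>p\<in>I. of_bool (fst p < m \<and> m \<le> snd p) * d)"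
    unfolding wvar_filter[OF nonoverlapping_finite[OF no], symmetric] sum.distrib[symmetric]
    unfolding wvar_def[of I c "head m x"] by (intro sum_mono)
  then show ?thesis using sum_crossing_le[OF no d(2), of m] by linarith
qed

lemma wvar_tail_le:
  assumes w: "weighted I c" and d: "\<And>n. m \<le> n \<Longrightarrow> norm (x n) \<le> d" "d \<ge> 0"
  shows "wvar I c (\<lambda>n. x n - head m x n) \<le> wvar {p \<in> I. m \<le> fst p} c x + d"
proof -
  have no: "nonoverlapping I" using w by (simp add: weighted_def)
  let ?y = "\<lambda>n. x n - head m x n"
  have "c p * norm (?y (snd p) - ?y (fst p)) \<le>
      (if m \<le> fst p then c p * norm (x (snd p) - x (fst p)) else 0) + of_bool (fst p < m \<and> m \<le> snd p) * d"
    if p: "p \<in> I" for p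
  proof -
    have lt: "fst p < snd p" using no p by (simp add: nonoverlapping_def)
    consider "snd p < m" | "m \<le> fst p" | "fst p < m" "m \<le> snd p" by linarith
    then show ?thesis
    proof cases
      case 3
      have "c p * norm (x (snd p)) \<le> 1 * d"
        by (intro mult_mono d 3 weighted_le_1[OF w p]) auto
      then show ?thesis using 3 by (simp add: head_def)
    qed (use lt d in \<open>auto simp: head_def\<close>)
  qed
  then have "wvar I c ?y \<le> wvar {p \<in> I. m \<le> fst p} c x + (\<Sum>p\<in>I. of_bool (fst p < m \<and> m \<le> snd p) * d)"
    unfolding wvar_filter[OF nonoverlapping_finite[OF no], symmetric] sum.distrib[symmetric]
    unfolding wvar_def[of I c ?y] by (intro sum_mono)
  then show ?thesis using sum_crossing_le[OF no d(2), of m] by linarith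
qed

text \<open>The path jumps twice, at \<open>N\<close> and at \<open>Suc M\<close>, and each jump is
  seen by at most one interval; an interval across both sees no increment.\<close>

lemma wvar_block_le:
  assumes w: "weighted I c"
  shows "wvar I c (\<lambda>n. if N \<le> n \<and> n \<le> M then z else 0) \<le> 2 * norm z"
proof -
  have no: "nonoverlapping I" using w by (simp add: weighted_def)
  let ?x = "\<lambda>n. if N \<le> n \<and> n \<le> M then z else 0"
  have "c p * norm (?x (snd p) - ?x (fst p)) \<le>
      of_bool (fst p < N \<and> N \<le> snd p) * norm z + of_bool (fst p < Suc M \<and> Suc M \<le> snd p) * norm z"
    if p: "p \<in> I" for p
  proof -
    have lt: "fst p < snd p" using no p by (simp add: nonoverlapping_def)
    have "c p * norm z \<le> 1 * norm z" by (intro mult_right_mono weighted_le_1[OF w p]) auto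
    then show ?thesis using lt by auto
  qed
  then have "wvar I c ?x \<le> (\<Sum>p\<in>I. of_bool (fst p < N \<and> N \<le> snd p) * norm z)
      + (\<Sum>p\<in>I. of_bool (fst p < Suc M \<and> Suc M \<le> snd p) * norm z)"
    unfolding wvar_def sum.distrib[symmetric] by (rule sum_mono)
  then show ?thesis
    using sum_crossing_le[OF no norm_ge_zero[of z], of N] sum_crossing_le[OF no norm_ge_zero[of z], of "Suc M"] by linarith
qed

section \<open>The space of paths\<close>

lemma var_le_diff: "var_le x A \<Longrightarrow> var_le y B \<Longrightarrow> var_le (\<lambda>n. x n - y n) (A + B)"
  using var_le_add[of x A "\<lambda>n. - y n" B] var_le_scale[of y B "-1"] by simp

text \<open>The support condition also forces the path to start at \<open>0\<close>, so the norm of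
  each value is an increment and is controlled by the variation.\<close>

typedef jy = "{x :: nat \<Rightarrow> l2. (\<forall>n i. n \<le> i \<longrightarrow> l2_nth (x n) i = 0) \<and> (\<exists>B. var_le x B) \<and> x \<longlonglongrightarrow> 0}"
  morphisms jpath Abs_jy
proof (rule exI[of _ "\<lambda>_. 0"])
  have "var_le (\<lambda>_. 0 :: l2) 0" by (simp add: var_le_def wvar_def)
  then show "(\<lambda>_. 0) \<in> {x :: nat \<Rightarrow> l2. (\<forall>n i. n \<le> i \<longrightarrow> l2_nth (x n) i = 0) \<and> (\<exists>B. var_le x B) \<and> x \<longlonglongrightarrow> 0}"
    by auto
qed

setup_lifting type_definition_jy

instantiation jy :: real_vector
begin

lift_definition zero_jy :: jy is "\<lambda>_. 0"
  by (auto simp: var_le_def wvar_def)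
lift_definition plus_jy :: "jy \<Rightarrow> jy \<Rightarrow> jy" is "\<lambda>x y n. x n + y n"
  subgoal for x y using var_le_add[of x _ y] tendsto_add[of x 0 _ y 0] by auto
  done
lift_definition uminus_jy :: "jy \<Rightarrow> jy" is "\<lambda>x n. - x n"
  subgoal for x using var_le_scale[of x _ "-1"] tendsto_minus[of x 0] by auto
  done
lift_definition minus_jy :: "jy \<Rightarrow> jy \<Rightarrow> jy" is "\<lambda>x y n. x n - y n"
  subgoal for x y using var_le_diff[of x _ y] tendsto_diff[of x 0 _ y 0] by auto
  done
lift_definition scaleR_jy :: "real \<Rightarrow> jy \<Rightarrow> jy" is "\<lambda>a x n. a *\<^sub>R x n"
  subgoal for a x using var_le_scale[of x _ a] tendsto_scaleR[OF tendsto_const, of x 0 _ a] by auto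
  done

instance
  by standard (transfer; simp add: algebra_simps fun_eq_iff)+

end

lemma jpath_simps [simp]:
  "jpath 0 n = 0"
  "jpath (x + y) n = jpath x n + jpath y n"
  "jpath (x - y) n = jpath x n - jpath y n"
  "jpath (- x) n = - jpath x n"
  "jpath (a *\<^sub>R x) n = a *\<^sub>R jpath x n"
  by (transfer; simp)+

lemma jpath_sum [simp]: "jpath (\<Sum>k\<in>A. f k) n = (\<Sum>k\<in>A. jpath (f k) n)"
  by (induction A rule: infinite_finite_induct) auto

lemma jy_eqI: "(\<And>n. jpath x n = jpath y n) \<Longrightarrow> x = y"
  by transfer auto

lemma jpath_supp [simp]: "n \<le> i \<Longrightarrow> l2_nth (jpath x n) i = 0"
  by transfer auto

lemma jpath_0 [simp]: "jpath x 0 = 0"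
  by (rule l2_eqI) simp

lemma jpath_tendsto: "jpath x \<longlonglongrightarrow> 0"
  by transfer auto

lemma jpath_trunc [simp]: "l2_trunc n (jpath x n) = jpath x n"
  by (rule l2_eqI) auto

lemma weighted_empty: "weighted {} c"
  by (simp add: weighted_def nonoverlapping_def)

instantiation jy :: real_normed_vector
begin

definition norm_jy :: "jy \<Rightarrow> real" where
  "norm_jy x = Sup {wvar I c (jpath x) | I c. weighted I c}"
definition dist_jy :: "jy \<Rightarrow> jy \<Rightarrow> real" where "dist_jy x y = norm (x - y)"
definition sgn_jy :: "jy \<Rightarrow> jy" where "sgn_jy x = x /\<^sub>R norm x"
definition uniformity_jy :: "(jy \<times> jy) filter" where
  "uniformity_jy = (INF e\<in>{0<..}. principal {(x, y). dist x y < e})"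
definition open_jy :: "jy set \<Rightarrow> bool" where
  "open_jy U \<longleftrightarrow> (\<forall>x\<in>U. eventually (\<lambda>(x', y). x' = x \<longrightarrow> y \<in> U) uniformity)"

lemma wvar_le_norm_jy: "weighted I c \<Longrightarrow> wvar I c (jpath x) \<le> norm x"
  unfolding norm_jy_def
proof (rule cSup_upper)
  obtain B where "var_le (jpath x) B" by transfer auto
  then show "bdd_above {wvar I c (jpath x) | I c. weighted I c}"
    unfolding var_le_def by (auto intro!: bdd_aboveI[of _ B])
qed blast

lemma norm_jy_le: "var_le (jpath x) B \<Longrightarrow> norm x \<le> B"
  unfolding norm_jy_def
proof (rule cSup_least)
  show "{wvar I c (jpath x) | I c. weighted I c} \<noteq> {}" using weighted_empty by blast
qed (auto simp: var_le_def)

lemma var_le_norm_jy: "var_le (jpath x) (norm x)"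
  using wvar_le_norm_jy by (simp add: var_le_def)

lemma norm_jy_nonneg: "norm (x :: jy) \<ge> 0"
  using wvar_le_norm_jy[OF weighted_empty, of undefined x] by (simp add: wvar_def)

lemma norm_jpath_le: "norm (jpath x n) \<le> norm x"
  using var_le_increment[OF var_le_norm_jy[of x], of 0 n] norm_jy_nonneg[of x] by (cases "n = 0") auto

instance
proof
  fix x y :: jy and a :: real
  have jpath_add: "jpath (x + y) = (\<lambda>n. jpath x n + jpath y n)" and jpath_scale: "jpath (a *\<^sub>R x) = (\<lambda>n. a *\<^sub>R jpath x n)"
    for x y a by auto
  show "norm x = 0 \<longleftrightarrow> x = 0"
  proof
    assume "norm x = 0"
    then have "jpath x n = 0" for n using norm_jpath_le[of x n] by simp
    then show "x = 0" by (intro jy_eqI) simp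
  next
    assume "x = 0"
    then have "var_le (jpath x) 0" by (simp add: var_le_def wvar_def)
    then show "norm x = 0" using norm_jy_le norm_jy_nonneg[of x] by (simp add: antisym)
  qed
  show "norm (x + y) \<le> norm x + norm y"
    by (rule norm_jy_le) (simp only: jpath_add var_le_add var_le_norm_jy)
  have le: "norm (b *\<^sub>R z) \<le> \<bar>b\<bar> * norm z" for b and z :: jy
    by (rule norm_jy_le) (simp only: jpath_scale var_le_scale var_le_norm_jy)
  show "norm (a *\<^sub>R x) = \<bar>a\<bar> * norm x"
  proof (cases "a = 0")
    case False
    have "\<bar>a\<bar> * norm x \<le> norm (a *\<^sub>R x)"
      using le[of "1 / a" "a *\<^sub>R x"] False by (simp add: field_simps)
    then show ?thesis using le[of a x] by simp
  qed (use le[of 0 x] norm_jy_nonneg[of "0 *\<^sub>R x"] in simp)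
qed (simp_all add: dist_jy_def sgn_jy_def uniformity_jy_def open_jy_def)

end

lemma bounded_linear_jpath: "bounded_linear (\<lambda>x. jpath x n)"
  by (rule bounded_linear_intro[where K = 1]) (auto simp: norm_jpath_le)

lemma jy_exI:
  assumes "\<And>n i. n \<le> i \<Longrightarrow> l2_nth (u n) i = 0" "var_le u B" "u \<longlonglongrightarrow> 0"
  obtains x where "jpath x = u" "norm x \<le> B"
proof -
  have "jpath (Abs_jy u) = u" by (rule Abs_jy_inverse) (use assms in auto)
  then show ?thesis using that[of "Abs_jy u"] norm_jy_le[of "Abs_jy u" B] assms(2) by simp
qed

instance jy :: banach
proof
  fix X :: "nat \<Rightarrow> jy" assume C: "Cauchy X"
  have "convergent (\<lambda>k. jpath (X k) n)" for n
    using bounded_linear.Cauchy[OF bounded_linear_jpath C] by (simp add: Cauchy_convergent)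
  then obtain u where u: "\<And>n. (\<lambda>k. jpath (X k) n) \<longlonglongrightarrow> u n"
    unfolding convergent_def by metis
  \<comment> \<open>Lower semicontinuity: each \<open>wvar I c\<close> involves finitely many times,
    so its bound survives pointwise limits.\<close>
  have close: "var_le (\<lambda>n. u n - jpath (X m) n) e" if m: "\<And>k. k \<ge> m \<Longrightarrow> norm (X k - X m) \<le> e" for e m
    unfolding var_le_def
  proof (intro allI impI)
    fix I c assume w: "weighted I c"
    have "(\<lambda>k. wvar I c (jpath (X k - X m))) \<longlonglongrightarrow> wvar I c (\<lambda>n. u n - jpath (X m) n)"
      unfolding wvar_def jpath_simps by (intro tendsto_intros u)
    moreover have "wvar I c (jpath (X k - X m)) \<le> e" if "k \<ge> m" for k
      using wvar_le_norm_jy[OF w, of "X k - X m"] m[OF that] by linarith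
    ultimately show "wvar I c (\<lambda>n. u n - jpath (X m) n) \<le> e" by (intro LIMSEQ_le_const2) auto
  qed
  have supp: "l2_nth (u n) i = 0" if "n \<le> i" for n i
  proof -
    have "(\<lambda>k. l2_nth (jpath (X k) n) i) \<longlonglongrightarrow> l2_nth (u n) i"
      by (rule bounded_linear.tendsto[OF bounded_linear_l2_nth u])
    then show ?thesis using that by (simp add: LIMSEQ_const_iff)
  qed
  have u0: "u 0 = 0" by (rule l2_eqI) (simp add: supp)
  have ev: "\<exists>m. \<forall>k\<ge>m. \<forall>l\<ge>m. norm (X k - X l) \<le> e" if "e > 0" for e
    using C that unfolding Cauchy_iff by (meson less_imp_le)
  obtain m1 where "\<And>k. k \<ge> m1 \<Longrightarrow> norm (X k - X m1) \<le> 1" using ev[of 1] by auto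
  from var_le_add[OF close[OF this] var_le_norm_jy[of "X m1"]]
  have ub: "var_le u (1 + norm (X m1))" by simp
  have "u \<longlonglongrightarrow> 0"
  proof (rule LIMSEQ_I)
    fix r :: real assume r: "r > 0"
    obtain m where m: "\<And>k. k \<ge> m \<Longrightarrow> norm (X k - X m) \<le> r / 2" using ev[of "r / 2"] r by auto
    obtain N where N: "\<And>n. n \<ge> N \<Longrightarrow> norm (jpath (X m) n) < r / 2"
      using LIMSEQ_D[OF jpath_tendsto[of "X m"], of "r / 2"] r by auto
    have "norm (u n - 0) < r" if "n \<ge> max N 1" for n
    proof -
      have "norm (u n - jpath (X m) n) \<le> r / 2"
        using var_le_increment[OF close[OF m], of 0 n] that u0 by simp
      then show ?thesis using N[of n] that norm_triangle_ineq[of "u n - jpath (X m) n" "jpath (X m) n"] by simp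
    qed
    then show "\<exists>no. \<forall>n\<ge>no. norm (u n - 0) < r" by blast
  qed
  then obtain x where x: "jpath x = u" using jy_exI[OF supp ub] by blast
  have "X \<longlonglongrightarrow> x"
  proof (rule LIMSEQ_I)
    fix r :: real assume r: "r > 0"
    then obtain m where m: "\<And>k l. k \<ge> m \<Longrightarrow> l \<ge> m \<Longrightarrow> norm (X k - X l) \<le> r / 2" using ev[of "r / 2"] by auto
    have "norm (X k - x) < r" if "k \<ge> m" for k
    proof -
      have "jpath (x - X k) = (\<lambda>n. u n - jpath (X k) n)" by (auto simp: x)
      moreover have "var_le (\<lambda>n. u n - jpath (X k) n) (r / 2)" using m that by (intro close) auto
      ultimately have "norm (x - X k) \<le> r / 2" by (intro norm_jy_le) simp
      then show ?thesis using r by (simp add: norm_minus_commute)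
    qed
    then show "\<exists>no. \<forall>n\<ge>no. norm (X n - x) < r" by blast
  qed
  then show "convergent X" by (rule convergentI)
qed

section \<open>Initial segments and constant blocks in the path space\<close>

lemma head_tendsto: "head m x \<longlonglongrightarrow> 0"
  by (rule tendsto_eventually, rule eventually_sequentiallyI[of m]) (simp add: head_def)

lemma var_le_head:
  fixes x :: "nat \<Rightarrow> l2"
  assumes "\<forall>n i. n \<le> i \<longrightarrow> l2_nth (x n) i = 0" and B: "var_le x B"
  shows "var_le (head m x) (2 * B)"
  unfolding var_le_def
proof (intro allI impI)
  have x0: "x 0 = 0" by (rule l2_eqI) (use assms in auto)
  have B0: "B \<ge> 0" using B weighted_empty by (force simp: var_le_def wvar_def)
  have xB: "norm (x n) \<le> B" for n
    using var_le_increment[OF B, of 0 n] x0 B0 by (cases "n = 0") auto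
  fix I c assume w: "weighted I c"
  have "wvar {p \<in> I. snd p < m} c x \<le> B"
    using B weighted_subset[OF w, of "{p \<in> I. snd p < m}"] by (auto simp: var_le_def)
  then show "wvar I c (head m x) \<le> 2 * B" using wvar_head_le[OF w, of m x B] xB B0 by simp
qed

lift_definition jhead :: "nat \<Rightarrow> jy \<Rightarrow> jy" is head
  subgoal for m x using var_le_head[of x _ m] by (auto simp: head_tendsto) (simp add: head_def)
  done

lemma jpath_jhead: "jpath (jhead m x) n = (if n < m then jpath x n else 0)"
  by transfer (simp add: head_def)

lemma norm_jhead_le: "norm (jhead m x) \<le> 2 * norm x"
proof (rule norm_jy_le, unfold var_le_def, intro allI impI)
  fix I c assume w: "weighted I c"
  have "wvar {p \<in> I. snd p < m} c (jpath x) \<le> norm x"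
    by (intro wvar_le_norm_jy weighted_subset[OF w]) auto
  moreover have "jpath (jhead m x) = head m (jpath x)" by transfer simp
  ultimately show "wvar I c (jpath (jhead m x)) \<le> 2 * norm x"
    using wvar_head_le[OF w, of m "jpath x" "norm x"] norm_jpath_le[of x] by simp
qed

text \<open>The remainder costs the variation of the tail, which is small for every path of bounded
  variation, plus the size of the values after the cut, which is small only because the path tends
  to \<open>0\<close>.\<close>

lemma jhead_tendsto: "(\<lambda>m. jhead m x) \<longlonglongrightarrow> x"
proof (rule LIMSEQ_I)
  fix r :: real assume r: "r > 0"
  obtain m1 where m1: "\<And>I c. weighted I c \<Longrightarrow> (\<forall>p\<in>I. m1 \<le> fst p) \<Longrightarrow> wvar I c (jpath x) \<le> r / 3"
    using tail_weighted_small[OF var_le_norm_jy[of x], of "r / 3"] r by auto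
  obtain m2 where m2: "\<And>n. n \<ge> m2 \<Longrightarrow> norm (jpath x n) < r / 3"
    using LIMSEQ_D[OF jpath_tendsto[of x], of "r / 3"] r by auto
  have "norm (jhead m x - x) < r" if m: "m \<ge> max m1 m2" for m
  proof -
    have eq: "jpath (x - jhead m x) = (\<lambda>n. jpath x n - head m (jpath x) n)"
      by (auto simp: jpath_jhead head_def)
    have "var_le (jpath (x - jhead m x)) (r / 3 + r / 3)"
      unfolding var_le_def eq
    proof (intro allI impI)
      fix I c assume w: "weighted I c"
      have "wvar {p \<in> I. m \<le> fst p} c (jpath x) \<le> r / 3"
        by (intro m1 weighted_subset[OF w]) (use m in auto)
      moreover have "norm (jpath x n) \<le> r / 3" if "m \<le> n" for n using m2[of n] m that by simp
      ultimately show "wvar I c (\<lambda>n. jpath x n - head m (jpath x) n) \<le> r / 3 + r / 3"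
        using wvar_tail_le[OF w, of m "jpath x" "r / 3"] r by fastforce
    qed
    then have "norm (x - jhead m x) \<le> r / 3 + r / 3" by (rule norm_jy_le)
    then show ?thesis using r by (simp add: norm_minus_commute)
  qed
  then show "\<exists>no. \<forall>m\<ge>no. norm (jhead m x - x) < r" by blast
qed

text \<open>The truncation makes the definition total; blocks are only used for \<open>z\<close> supported in \<open>{..<N}\<close>.\<close>

lift_definition jblock :: "nat \<Rightarrow> nat \<Rightarrow> l2 \<Rightarrow> jy" is
  "\<lambda>N M z n. if N \<le> n \<and> n \<le> M then l2_trunc N z else 0"
  subgoal for N M z
  proof (intro conjI)
    let ?x = "\<lambda>n. if N \<le> n \<and> n \<le> M then l2_trunc N z else 0"
    have "var_le ?x (2 * norm (l2_trunc N z))" by (simp add: var_le_def wvar_block_le)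
    then show "\<exists>B. var_le ?x B" by blast
    show "?x \<longlonglongrightarrow> 0"
      by (rule tendsto_eventually, rule eventually_sequentiallyI[of "Suc M"]) simp
  qed auto
  done

lemma jpath_jblock: "jpath (jblock N M z) n = (if N \<le> n \<and> n \<le> M then l2_trunc N z else 0)"
  by (simp add: jblock.rep_eq)

lemma norm_jblock_le: "norm (jblock N M z) \<le> 2 * norm z"
proof -
  have eq: "jpath (jblock N M z) = (\<lambda>n. if N \<le> n \<and> n \<le> M then l2_trunc N z else 0)"
    by (rule ext) (rule jpath_jblock)
  have "var_le (jpath (jblock N M z)) (2 * norm (l2_trunc N z))"
    unfolding eq var_le_def using wvar_block_le by blast
  then have "norm (jblock N M z) \<le> 2 * norm (l2_trunc N z)" by (rule norm_jy_le)
  then show ?thesis using norm_l2_trunc_le[of N z] by linarith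
qed

definition junit :: "nat \<Rightarrow> nat \<Rightarrow> jy" where
  "junit n i = jblock n n (l2_unit i)"

lemma l2_trunc_unit: "i < n \<Longrightarrow> l2_trunc n (l2_unit i) = l2_unit i"
  by (rule l2_eqI) simp

lemma jpath_junit: "i < n \<Longrightarrow> jpath (junit n i) m = (if m = n then l2_unit i else 0)"
  by (auto simp: junit_def jpath_jblock l2_trunc_unit)

lemma jhead_eq_sum: "jhead m x = (\<Sum>n<m. \<Sum>i<n. l2_nth (jpath x n) i *\<^sub>R junit n i)"
proof (rule jy_eqI)
  fix k
  have "jpath (\<Sum>i<n. l2_nth (jpath x n) i *\<^sub>R junit n i) k = (if n = k then jpath x k else 0)" for n
  proof -
    have "(\<Sum>i<n. jpath (l2_nth (jpath x n) i *\<^sub>R junit n i) k)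
        = (\<Sum>i<n. if n = k then l2_nth (jpath x n) i *\<^sub>R l2_unit i else 0)"
      by (intro sum.cong) (auto simp: jpath_junit)
    also have "\<dots> = (if n = k then l2_trunc k (jpath x k) else 0)" by (simp add: l2_trunc_eq_sum)
    finally show ?thesis by simp
  qed
  then show "jpath (jhead m x) k = jpath (\<Sum>n<m. \<Sum>i<n. l2_nth (jpath x n) i *\<^sub>R junit n i) k"
    by (simp add: jpath_jhead)
qed

section \<open>Functionals and the bidual\<close>

definition jeval :: "nat \<Rightarrow> l2 \<Rightarrow> jy \<Rightarrow>\<^sub>L real" where
  "jeval n w = Blinfun (\<lambda>x. inner (jpath x n) w)"

lemma jeval_apply [simp]: "blinfun_apply (jeval n w) x = inner (jpath x n) w"
proof -
  have "bounded_linear (\<lambda>x. inner (jpath x n) w)"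
    by (rule bounded_linear_compose[OF bounded_linear_inner_left bounded_linear_jpath])
  then show ?thesis by (simp add: jeval_def bounded_linear_Blinfun_apply)
qed

lemma inner_l2_supp:
  assumes "\<And>i. n \<le> i \<Longrightarrow> l2_nth x i = 0"
  shows "inner x w = (\<Sum>i<n. l2_nth x i * l2_nth w i)"
proof -
  have "(\<lambda>i. l2_nth x i * l2_nth w i) sums (\<Sum>i<n. l2_nth x i * l2_nth w i)"
    by (rule sums_finite) (use assms in auto)
  then show ?thesis by (simp add: inner_l2_def sums_iff)
qed

lemma jeval_eq_sum: "jeval n w = (\<Sum>i<n. l2_nth w i *\<^sub>R jeval n (l2_unit i))"
  by (rule blinfun_eqI)
    (simp add: inner_l2_supp[of n "jpath _ n"] inner_l2_unit blinfun.sum_left blinfun.scaleR_left mult.commute)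

lemma jy_functional_tail_small:
  fixes f :: "jy \<Rightarrow>\<^sub>L real"
  assumes e: "e > 0"
  shows "\<exists>m. \<forall>x. (\<forall>n<m. jpath x n = 0) \<longrightarrow> \<bar>blinfun_apply f x\<bar> \<le> e * norm x"
proof (rule ccontr)
  assume "\<not> ?thesis"
  then have bad: "\<exists>x. (\<forall>n<m. jpath x n = 0) \<and> e * norm x < \<bar>blinfun_apply f x\<bar>" for m
    by (meson not_le)
  have block: "\<exists>u M. (\<forall>n. jpath u n \<noteq> 0 \<longrightarrow> m \<le> n \<and> n < M) \<and> norm u \<le> 2 \<and> e < blinfun_apply f u" for m
  proof -
    obtain x where x: "\<And>n. n < m \<Longrightarrow> jpath x n = 0" "e * norm x < \<bar>blinfun_apply f x\<bar>" using bad[of m] by blast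
    have nx: "norm x > 0" using x(2) by auto
    \<comment> \<open>Normalised, with the sign that makes the value of \<open>f\<close> positive.
      Cutting \<open>y\<close> far out gives a finitely supported block, at the price of norm
      \<open>2\<close> instead of \<open>1\<close>.\<close>
    define y where "y = (sgn (blinfun_apply f x) / norm x) *\<^sub>R x"
    have "norm y \<le> 1" using nx by (simp add: y_def abs_sgn_eq)
    have "blinfun_apply f y = \<bar>blinfun_apply f x\<bar> / norm x"
      by (simp add: y_def blinfun.scaleR_right sgn_mult_self_eq abs_mult_sgn mult.commute) (simp add: abs_sgn)
    moreover have "e < \<bar>blinfun_apply f x\<bar> / norm x" using x(2) nx by (simp add: pos_less_divide_eq)
    ultimately have fy: "e < blinfun_apply f y" by simp
    have "(\<lambda>M. blinfun_apply f (jhead M y)) \<longlonglongrightarrow> blinfun_apply f y"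
      by (intro tendsto_intros jhead_tendsto)
    then have "\<forall>\<^sub>F M in sequentially. e < blinfun_apply f (jhead M y)"
      using fy by (rule order_tendstoD)
    then obtain M where M: "e < blinfun_apply f (jhead M y)" by (auto simp: eventually_sequentially)
    have "norm (jhead M y) \<le> 2" using norm_jhead_le[of M y] \<open>norm y \<le> 1\<close> by linarith
    moreover have "m \<le> n \<and> n < M" if "jpath (jhead M y) n \<noteq> 0" for n
      using that x(1)[of n] by (auto simp: jpath_jhead y_def split: if_splits intro: leI)
    ultimately show ?thesis using M by blast
  qed
  \<comment> \<open>Chosen so that \<open>norm f * r \<le> e / 4\<close>; the \<open>+ 1\<close>
    covers \<open>f = 0\<close>.\<close>
  define r where "r = e / (4 * (norm f + 1))"
  have r: "r > 0" unfolding r_def using e by (intro divide_pos_pos) (auto simp: add_nonneg_pos)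
  \<comment> \<open>The number of endpoints of \<open>p\<close> before time \<open>M\<close>, hence
    at most \<open>2\<close>. When a block living between \<open>M\<close> and \<open>L\<close> is
    appended, every interval with an endpoint there gains at least \<open>1\<close>, which pays for
    its cube weight in the new block. Over all blocks each weight is therefore charged at most
    twice.\<close>
  define cnt where "cnt M p = of_bool (fst p < M) + (of_bool (snd p < M) :: real)" for M :: nat and p :: "nat \<times> nat"
  have claim: "\<exists>y M. (\<forall>n\<ge>M. jpath y n = 0) \<and> real k * e \<le> blinfun_apply f y \<and>
      (\<forall>I c. nonoverlapping I \<longrightarrow> (\<forall>p\<in>I. 0 \<le> c p) \<longrightarrow>
        wvar I c (jpath y) \<le> ((\<Sum>p\<in>I. c p ^ 3 * cnt M p) / r\<^sup>2 + real k * r) * 2)" for k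
  proof (induction k)
    case 0
    show ?case by (intro exI[of _ 0]) (simp add: blinfun.zero_right wvar_def cnt_def)
  next
    case (Suc k)
    then obtain y M where y: "\<And>n. n \<ge> M \<Longrightarrow> jpath y n = 0" "real k * e \<le> blinfun_apply f y"
      and yv: "\<And>I c. nonoverlapping I \<Longrightarrow> (\<forall>p\<in>I. 0 \<le> c p) \<Longrightarrow>
        wvar I c (jpath y) \<le> ((\<Sum>p\<in>I. c p ^ 3 * cnt M p) / r\<^sup>2 + real k * r) * 2" by blast
    obtain u M' where u: "\<And>n. jpath u n \<noteq> 0 \<Longrightarrow> M \<le> n \<and> n < M'" "norm u \<le> 2" "e < blinfun_apply f u"
      using block[of M] by blast
    define L where "L = max M M'"
    have uL: "M \<le> n \<and> n < L" if "jpath u n \<noteq> 0" for n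
      using u(1)[OF that] by (simp add: L_def)
    have "M \<le> L" by (simp add: L_def)
    have "wvar I c (jpath (y + u)) \<le> ((\<Sum>p\<in>I. c p ^ 3 * cnt L p) / r\<^sup>2 + real (Suc k) * r) * 2"
      if no: "nonoverlapping I" and c0: "\<forall>p\<in>I. 0 \<le> c p" for I c
    proof -
      define J where "J = {p \<in> I. M \<le> fst p \<and> fst p < L \<or> M \<le> snd p \<and> snd p < L}"
      have J: "J \<subseteq> I" "finite I" using no by (auto simp: J_def nonoverlapping_def)
      have ul: "var_le (jpath u) 2" using var_le_norm_jy[of u] u(2) by (auto simp: var_le_def intro: order_trans)
      have "wvar I c (jpath u) = wvar J c (jpath u)"
        unfolding wvar_def
      proof (rule sum.mono_neutral_right[OF J(2,1)], rule ballI)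
        fix p assume "p \<in> I - J"
        then have "jpath u (fst p) = 0" "jpath u (snd p) = 0"
          using uL[of "fst p"] uL[of "snd p"] by (auto simp: J_def)
        then show "c p * norm (jpath u (snd p) - jpath u (fst p)) = 0" by simp
      qed
      also have "\<dots> \<le> ((\<Sum>p\<in>J. c p ^ 3) / r\<^sup>2 + r) * 2"
        by (rule wvar_le_linear[OF ul]) (use nonoverlapping_subset[OF no J(1)] c0 J(1) r in auto)
      finally have uv: "wvar I c (jpath u) \<le> ((\<Sum>p\<in>J. c p ^ 3) / r\<^sup>2 + r) * 2" .
      have "(\<Sum>p\<in>I. c p ^ 3 * cnt M p) + (\<Sum>p\<in>J. c p ^ 3) \<le> (\<Sum>p\<in>I. c p ^ 3 * cnt L p)"
      proof -
        have "(\<Sum>p\<in>J. c p ^ 3) = (\<Sum>p\<in>I. if p \<in> J then c p ^ 3 else 0)"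
          using J by (simp add: sum.inter_restrict[symmetric] Int_absorb1)
        then have "(\<Sum>p\<in>I. c p ^ 3 * cnt M p) + (\<Sum>p\<in>J. c p ^ 3)
            = (\<Sum>p\<in>I. c p ^ 3 * cnt M p + (if p \<in> J then c p ^ 3 else 0))"
          by (simp add: sum.distrib)
        also have "\<dots> \<le> (\<Sum>p\<in>I. c p ^ 3 * cnt L p)"
        proof (rule sum_mono)
          fix p assume p: "p \<in> I"
          have "cnt M p + of_bool (p \<in> J) \<le> cnt L p" using \<open>M \<le> L\<close> by (auto simp: cnt_def J_def)
          then have "c p ^ 3 * (cnt M p + of_bool (p \<in> J)) \<le> c p ^ 3 * cnt L p"
            using c0 p by (intro mult_left_mono) auto
          then show "c p ^ 3 * cnt M p + (if p \<in> J then c p ^ 3 else 0) \<le> c p ^ 3 * cnt L p"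
            by (auto simp: algebra_simps)
        qed
        finally show ?thesis .
      qed
      then have "(\<Sum>p\<in>I. c p ^ 3 * cnt M p) / r\<^sup>2 + (\<Sum>p\<in>J. c p ^ 3) / r\<^sup>2 \<le> (\<Sum>p\<in>I. c p ^ 3 * cnt L p) / r\<^sup>2"
        unfolding add_divide_distrib[symmetric] by (rule divide_right_mono) simp
      moreover have "wvar I c (jpath (y + u)) \<le> wvar I c (jpath y) + wvar I c (jpath u)"
        using wvar_add_le[of I c "jpath y" "jpath u"] c0 by (simp add: plus_jy.rep_eq)
      ultimately show ?thesis using yv[OF no c0] uv by (simp add: algebra_simps)
    qed
    moreover have "\<forall>n\<ge>L. jpath (y + u) n = 0" using y(1) uL \<open>M \<le> L\<close> by (auto dest: order_trans) (meson not_less)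
    moreover have "real (Suc k) * e \<le> blinfun_apply f (y + u)"
      using y(2) u(3) by (simp add: blinfun.add_right algebra_simps)
    ultimately show ?case by blast
  qed
  have bound: "real k * e \<le> norm f * ((2 / r\<^sup>2 + real k * r) * 2)" for k
  proof -
    obtain y M where y: "real k * e \<le> blinfun_apply f y"
      and yv: "\<And>I c. nonoverlapping I \<Longrightarrow> (\<forall>p\<in>I. 0 \<le> c p) \<Longrightarrow>
        wvar I c (jpath y) \<le> ((\<Sum>p\<in>I. c p ^ 3 * cnt M p) / r\<^sup>2 + real k * r) * 2" using claim[of k] by blast
    have "var_le (jpath y) ((2 / r\<^sup>2 + real k * r) * 2)"
      unfolding var_le_def
    proof (intro allI impI)
      fix I c assume w: "weighted I c"
      have "(\<Sum>p\<in>I. c p ^ 3 * cnt M p) \<le> (\<Sum>p\<in>I. c p ^ 3 * 2)"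
        using weighted_le_1[OF w] by (intro sum_mono mult_left_mono) (auto simp: cnt_def)
      also have "\<dots> \<le> 2" using w by (simp add: weighted_def flip: sum_distrib_right)
      finally have "(\<Sum>p\<in>I. c p ^ 3 * cnt M p) / r\<^sup>2 \<le> 2 / r\<^sup>2" by (rule divide_right_mono) simp
      moreover have "wvar I c (jpath y) \<le> ((\<Sum>p\<in>I. c p ^ 3 * cnt M p) / r\<^sup>2 + real k * r) * 2"
        by (rule yv) (use w in \<open>auto simp: weighted_def\<close>)
      ultimately show "wvar I c (jpath y) \<le> (2 / r\<^sup>2 + real k * r) * 2" by argo
    qed
    then have "norm y \<le> (2 / r\<^sup>2 + real k * r) * 2" by (rule norm_jy_le)
    then have "norm f * norm y \<le> norm f * ((2 / r\<^sup>2 + real k * r) * 2)" by (intro mult_left_mono) auto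
    moreover have "blinfun_apply f y \<le> norm f * norm y" using norm_blinfun[of f y] by simp
    ultimately show ?thesis using y by linarith
  qed
  have fr: "norm f * r \<le> e / 4"
  proof -
    have "norm f / (norm f + 1) \<le> 1" by (simp add: divide_le_eq_1 add_nonneg_pos)
    then have "e / 4 * (norm f / (norm f + 1)) \<le> e / 4 * 1" using e by (intro mult_left_mono) auto
    then show ?thesis by (simp add: r_def mult_ac)
  qed
  \<comment> \<open>The bound reads
    \<open>k * e \<le> 4 * norm f / r\<^sup>2 + 2 * k * norm f * r\<close>. Its linear part is at
    most \<open>k * e / 2\<close>, so a large \<open>k\<close> beats the constant.\<close>
  obtain k :: nat where k: "real k > 4 * norm f / r\<^sup>2 / (e / 2)" using reals_Archimedean2 by blast
  have "real k * (norm f * r) \<le> real k * (e / 4)" using fr by (intro mult_left_mono) auto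
  moreover have "real k * e \<le> 4 * norm f / r\<^sup>2 + 2 * (real k * (norm f * r))"
    using bound[of k] by (simp add: algebra_simps)
  ultimately have "real k * (e / 2) \<le> 4 * norm f / r\<^sup>2" by simp
  moreover have "4 * norm f / r\<^sup>2 < real k * (e / 2)" using k e by (subst (asm) pos_divide_less_eq) auto
  ultimately show False by linarith
qed

text \<open>Composing \<open>f\<close> with \<open>jhead m\<close> gives a finite combination of
  evaluations, and by the shrinking property these compositions converge to \<open>f\<close> in
  norm. Elements of the bidual are hence determined by their values on evaluations.\<close>

lemma jeval_total:
  fixes \<Phi> :: "(jy \<Rightarrow>\<^sub>L real) \<Rightarrow>\<^sub>L real"
  assumes "\<And>n w. blinfun_apply \<Phi> (jeval n w) = 0"
  shows "\<Phi> = 0"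
proof (rule blinfun_eqI)
  fix f :: "jy \<Rightarrow>\<^sub>L real"
  define g where "g m = (\<Sum>n<m. \<Sum>i<n. blinfun_apply f (junit n i) *\<^sub>R jeval n (l2_unit i))" for m
  have g: "blinfun_apply (g m) x = blinfun_apply f (jhead m x)" for m x
    by (simp add: g_def jhead_eq_sum blinfun.sum_left blinfun.sum_right blinfun.scaleR_left blinfun.scaleR_right
        inner_l2_unit mult.commute)
  have \<Phi>g: "blinfun_apply \<Phi> (g m) = 0" for m
    by (simp add: g_def blinfun.sum_right blinfun.scaleR_right assms)
  have "\<bar>blinfun_apply \<Phi> f\<bar> \<le> e" if e: "e > 0" for e
  proof -
    \<comment> \<open>The later factor \<open>3\<close> bounds \<open>x - jhead m x\<close> by means
      of \<open>norm_jhead_le\<close>; the \<open>+ 1\<close> keeps the divisor positive.\<close>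
    define d' where "d' = e / (norm \<Phi> + 1)"
    define d where "d = d' / 3"
    have "d' > 0" unfolding d'_def using e by (intro divide_pos_pos) (auto simp: add_nonneg_pos)
    then have d: "d > 0" "d * 3 = d'" by (simp_all add: d_def)
    obtain m where m: "\<And>x. (\<forall>n<m. jpath x n = 0) \<Longrightarrow> \<bar>blinfun_apply f x\<bar> \<le> d * norm x"
      using jy_functional_tail_small[OF d(1), of f] by blast
    have "norm (f - g m) \<le> d * 3"
    proof (rule norm_blinfun_bound)
      fix x
      have "\<bar>blinfun_apply f (x - jhead m x)\<bar> \<le> d * norm (x - jhead m x)"
        by (rule m) (simp add: jpath_jhead)
      also have "norm (x - jhead m x) \<le> 3 * norm x"
        using norm_triangle_ineq4[of x "jhead m x"] norm_jhead_le[of m x] by linarith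
      finally show "norm (blinfun_apply (f - g m) x) \<le> d * 3 * norm x"
        using d(1) by (simp add: blinfun.diff_left g blinfun.diff_right mult_left_mono)
    qed (use d(1) in simp)
    then have "norm \<Phi> * norm (f - g m) \<le> norm \<Phi> * (d * 3)" by (rule mult_left_mono) simp
    moreover have "\<bar>blinfun_apply \<Phi> f\<bar> \<le> norm \<Phi> * norm (f - g m)"
      using norm_blinfun[of \<Phi> "f - g m"] by (simp add: blinfun.diff_right \<Phi>g)
    moreover have "norm \<Phi> * (d * 3) \<le> e"
    proof -
      have "norm \<Phi> / (norm \<Phi> + 1) \<le> 1" by (simp add: divide_le_eq_1 add_nonneg_pos)
      then have "e * (norm \<Phi> / (norm \<Phi> + 1)) \<le> e * 1" using e by (intro mult_left_mono) auto
      then show ?thesis by (simp add: d(2) d'_def mult_ac)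
    qed
    ultimately show ?thesis by linarith
  qed
  then have "blinfun_apply \<Phi> f = 0" by (metis abs_le_zero_iff dense_ge)
  then show "blinfun_apply \<Phi> f = blinfun_apply 0 f" by simp
qed

section \<open>Elements of the bidual as paths\<close>

definition bpath :: "((jy \<Rightarrow>\<^sub>L real) \<Rightarrow>\<^sub>L real) \<Rightarrow> nat \<Rightarrow> l2" where
  "bpath \<Phi> n = (\<Sum>i<n. blinfun_apply \<Phi> (jeval n (l2_unit i)) *\<^sub>R l2_unit i)"

text \<open>So \<open>bpath \<Phi> n\<close> is the Riesz vector of
  \<open>w \<mapsto> \<Phi> (jeval n w)\<close>; the finite sum defining it is enough because
  \<open>jeval n\<close> sees only the first \<open>n\<close> coordinates.\<close>

lemma inner_bpath: "inner (bpath \<Phi> n) w = blinfun_apply \<Phi> (jeval n w)"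
proof -
  have "blinfun_apply \<Phi> (jeval n w) = (\<Sum>i<n. l2_nth w i * blinfun_apply \<Phi> (jeval n (l2_unit i)))"
    by (subst jeval_eq_sum) (simp add: blinfun.sum_right blinfun.scaleR_right)
  then show ?thesis
    by (simp add: bpath_def inner_sum_left inner_commute[of "l2_unit _"] inner_l2_unit mult.commute)
qed

lemma l2_inner_eqI: "(\<And>w. inner x w = inner y w) \<Longrightarrow> x = (y :: l2)"
  by (metis inner_eq_zero_iff inner_diff_left right_minus_eq)

lemma bpath_supp: "n \<le> i \<Longrightarrow> l2_nth (bpath \<Phi> n) i = 0"
  by (auto simp: bpath_def intro!: sum.neutral)

lemma bpath_simps [simp]:
  "bpath (\<Phi> + \<Psi>) n = bpath \<Phi> n + bpath \<Psi> n"
  "bpath (\<Phi> - \<Psi>) n = bpath \<Phi> n - bpath \<Psi> n"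
  "bpath (a *\<^sub>R \<Phi>) n = a *\<^sub>R bpath \<Phi> n"
  by (rule l2_inner_eqI;
      simp add: inner_add_left inner_diff_left inner_bpath blinfun.add_left blinfun.diff_left blinfun.scaleR_left)+

lemma inner_sgn: "inner v (sgn v) = norm (v :: 'a::real_inner)"
proof (cases "v = 0")
  case False
  have "inner v (sgn v) = (norm v)\<^sup>2 / norm v"
    by (simp add: sgn_div_norm power2_norm_eq_inner divide_inverse)
  then show ?thesis using False by (simp add: power2_eq_square)
qed simp

text \<open>The weighted variation of the path is the value of \<open>\<Phi>\<close> at a
  combination \<open>g\<close> of differences of evaluations, taken in the directions of the
  increments. By Cauchy-Schwarz \<open>g\<close> is dominated by \<open>wvar I c\<close> on
  \<open>Y\<close>, so its norm is at most \<open>1\<close>.\<close>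

lemma var_le_bpath: "var_le (bpath \<Phi>) (norm \<Phi>)"
  unfolding var_le_def
proof (intro allI impI)
  fix I c assume w: "weighted I c"
  define v where "v p = sgn (bpath \<Phi> (snd p) - bpath \<Phi> (fst p))" for p
  have v1: "norm (v p) \<le> 1" for p by (simp add: v_def norm_sgn)
  have vi: "inner (bpath \<Phi> (snd p) - bpath \<Phi> (fst p)) (v p) = norm (bpath \<Phi> (snd p) - bpath \<Phi> (fst p))" for p
    unfolding v_def by (rule inner_sgn)
  define g where "g = (\<Sum>p\<in>I. c p *\<^sub>R (jeval (snd p) (v p) - jeval (fst p) (v p)))"
  have "norm g \<le> 1"
  proof (rule norm_blinfun_bound)
    fix x
    have "norm (blinfun_apply g x) \<le> (\<Sum>p\<in>I. norm (c p * inner (jpath x (snd p) - jpath x (fst p)) (v p)))"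
      by (simp add: g_def blinfun.sum_left blinfun.scaleR_left blinfun.diff_left inner_diff_left)
    also have "\<dots> \<le> wvar I c (jpath x)"
      unfolding wvar_def
    proof (rule sum_mono)
      fix p assume p: "p \<in> I"
      have "\<bar>inner (jpath x (snd p) - jpath x (fst p)) (v p)\<bar> \<le> norm (jpath x (snd p) - jpath x (fst p)) * norm (v p)"
        by (rule Cauchy_Schwarz_ineq2)
      also have "\<dots> \<le> norm (jpath x (snd p) - jpath x (fst p)) * 1" using v1 by (rule mult_left_mono) simp
      finally show "norm (c p * inner (jpath x (snd p) - jpath x (fst p)) (v p)) \<le> c p * norm (jpath x (snd p) - jpath x (fst p))"
        using weighted_le_1[OF w p] by (simp add: abs_mult mult_left_mono)
    qed
    also have "\<dots> \<le> norm x" by (rule wvar_le_norm_jy[OF w])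
    finally show "norm (blinfun_apply g x) \<le> 1 * norm x" by simp
  qed simp
  have "wvar I c (bpath \<Phi>) = blinfun_apply \<Phi> g"
    by (simp add: wvar_def vi[symmetric] inner_diff_left inner_bpath g_def blinfun.sum_right blinfun.scaleR_right blinfun.diff_right)
  also have "\<dots> \<le> norm \<Phi> * norm g" using norm_blinfun[of \<Phi> g] by simp
  also have "\<dots> \<le> norm \<Phi> * 1" using \<open>norm g \<le> 1\<close> by (rule mult_left_mono) simp
  finally show "wvar I c (bpath \<Phi>) \<le> norm \<Phi>" by simp
qed

definition blim :: "((jy \<Rightarrow>\<^sub>L real) \<Rightarrow>\<^sub>L real) \<Rightarrow> l2" where
  "blim \<Phi> = lim (bpath \<Phi>)"

lemma bpath_tendsto: "bpath \<Phi> \<longlonglongrightarrow> blim \<Phi>"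
  using var_le_Cauchy[OF var_le_bpath] by (simp add: blim_def Cauchy_convergent convergent_LIMSEQ_iff[symmetric])

lemma bpath_0 [simp]: "bpath \<Phi> 0 = 0"
  by (simp add: bpath_def)

lemma norm_bpath_le: "norm (bpath \<Phi> n) \<le> norm \<Phi>"
  using var_le_increment[OF var_le_bpath[of \<Phi>], of 0 n] by (cases "n = 0") auto

lemma bounded_linear_blim: "bounded_linear blim"
proof (rule bounded_linear_intro[where K = 1])
  show "blim (\<Phi> + \<Psi>) = blim \<Phi> + blim \<Psi>" for \<Phi> \<Psi>
  proof (rule LIMSEQ_unique[OF bpath_tendsto])
    have "bpath (\<Phi> + \<Psi>) = (\<lambda>n. bpath \<Phi> n + bpath \<Psi> n)" by auto
    then show "bpath (\<Phi> + \<Psi>) \<longlonglongrightarrow> blim \<Phi> + blim \<Psi>" by (simp add: tendsto_add bpath_tendsto)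
  qed
  show "blim (a *\<^sub>R \<Phi>) = a *\<^sub>R blim \<Phi>" for a \<Phi>
  proof (rule LIMSEQ_unique[OF bpath_tendsto])
    have "bpath (a *\<^sub>R \<Phi>) = (\<lambda>n. a *\<^sub>R bpath \<Phi> n)" by auto
    then show "bpath (a *\<^sub>R \<Phi>) \<longlonglongrightarrow> a *\<^sub>R blim \<Phi>" by (simp add: tendsto_scaleR bpath_tendsto)
  qed
  show "norm (blim \<Phi>) \<le> norm \<Phi> * 1" for \<Phi>
    using tendsto_norm[OF bpath_tendsto[of \<Phi>]] by (rule LIMSEQ_le_const2) (simp add: norm_bpath_le)
qed

section \<open>The canonical image and the limit map\<close>

definition jembed :: "jy \<Rightarrow> (jy \<Rightarrow>\<^sub>L real) \<Rightarrow>\<^sub>L real" where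
  "jembed x = Blinfun (\<lambda>f. blinfun_apply f x)"

lemma jembed_apply [simp]: "blinfun_apply (jembed x) f = blinfun_apply f x"
  by (simp add: jembed_def bounded_linear_Blinfun_apply blinfun.bounded_linear_left)

lemma norm_jembed_le: "norm (jembed x) \<le> norm x"
proof (rule norm_blinfun_bound)
  show "norm (blinfun_apply (jembed x) f) \<le> norm x * norm f" for f
    using norm_blinfun[of f x] by (simp add: mult.commute)
qed simp

lemma bpath_jembed [simp]: "bpath (jembed x) n = jpath x n"
  by (rule l2_inner_eqI) (simp add: inner_bpath)

text \<open>A path with limit \<open>0\<close> belongs to an element of \<open>Y\<close>, and the
  image of that element agrees with \<open>\<Phi>\<close> on all evaluations;
  \<open>jeval_total\<close> makes them equal.\<close>

lemma blim_eq_0_iff: "blim \<Phi> = 0 \<longleftrightarrow> \<Phi> \<in> range jembed"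
proof
  assume "blim \<Phi> = 0"
  then obtain x where x: "jpath x = bpath \<Phi>"
    using jy_exI[OF bpath_supp var_le_bpath] bpath_tendsto[of \<Phi>] by metis
  have "\<Phi> - jembed x = 0"
    by (rule jeval_total) (simp add: blinfun.diff_left x inner_bpath)
  then show "\<Phi> \<in> range jembed" by auto
next
  assume "\<Phi> \<in> range jembed"
  then obtain x where "\<Phi> = jembed x" by blast
  then have "bpath \<Phi> = jpath x" by auto
  then have "bpath \<Phi> \<longlonglongrightarrow> 0" using jpath_tendsto[of x] by simp
  then show "blim \<Phi> = 0" using bpath_tendsto LIMSEQ_unique by blast
qed

text \<open>The lift is the weak-star limit, as \<open>M\<close> grows, of the blocks equal to
  \<open>z\<close> from \<open>N\<close> to \<open>M\<close>. Two such blocks differ only at late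
  times, so by the shrinking property every functional converges along them.\<close>

lemma blim_finite_lift:
  assumes z: "l2_trunc N z = z"
  shows "\<exists>\<Phi>. blim \<Phi> = z \<and> norm \<Phi> \<le> 2 * norm z"
proof -
  have Cau: "Cauchy (\<lambda>M. blinfun_apply f (jblock N M z))" for f :: "jy \<Rightarrow>\<^sub>L real"
  proof (rule metric_CauchyI)
    fix e :: real assume e: "e > 0"
    \<comment> \<open>The difference of two blocks has norm at most \<open>4 * norm z\<close>; the
      \<open>+ 1\<close> gives strictness and covers \<open>z = 0\<close>.\<close>
    define d where "d = e / (4 * (norm z + 1))"
    have d: "d > 0" unfolding d_def using e by (intro divide_pos_pos) (auto simp: add_nonneg_pos)
    obtain m where m: "\<And>x. (\<forall>n<m. jpath x n = 0) \<Longrightarrow> \<bar>blinfun_apply f x\<bar> \<le> d * norm x"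
      using jy_functional_tail_small[OF d, of f] by blast
    have "dist (blinfun_apply f (jblock N M z)) (blinfun_apply f (jblock N M' z)) < e"
      if M: "m \<le> M" "m \<le> M'" for M M'
    proof -
      let ?x = "jblock N M z - jblock N M' z"
      have "\<bar>blinfun_apply f ?x\<bar> \<le> d * norm ?x"
        by (rule m) (use M in \<open>auto simp: jpath_jblock\<close>)
      also have "\<dots> \<le> d * (4 * norm z)"
        using norm_triangle_ineq4[of "jblock N M z" "jblock N M' z"] norm_jblock_le[of N M z] norm_jblock_le[of N M' z] d
        by (intro mult_left_mono) auto
      also have "\<dots> < d * (4 * (norm z + 1))" using d by (intro mult_strict_left_mono) auto
      also have "\<dots> = e" using norm_ge_zero[of z] by (simp add: d_def add_nonneg_eq_0_iff)
      finally show ?thesis by (simp add: dist_real_def blinfun.diff_right)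
    qed
    then show "\<exists>M. \<forall>m\<ge>M. \<forall>n\<ge>M. dist (blinfun_apply f (jblock N m z)) (blinfun_apply f (jblock N n z)) < e" by blast
  qed
  define F where "F f = lim (\<lambda>M. blinfun_apply f (jblock N M z))" for f :: "jy \<Rightarrow>\<^sub>L real"
  have F: "(\<lambda>M. blinfun_apply f (jblock N M z)) \<longlonglongrightarrow> F f" for f
    using Cau[of f] by (simp add: F_def Cauchy_convergent convergent_LIMSEQ_iff[symmetric])
  have Fb: "norm (F f) \<le> norm f * (2 * norm z)" for f
  proof (rule LIMSEQ_le_const2[OF tendsto_norm[OF F[of f]]], intro exI allI impI)
    fix M
    have "norm (blinfun_apply f (jblock N M z)) \<le> norm f * norm (jblock N M z)" by (rule norm_blinfun)
    also have "\<dots> \<le> norm f * (2 * norm z)" by (intro mult_left_mono norm_jblock_le) auto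
    finally show "norm (blinfun_apply f (jblock N M z)) \<le> norm f * (2 * norm z)" .
  qed
  have bl: "bounded_linear F"
  proof (rule bounded_linear_intro[OF _ _ Fb])
    show "F (f + g) = F f + F g" for f g
      by (rule LIMSEQ_unique[OF F]) (simp add: blinfun.add_left tendsto_add F)
    show "F (a *\<^sub>R f) = a *\<^sub>R F f" for a f
      by (rule LIMSEQ_unique[OF F]) (simp add: blinfun.scaleR_left tendsto_mult F)
  qed
  define \<Phi> where "\<Phi> = Blinfun F"
  have \<Phi>: "blinfun_apply \<Phi> f = F f" for f by (simp add: \<Phi>_def bounded_linear_Blinfun_apply[OF bl])
  have "bpath \<Phi> n = z" if n: "n \<ge> N" for n
  proof (rule l2_inner_eqI)
    fix w
    have "(\<lambda>M. blinfun_apply (jeval n w) (jblock N M z)) \<longlonglongrightarrow> inner z w"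
      by (rule tendsto_eventually, rule eventually_sequentiallyI[of n]) (use n z in \<open>simp add: jpath_jblock\<close>)
    then show "inner (bpath \<Phi> n) w = inner z w"
      unfolding inner_bpath \<Phi> using F LIMSEQ_unique by blast
  qed
  then have "bpath \<Phi> \<longlonglongrightarrow> z"
    by (intro tendsto_eventually eventually_sequentiallyI[of N]) simp
  then have "blim \<Phi> = z" using bpath_tendsto LIMSEQ_unique by blast
  moreover have "norm \<Phi> \<le> 2 * norm z"
    by (rule norm_blinfun_bound) (use Fb in \<open>auto simp: \<Phi> mult.commute\<close>)
  ultimately show ?thesis by blast
qed

text \<open>Successive approximation: the residual halves at each step, so the corrections are
  dominated by a geometric series with sum \<open>2 * K * norm z\<close>.\<close>

lemma surjective_if_almost:
  fixes T :: "'a::banach \<Rightarrow> 'b::real_normed_vector"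
  assumes T: "bounded_linear T"
    and K: "K \<ge> 0" and approx: "\<And>z. \<exists>x. norm (z - T x) \<le> norm z / 2 \<and> norm x \<le> K * norm z"
  shows "\<exists>x. T x = z \<and> norm x \<le> 2 * K * norm z"
proof -
  interpret T: bounded_linear T by fact
  obtain g where g: "\<And>z. norm (z - T (g z)) \<le> norm z / 2" "\<And>z. norm (g z) \<le> K * norm z"
    using approx by metis
  define u where "u n = ((\<lambda>z. z - T (g z)) ^^ n) z" for n
  have u0: "u 0 = z" and uS: "u (Suc n) = u n - T (g (u n))" for n by (simp_all add: u_def)
  have un: "norm (u n) \<le> norm z * (1 / 2) ^ n" for n
  proof (induction n)
    case (Suc n)
    have "norm (u (Suc n)) \<le> norm (u n) / 2" unfolding uS by (rule g(1))
    then show ?case using Suc by simp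
  qed (simp add: u0)
  have gb: "norm (g (u n)) \<le> K * norm z * (1 / 2) ^ n" for n
  proof -
    have "norm (g (u n)) \<le> K * norm (u n)" by (rule g(2))
    also have "\<dots> \<le> K * (norm z * (1 / 2) ^ n)" by (intro mult_left_mono un K)
    finally show ?thesis by (simp add: mult_ac)
  qed
  have geo: "(\<lambda>n. K * norm z * (1 / 2) ^ n) sums (K * norm z * 2)"
    using sums_mult[OF geometric_sums[of "1 / 2 :: real"], of "K * norm z"] by simp
  have sn: "summable (\<lambda>n. norm (g (u n)))"
    by (rule summable_comparison_test'[OF sums_summable[OF geo]]) (use gb in simp)
  define x where "x = (\<Sum>n. g (u n))"
  have gx: "(\<lambda>n. g (u n)) sums x" unfolding x_def by (rule summable_sums[OF summable_norm_cancel[OF sn]])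
  have "norm x \<le> (\<Sum>n. norm (g (u n)))" unfolding x_def by (rule summable_norm[OF sn])
  also have "\<dots> \<le> K * norm z * 2"
    using suminf_le[OF gb sn sums_summable[OF geo]] geo by (simp add: sums_iff)
  finally have nx: "norm x \<le> 2 * K * norm z" by simp
  have "(\<lambda>n. T (g (u n))) sums T x" by (rule T.sums[OF gx])
  moreover have "(\<lambda>n. T (g (u n))) sums z"
  proof -
    have "u \<longlonglongrightarrow> 0"
    proof (rule tendsto_norm_zero_cancel, rule tendsto_sandwich[of "\<lambda>_. 0"])
      show "(\<lambda>n. norm z * (1 / 2) ^ n) \<longlonglongrightarrow> 0"
        by (rule tendsto_mult_right_zero) (rule LIMSEQ_realpow_zero, auto)
    qed (use un in auto)
    then have "(\<lambda>n. u n - u (Suc n)) sums (u 0 - 0)" by (rule telescope_sums')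
    then show ?thesis by (simp add: uS u0)
  qed
  ultimately have "T x = z" by (rule sums_unique2)
  with nx show ?thesis by blast
qed

text \<open>A truncation within \<open>norm y / 2\<close> of \<open>y\<close> has a lift of norm at
  most \<open>2 * norm y\<close>; iterating on the error doubles this constant to
  \<open>4\<close>.\<close>

lemma blim_lift: "\<exists>\<Phi>. blim \<Phi> = z \<and> norm \<Phi> \<le> 4 * norm z"
proof -
  have "\<exists>\<Phi>. norm (y - blim \<Phi>) \<le> norm y / 2 \<and> norm \<Phi> \<le> 2 * norm y" for y
  proof (cases "y = 0")
    case True
    then show ?thesis using linear_0[OF bounded_linear.linear[OF bounded_linear_blim]] by (intro exI[of _ 0]) simp
  next
    case False
    then have "norm y / 2 > 0" by simp
    then obtain n where n: "norm (l2_trunc n y - y) < norm y / 2"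
      using LIMSEQ_D[OF l2_trunc_tendsto[of y]] by blast
    have "l2_trunc n (l2_trunc n y) = l2_trunc n y" by (rule l2_eqI) simp
    from blim_finite_lift[OF this] obtain \<Phi> where "blim \<Phi> = l2_trunc n y" "norm \<Phi> \<le> 2 * norm (l2_trunc n y)" by blast
    then show ?thesis using n norm_l2_trunc_le[of n y] by (intro exI[of _ \<Phi>]) (auto simp: norm_minus_commute)
  qed
  from surjective_if_almost[OF bounded_linear_blim _ this] show ?thesis by simp
qed

section \<open>Norming subspaces of the dual\<close>

text \<open>Subtracting \<open>\<Phi>\<close> from a controlled lift \<open>\<Psi>\<close> of its
  limit leaves an element \<open>x\<close> of \<open>Y\<close>. On \<open>M\<close> it acts like
  \<open>\<Psi>\<close>, since \<open>\<Phi>\<close> vanishes there, so norming gives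
  \<open>c * norm x \<le> norm \<Psi>\<close>, and \<open>norm \<Psi>\<close> is at most
  \<open>4\<close> times the norm of the limit.\<close>

lemma annihilator_bounded_below:
  fixes M :: "(jy \<Rightarrow>\<^sub>L real) set"
  assumes c: "c > 0"
    and norming: "\<And>x. c * norm x \<le> Sup (insert 0 {\<bar>blinfun_apply f x\<bar> / norm f | f. f \<in> M \<and> f \<noteq> 0})"
    and \<Phi>: "\<And>f. f \<in> M \<Longrightarrow> blinfun_apply \<Phi> f = 0"
  shows "norm \<Phi> \<le> (1 + 1 / c) * 4 * norm (blim \<Phi>)"
proof -
  obtain \<Psi> where \<Psi>: "blim \<Psi> = blim \<Phi>" "norm \<Psi> \<le> 4 * norm (blim \<Phi>)" using blim_lift by blast
  have "blim (\<Psi> - \<Phi>) = 0" using \<Psi>(1) by (simp add: linear_diff[OF bounded_linear.linear[OF bounded_linear_blim]])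
  then obtain x where x: "\<Psi> - \<Phi> = jembed x" using blim_eq_0_iff by auto
  have "c * norm x \<le> norm \<Psi>"
  proof (rule order_trans[OF norming cSup_least])
    fix r assume "r \<in> insert 0 {\<bar>blinfun_apply f x\<bar> / norm f | f. f \<in> M \<and> f \<noteq> 0}"
    then consider "r = 0" | f where "f \<in> M" "f \<noteq> 0" "r = \<bar>blinfun_apply f x\<bar> / norm f" by blast
    then show "r \<le> norm \<Psi>"
    proof cases
      case 2
      have "blinfun_apply f x = blinfun_apply (\<Psi> - \<Phi>) f" by (simp add: x)
      also have "\<dots> = blinfun_apply \<Psi> f" using \<Phi>[OF 2(1)] by (simp add: blinfun.diff_left)
      finally have "\<bar>blinfun_apply f x\<bar> \<le> norm \<Psi> * norm f" using norm_blinfun[of \<Psi> f] by simp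
      then show ?thesis using 2 by (simp add: divide_le_eq)
    qed simp
  qed simp
  then have "norm x \<le> norm \<Psi> / c" using c by (simp add: field_simps)
  moreover have "\<Phi> = \<Psi> - jembed x" using x by (simp add: algebra_simps)
  then have "norm \<Phi> \<le> norm \<Psi> + norm x"
    using norm_triangle_ineq4[of \<Psi> "jembed x"] norm_jembed_le[of x] by simp
  ultimately have "norm \<Phi> \<le> (1 + 1 / c) * norm \<Psi>" by (simp add: algebra_simps)
  also have "\<dots> \<le> (1 + 1 / c) * (4 * norm (blim \<Phi>))" using \<Psi>(2) c by (intro mult_left_mono) auto
  finally show ?thesis by (simp only: mult.assoc)
qed

lemma norming_imp_finite_codim:
  fixes M :: "(jy \<Rightarrow>\<^sub>L real) set"
  assumes M: "subspace M" "closed M" and c: "c > 0"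
    and norming: "\<And>x. c * norm x \<le> Sup (insert 0 {\<bar>blinfun_apply f x\<bar> / norm f | f. f \<in> M \<and> f \<noteq> 0})"
  shows "\<exists>B. finite B \<and> span (B \<union> M) = UNIV"
proof (rule ccontr)
  assume "\<not> ?thesis"
  then have proper: "span (B \<union> M) \<noteq> UNIV" if "finite B" for B using that by blast
  define A where "A = {\<Phi> :: (jy \<Rightarrow>\<^sub>L real) \<Rightarrow>\<^sub>L real. \<forall>f\<in>M. blinfun_apply \<Phi> f = 0}"
  have A_add: "\<Phi> + \<Psi> \<in> A" and A_scale: "a *\<^sub>R \<Phi> \<in> A" if "\<Phi> \<in> A" "\<Psi> \<in> A" for \<Phi> \<Psi> a
    using that by (auto simp: A_def blinfun.add_left blinfun.scaleR_left)
  define K where "K = (1 + 1 / c) * 4"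
  have K: "norm \<Phi> \<le> K * norm (blim \<Phi>)" if "\<Phi> \<in> A" for \<Phi>
    unfolding K_def by (rule annihilator_bounded_below[OF c norming]) (use that in \<open>auto simp: A_def\<close>)
  interpret T: bounded_linear blim by (rule bounded_linear_blim)
  have far: "\<exists>\<Phi>\<in>A. (\<forall>n\<le>m. bpath \<Phi> n = 0) \<and> norm (blim \<Phi>) = 1" for m
  proof -
    \<comment> \<open>Finitely many functionals encode vanishing of the path up to time
      \<open>m\<close>. Adjoining them to \<open>M\<close> keeps the span closed, and proper because
      the codimension is infinite, so a nonzero functional annihilates both.\<close>
    define B where "B = (\<lambda>(n, i). jeval n (l2_unit i)) ` (SIGMA n:{..m}. {..<n})"
    have fin: "finite B" by (simp add: B_def)
    obtain g where "g \<notin> span (B \<union> M)" using proper[OF fin] by blast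
    then obtain F where F: "bounded_linear F" "\<And>f. f \<in> span (B \<union> M) \<Longrightarrow> F f = (0 :: real)" "F g = 1"
      using separate_closed_subspace[OF subspace_span closed_subspace_union_finite[OF fin M]] by blast
    define \<Phi> where "\<Phi> = Blinfun F"
    have \<Phi>: "blinfun_apply \<Phi> f = F f" for f by (simp add: \<Phi>_def bounded_linear_Blinfun_apply F)
    have \<Phi>A: "\<Phi> \<in> A" by (simp add: A_def \<Phi> F(2) span_base)
    have "F (jeval n (l2_unit i)) = 0" if "n \<le> m" "i < n" for n i
      by (rule F(2), rule span_base) (use that in \<open>auto simp: B_def\<close>)
    then have b0: "bpath \<Phi> n = 0" if "n \<le> m" for n using that by (simp add: bpath_def \<Phi>)
    have "\<Phi> \<noteq> 0" using F(3) \<Phi>[of g] by auto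
    \<comment> \<open>By the bound \<open>K\<close>, an annihilating element with limit
      \<open>0\<close> would be \<open>0\<close>.\<close>
    then have "blim \<Phi> \<noteq> 0" using K[OF \<Phi>A] by auto
    define \<Psi> where "\<Psi> = (1 / norm (blim \<Phi>)) *\<^sub>R \<Phi>"
    have "\<Psi> \<in> A" "norm (blim \<Psi>) = 1" "\<forall>n\<le>m. bpath \<Psi> n = 0"
      using A_scale[OF \<Phi>A \<Phi>A] \<open>blim \<Phi> \<noteq> 0\<close> b0 by (auto simp: \<Psi>_def T.scale)
    then show ?thesis by blast
  qed
  have claim: "\<exists>\<Phi>\<in>A. \<exists>I m. nonoverlapping I \<and> card I = k \<and> (\<forall>p\<in>I. snd p \<le> m) \<and>
      (\<forall>p\<in>I. 1 / 4 \<le> norm (bpath \<Phi> (snd p) - bpath \<Phi> (fst p))) \<and> (norm (blim \<Phi>))\<^sup>2 \<le> real k" for k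
  proof (induction k)
    case 0
    have "0 \<in> A" by (simp add: A_def)
    then show ?case
      by (intro bexI[of _ 0] exI[of _ "{}"]) (auto simp: nonoverlapping_def T.zero)
  next
    case (Suc k)
    then obtain \<Phi> I m where \<Phi>: "\<Phi> \<in> A" and I: "nonoverlapping I" "card I = k" "\<And>p. p \<in> I \<Longrightarrow> snd p \<le> m"
      and inc: "\<And>p. p \<in> I \<Longrightarrow> 1 / 4 \<le> norm (bpath \<Phi> (snd p) - bpath \<Phi> (fst p))"
      and nl: "(norm (blim \<Phi>))\<^sup>2 \<le> real k" by blast
    \<comment> \<open>From time \<open>a\<close> on, the old path moves by less than
      \<open>1 / 4\<close>, while the new one goes from \<open>0\<close> at \<open>a\<close> to norm
      at least \<open>1 / 2\<close> at \<open>b\<close>; the sum keeps an increment of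
      \<open>1 / 4\<close>. Earlier intervals end by \<open>a\<close>, where the new path is still
      \<open>0\<close>, so their increments are untouched.\<close>
    have "Cauchy (bpath \<Phi>)" by (rule var_le_Cauchy[OF var_le_bpath])
    then obtain m0 where m0: "\<And>a b. a \<ge> m0 \<Longrightarrow> b \<ge> m0 \<Longrightarrow> norm (bpath \<Phi> a - bpath \<Phi> b) < 1 / 4"
      unfolding Cauchy_iff by (meson zero_less_divide_1_iff zero_less_numeral)
    define a where "a = max m m0"
    obtain \<Psi>0 where \<Psi>0: "\<Psi>0 \<in> A" "\<And>n. n \<le> a \<Longrightarrow> bpath \<Psi>0 n = 0" "norm (blim \<Psi>0) = 1" using far[of a] by blast
    \<comment> \<open>The sign makes the inner product of the limits nonpositive, so the squared
      norm of the limit grows by at most \<open>1\<close>.\<close>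
    define s :: real where "s = (if inner (blim \<Phi>) (blim \<Psi>0) \<le> 0 then 1 else - 1)"
    define \<Psi> where "\<Psi> = s *\<^sub>R \<Psi>0"
    have \<Psi>: "\<Psi> \<in> A" "\<And>n. n \<le> a \<Longrightarrow> bpath \<Psi> n = 0" "norm (blim \<Psi>) = 1"
      using A_scale[OF \<Psi>0(1,1)] \<Psi>0 by (auto simp: \<Psi>_def s_def T.neg)
    have ortho: "inner (blim \<Phi>) (blim \<Psi>) \<le> 0" by (simp add: \<Psi>_def T.scale s_def T.neg)
    obtain b0 where b0: "\<And>n. n \<ge> b0 \<Longrightarrow> norm (bpath \<Psi> n - blim \<Psi>) < 1 / 2"
      using LIMSEQ_D[OF bpath_tendsto[of \<Psi>], of "1 / 2"] by auto
    define b where "b = max b0 (Suc a)"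
    have ab: "a < b" by (simp add: b_def)
    have "norm (blim \<Psi>) \<le> norm (bpath \<Psi> b) + norm (bpath \<Psi> b - blim \<Psi>)"
      using norm_triangle_ineq4[of "bpath \<Psi> b" "bpath \<Psi> b - blim \<Psi>"] by simp
    then have \<Psi>b: "norm (bpath \<Psi> b) \<ge> 1 / 2" using b0[of b] \<Psi>(3) by (simp add: b_def)
    let ?I = "insert (a, b) I" and ?\<Phi> = "\<Phi> + \<Psi>"
    have lt: "fst p < snd p" "snd p \<le> a" if "p \<in> I" for p
      using I(1) I(3)[OF that] that by (auto simp: nonoverlapping_def a_def)
    have new: "(a, b) \<notin> I" using lt(2)[of "(a, b)"] ab by auto
    have "nonoverlapping ?I" using I(1) lt ab unfolding nonoverlapping_def by auto
    moreover have "card ?I = Suc k" using I new by (simp add: nonoverlapping_def)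
    moreover have "\<forall>p\<in>?I. snd p \<le> b" using lt ab by fastforce
    moreover have "1 / 4 \<le> norm (bpath ?\<Phi> (snd p) - bpath ?\<Phi> (fst p))" if p: "p \<in> ?I" for p
    proof (cases "p = (a, b)")
      case True
      have "norm (bpath \<Phi> b - bpath \<Phi> a) < 1 / 4" using m0[of b a] ab by (simp add: a_def)
      then have "1 / 4 \<le> norm (bpath \<Psi> b) - norm (bpath \<Phi> b - bpath \<Phi> a)" using \<Psi>b by simp
      also have "\<dots> \<le> norm (bpath \<Psi> b + (bpath \<Phi> b - bpath \<Phi> a))" by (rule norm_diff_ineq)
      finally show ?thesis by (simp add: True \<Psi>(2) algebra_simps)
    next
      case False
      then have "p \<in> I" using p by simp
      then show ?thesis using inc[of p] lt[of p] by (simp add: \<Psi>(2))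
    qed
    moreover have "(norm (blim ?\<Phi>))\<^sup>2 \<le> real (Suc k)"
    proof -
      have "(norm (blim ?\<Phi>))\<^sup>2 = (norm (blim \<Phi>))\<^sup>2 + 2 * inner (blim \<Phi>) (blim \<Psi>) + (norm (blim \<Psi>))\<^sup>2"
        by (simp add: T.add power2_norm_eq_inner inner_add_left inner_add_right inner_commute)
      then show ?thesis using nl ortho \<Psi>(3) by simp
    qed
    moreover have "?\<Phi> \<in> A" by (rule A_add[OF \<Phi> \<Psi>(1)])
    ultimately show ?case by blast
  qed
  \<comment> \<open>With \<open>j\<^sup>3\<close> intervals of weight \<open>1 / j\<close> the cube
    weights sum to \<open>1\<close> and the weighted variation is at least
    \<open>j\<^sup>2 / 4\<close>, whereas the square of the limit's norm is at most
    \<open>j\<^sup>3\<close>. Comparing squares leaves one factor \<open>j\<close>.\<close>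
  have "real j \<le> 16 * K\<^sup>2" if j: "j > 0" for j :: nat
  proof -
    obtain \<Phi> I where \<Phi>: "\<Phi> \<in> A" and I: "nonoverlapping I" "card I = j ^ 3"
      and inc: "\<And>p. p \<in> I \<Longrightarrow> 1 / 4 \<le> norm (bpath \<Phi> (snd p) - bpath \<Phi> (fst p))"
      and nl: "(norm (blim \<Phi>))\<^sup>2 \<le> real (j ^ 3)" using claim[of "j ^ 3"] by blast
    have w: "weighted I (\<lambda>_. 1 / real j)"
      using I j by (simp add: weighted_def power_divide)
    have "(\<Sum>p\<in>I. 1 / real j * (1 / 4)) \<le> wvar I (\<lambda>_. 1 / real j) (bpath \<Phi>)"
      unfolding wvar_def using inc by (intro sum_mono mult_left_mono) auto
    also have "\<dots> \<le> norm \<Phi>" using var_le_bpath w by (simp add: var_le_def)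
    also have "\<dots> \<le> K * norm (blim \<Phi>)" by (rule K[OF \<Phi>])
    also have "(\<Sum>p\<in>I. 1 / real j * (1 / 4)) = (real j)\<^sup>2 / 4"
      using I(2) j by (simp add: power3_eq_cube power2_eq_square)
    finally have "((real j)\<^sup>2 / 4)\<^sup>2 \<le> (K * norm (blim \<Phi>))\<^sup>2" by (rule power_mono) simp
    also have "\<dots> \<le> K\<^sup>2 * real (j ^ 3)" unfolding power_mult_distrib by (intro mult_left_mono nl) auto
    finally have "real j * real j ^ 3 \<le> (16 * K\<^sup>2) * real j ^ 3"
      by (simp add: power2_eq_square power3_eq_cube field_simps)
    then show ?thesis using j by (simp add: mult_le_cancel_right)
  qed
  moreover obtain j :: nat where "real j > 16 * K\<^sup>2" using reals_Archimedean2 by blast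
  moreover from this have "j > 0" by (metis mult_nonneg_nonneg not_gr0 not_less of_nat_0 zero_le_numeral zero_le_power2)
  ultimately show False by (meson not_less)
qed

section \<open>A basis and the carrier-based space\<close>

text \<open>Row-by-row enumeration of the pairs \<open>(n, i)\<close> with \<open>i < n\<close>. It
  starts in row \<open>1\<close> because row \<open>0\<close> is empty.\<close>

fun jpos :: "nat \<Rightarrow> nat \<times> nat" where
  "jpos 0 = (1, 0)"
| "jpos (Suc s) = (let (n, i) = jpos s in if Suc i < n then (n, Suc i) else (Suc n, 0))"

lemma jpos_less: "snd (jpos s) < fst (jpos s)"
  by (induction s) (auto simp: Let_def split: prod.splits)

text \<open>Rows \<open>1\<close> to \<open>n - 1\<close> hold \<open>n * (n - 1) div 2\<close>
  positions. The formula gives a left inverse of \<open>jpos\<close>, hence injectivity.\<close>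

lemma jpos_index: "fst (jpos s) * (fst (jpos s) - 1) div 2 + snd (jpos s) = s"
proof (induction s)
  case (Suc s)
  obtain n i where ni: "jpos s = (n, i)" by fastforce
  have "i < n" using jpos_less[of s] ni by simp
  show ?case
  proof (cases "Suc i < n")
    case True
    then show ?thesis using Suc ni by simp
  next
    case False
    then have "n = Suc i" using \<open>i < n\<close> by simp
    then show ?thesis using Suc ni by simp
  qed
qed simp

lemma jpos_inj: "jpos s = jpos t \<longleftrightarrow> s = t"
  by (metis jpos_index)

lemma jpos_row_mono: "s \<le> t \<Longrightarrow> fst (jpos s) \<le> fst (jpos t)"
  by (rule lift_Suc_mono_le[of "\<lambda>s. fst (jpos s)"]) (auto split: prod.splits)

lemma jpos_row_unbounded: "\<exists>s. m \<le> fst (jpos s)"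
proof (rule ccontr)
  assume "\<not> ?thesis"
  then have lt: "fst (jpos s) < m" for s by (simp add: not_le)
  have "s < m * m + m" for s
  proof -
    have "fst (jpos s) * (fst (jpos s) - 1) div 2 \<le> m * m"
      using lt[of s] by (intro order_trans[OF div_le_dividend] mult_le_mono) auto
    then show ?thesis using jpos_index[of s] jpos_less[of s] lt[of s] by linarith
  qed
  then show False by blast
qed

section \<open>Coordinates and basis expansions\<close>

definition jcoord :: "nat \<Rightarrow> jy \<Rightarrow> real" where
  "jcoord s x = l2_nth (jpath x (fst (jpos s))) (snd (jpos s))"

definition jbasis :: "nat \<Rightarrow> jy" where
  "jbasis s = junit (fst (jpos s)) (snd (jpos s))"

lemma jcoord_jbasis: "jcoord s (jbasis t) = (if s = t then 1 else 0)"
  using jpos_inj[of s t]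
  by (auto simp: jcoord_def jbasis_def jpath_junit[OF jpos_less] prod_eq_iff split: if_splits)

lemma bounded_linear_jcoord: "bounded_linear (jcoord s)"
  unfolding jcoord_def by (rule bounded_linear_compose[OF bounded_linear_l2_nth bounded_linear_jpath])

lemma jbasis_partial_sum:
  "jpath (\<Sum>t<s. jcoord t x *\<^sub>R jbasis t) m =
    (if m < fst (jpos s) then jpath x m else if m = fst (jpos s) then l2_trunc (snd (jpos s)) (jpath x m) else 0)"
proof (induction s)
  case 0
  show ?case by (auto intro!: l2_eqI)
next
  case (Suc s)
  obtain n i where ni: "jpos s = (n, i)" by fastforce
  have "i < n" using jpos_less[of s] ni by simp
  have new: "jpath (jcoord s x *\<^sub>R jbasis s) m = (if m = n then l2_nth (jpath x n) i *\<^sub>R l2_unit i else 0)"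
    using \<open>i < n\<close> by (simp add: jcoord_def jbasis_def ni jpath_junit)
  have tr: "l2_trunc i z + l2_nth z i *\<^sub>R l2_unit i = l2_trunc (Suc i) z" for z
    by (rule l2_eqI) (auto simp: less_Suc_eq)
  have "jpath (\<Sum>t<Suc s. jcoord t x *\<^sub>R jbasis t) m =
      (if m < n then jpath x m else if m = n then l2_trunc (Suc i) (jpath x m) else 0)"
    using Suc new by (auto simp: ni tr)
  also have "\<dots> = (if m < fst (jpos (Suc s)) then jpath x m
      else if m = fst (jpos (Suc s)) then l2_trunc (snd (jpos (Suc s))) (jpath x m) else 0)"
  proof (cases "Suc i < n")
    \<comment> \<open>At the end of a row, truncation at \<open>n\<close> is the identity by the
      support condition, and truncation at \<open>0\<close> starts the next row with the zero
      vector.\<close>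
    case False
    then have "Suc i = n" using \<open>i < n\<close> by simp
    then show ?thesis by (auto simp: ni less_Suc_eq intro!: l2_eqI)
  qed (simp add: ni)
  finally show ?case .
qed

text \<open>A partial sum is an initial segment plus part of one row. That part is a block at a
  single time, of norm at most twice the value of the path there, and these values tend to
  \<open>0\<close>.\<close>

lemma jbasis_expansion: "(\<lambda>s. \<Sum>t<s. jcoord t x *\<^sub>R jbasis t) \<longlonglongrightarrow> x"
proof -
  let ?S = "\<lambda>s. \<Sum>t<s. jcoord t x *\<^sub>R jbasis t"
  let ?r = "\<lambda>s. fst (jpos s)"
  have eq: "?S s - jhead (?r s) x = jblock (?r s) (?r s) (l2_trunc (snd (jpos s)) (jpath x (?r s)))" for s
    by (rule jy_eqI, subst jpath_simps(3), subst jbasis_partial_sum)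
      (auto simp: jpath_jhead jpath_jblock intro!: l2_eqI)
  have le: "norm (?S s - jhead (?r s) x) \<le> 2 * norm (jpath x (?r s))" for s
    unfolding eq
    using norm_jblock_le[of "?r s" "?r s" "l2_trunc (snd (jpos s)) (jpath x (?r s))"]
      norm_l2_trunc_le[of "snd (jpos s)" "jpath x (?r s)"] by linarith
  have r: "filterlim ?r at_top sequentially"
    unfolding filterlim_at_top eventually_sequentially
    using jpos_row_unbounded jpos_row_mono by (meson order_trans)
  have "(\<lambda>s. norm (jpath x (?r s))) \<longlonglongrightarrow> 0"
    using filterlim_compose[OF tendsto_norm_zero[OF jpath_tendsto[of x]] r] .
  then have lim0: "(\<lambda>s. 2 * norm (jpath x (?r s))) \<longlonglongrightarrow> 0" by (rule tendsto_mult_right_zero)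
  have "(\<lambda>s. norm (?S s - jhead (?r s) x)) \<longlonglongrightarrow> 0"
    by (rule tendsto_sandwich[OF _ _ tendsto_const lim0]) (use le in auto)
  then have "(\<lambda>s. ?S s - jhead (?r s) x) \<longlonglongrightarrow> 0" by (rule tendsto_norm_zero_cancel)
  moreover have "(\<lambda>s. jhead (?r s) x) \<longlonglongrightarrow> x" using filterlim_compose[OF jhead_tendsto r] .
  ultimately have "(\<lambda>s. (?S s - jhead (?r s) x) + jhead (?r s) x) \<longlonglongrightarrow> 0 + x" by (rule tendsto_add)
  then show ?thesis by simp
qed

text \<open>Coordinates are continuous and biorthogonal to the basis, so along the partial sums
  coordinate \<open>t\<close> is eventually constant, equal to \<open>a t\<close>.\<close>

lemma jbasis_coefficients_unique:
  assumes "(\<lambda>s. \<Sum>t<s. a t *\<^sub>R jbasis t) \<longlonglongrightarrow> x"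
  shows "a t = jcoord t x"
proof -
  interpret C: bounded_linear "jcoord t" by (rule bounded_linear_jcoord)
  have "(\<lambda>s. jcoord t (\<Sum>u<s. a u *\<^sub>R jbasis u)) \<longlonglongrightarrow> jcoord t x" by (rule C.tendsto[OF assms])
  moreover have "jcoord t (\<Sum>u<s. a u *\<^sub>R jbasis u) = a t" if "s \<ge> Suc t" for s
  proof -
    have "jcoord t (\<Sum>u<s. a u *\<^sub>R jbasis u) = (\<Sum>u<s. a u * (if t = u then 1 else 0))"
      by (simp add: C.sum C.scale jcoord_jbasis)
    also have "\<dots> = (\<Sum>u<s. if u = t then a t else 0)" by (intro sum.cong) auto
    finally have "jcoord t (\<Sum>u<s. a u *\<^sub>R jbasis u) = (\<Sum>u<s. if u = t then a t else 0)" .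
    then show ?thesis using that by simp
  qed
  then have "(\<lambda>s. jcoord t (\<Sum>u<s. a u *\<^sub>R jbasis u)) \<longlonglongrightarrow> a t"
    by (intro tendsto_eventually eventually_sequentiallyI)
  ultimately show ?thesis by (rule LIMSEQ_unique[symmetric])
qed

lemma jcoords_inj: "inj (\<lambda>x s. jcoord s x)"
proof (rule injI)
  fix x y assume "(\<lambda>s. jcoord s x) = (\<lambda>s. jcoord s y)"
  then have "jcoord s x = jcoord s y" for s by metis
  then show "x = y" using jbasis_expansion[of x] jbasis_expansion[of y] LIMSEQ_unique by simp
qed

definition jcoords :: "jy \<Rightarrow> nat \<Rightarrow> real" where
  "jcoords x = (\<lambda>s. jcoord s x)"

text \<open>The space has to live on \<open>nat \<Rightarrow> real\<close>, so each path is replaced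
  by its sequence of basis coefficients, and the norm is pulled back along this injection.\<close>

definition james_space :: "(nat \<Rightarrow> real) normed_vs" where
  "james_space =
     \<lparr>carrier = range jcoords,
      mult = (\<lambda>_ _. undefined),
      one = undefined,
      zero = (\<lambda>_. 0),
      add = (\<lambda>a b s. a s + b s),
      smult = (\<lambda>r a s. r * a s),
      vnorm = (\<lambda>a. norm (inv_into UNIV jcoords a))\<rparr>"

lemma inj_jcoords: "inj jcoords"
  using jcoords_inj by (simp add: jcoords_def[abs_def])

lemma iso_rep_james_space: "iso_rep james_space jcoords"
proof
  have lin: "linear (jcoord s)" for s by (rule bounded_linear.linear[OF bounded_linear_jcoord])
  have vn: "vnorm james_space (jcoords x) = norm x" for x
    by (simp add: james_space_def inj_jcoords)
  show "bij_betw jcoords UNIV (carrier james_space)"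
    by (simp add: bij_betw_def inj_jcoords james_space_def)
  show "jcoords 0 = \<zero>\<^bsub>james_space\<^esub>"
    by (simp add: james_space_def jcoords_def linear_0[OF lin])
  show "jcoords (x + y) = jcoords x \<oplus>\<^bsub>james_space\<^esub> jcoords y" for x y
    by (simp add: james_space_def jcoords_def linear_add[OF lin])
  show "jcoords (a *\<^sub>R x) = a \<odot>\<^bsub>james_space\<^esub> jcoords x" for a x
    by (simp add: james_space_def jcoords_def linear_scale[OF lin])
  show "vnorm james_space (jcoords (x + y)) \<le> vnorm james_space (jcoords x) + vnorm james_space (jcoords y)" for x y
    by (simp add: vn norm_triangle_ineq)
  show "vnorm james_space (jcoords (a *\<^sub>R x)) = \<bar>a\<bar> * vnorm james_space (jcoords x)" for a x
    by (simp add: vn)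
  show "\<exists>c. \<forall>x. norm x \<le> c * vnorm james_space (jcoords x)"
    "\<exists>C. \<forall>x. vnorm james_space (jcoords x) \<le> C * norm x"
    by (auto simp: vn intro!: exI[of _ 1])
  show "vnorm james_space (jcoords x) = norm x" for x by (rule vn)
qed

theorem theorem7:
  shows "\<exists>Y :: (nat \<Rightarrow> real) normed_vs.
    banach_space Y \<and>
    (\<exists>e. schauder_basis Y e) \<and>
    banach_space (quotient_space (bidual_space Y) (canonical_image Y)) \<and>
    \<not> finite_dimensional (quotient_space (bidual_space Y) (canonical_image Y)) \<and>
    reflexive_space (quotient_space (bidual_space Y) (canonical_image Y)) \<and>
    separable_space (norm_topology (quotient_space (bidual_space Y) (canonical_image Y))) \<and>
    \<not> (\<exists>M. submodule M real_ring (dual_space Y) \<and>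
          closedin (norm_topology (dual_space Y)) M \<and>
          norming Y M \<and>
          infinite_codimension (dual_space Y) M)"
proof (intro exI[of _ james_space] conjI)
  interpret Y: iso_rep james_space jcoords by (rule iso_rep_james_space)
  interpret D: iso_rep "dual_space james_space" Y.dual_rep by (rule Y.dual)
  interpret DD: iso_rep "bidual_space james_space" D.dual_rep by (rule D.dual)
  interpret Yb: banach_rep james_space jcoords ..
  show "banach_space james_space" by (rule Yb.banach_space)

  have "schauder_basis james_space (\<lambda>s. jcoords (jbasis s))"
    unfolding schauder_basis_def
  proof (intro conjI ballI)
    show "range (\<lambda>s. jcoords (jbasis s)) \<subseteq> carrier james_space" by auto
    fix u assume "u \<in> carrier james_space"
    then obtain x where u: "u = jcoords x" by (rule Y.unrep_cases)
    have "(\<Oplus>\<^bsub>james_space\<^esub>i\<in>{..<n}. a i \<odot>\<^bsub>james_space\<^esub> jcoords (jbasis i))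
        = jcoords (\<Sum>i<n. a i *\<^sub>R jbasis i)" for a :: "nat \<Rightarrow> real" and n
      by (simp add: Y.finsum_rep flip: Y.rep_scale)
    then have *: "limitin (norm_topology james_space)
        (\<lambda>n. \<Oplus>\<^bsub>james_space\<^esub>i\<in>{..<n}. a i \<odot>\<^bsub>james_space\<^esub> jcoords (jbasis i)) u sequentially
        \<longleftrightarrow> (\<lambda>n. \<Sum>i<n. a i *\<^sub>R jbasis i) \<longlonglongrightarrow> x" for a
      by (simp add: u Y.limitin_rep)
    show "\<exists>!a. limitin (norm_topology james_space)
        (\<lambda>n. \<Oplus>\<^bsub>james_space\<^esub>i\<in>{..<n}. a i \<odot>\<^bsub>james_space\<^esub> jcoords (jbasis i)) u sequentially"
      unfolding *
    proof (rule ex1I[of _ "\<lambda>i. jcoord i x"])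
      show "(\<lambda>n. \<Sum>i<n. jcoord i x *\<^sub>R jbasis i) \<longlonglongrightarrow> x" by (rule jbasis_expansion)
    qed (auto dest: jbasis_coefficients_unique)
  qed
  then show "\<exists>e. schauder_basis james_space e" by metis

  have emb: "canonical_embedding james_space (jcoords x) = D.dual_rep (jembed x)" for x
  proof
    fix f
    show "canonical_embedding james_space (jcoords x) f = D.dual_rep (jembed x) f"
    proof (cases "f \<in> carrier (dual_space james_space)")
      case True
      then obtain g where "f = Y.dual_rep g" by (rule D.unrep_cases)
      then show ?thesis by (simp add: canonical_embedding_def)
    qed (simp add: canonical_embedding_def D.dual_rep_def)
  qed
  \<comment> \<open>Modulo the model, the canonical image is the kernel of the limit map. The lift
    with constant \<open>4\<close> therefore makes \<open>l2\<close> a model of the quotient, from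
    which completeness, infinite dimension, reflexivity and separability are read off.\<close>
  have image: "canonical_image james_space = D.dual_rep ` {\<Phi>. blim \<Phi> = 0}"
    by (auto simp: canonical_image_def Y.carrier_eq image_image emb blim_eq_0_iff)
  define W where "W = quotient_space (bidual_space james_space) (canonical_image james_space)"
  interpret W: normed_rep W "\<lambda>z. D.dual_rep ` {\<Phi>. blim \<Phi> = z}"
    unfolding W_def image by (rule DD.quotient_by_kernel[OF bounded_linear_blim blim_lift])
  interpret Wb: banach_rep W "\<lambda>z. D.dual_rep ` {\<Phi>. blim \<Phi> = z}" ..
  interpret Wh: hilbert_rep W "\<lambda>z. D.dual_rep ` {\<Phi>. blim \<Phi> = z}"
    by unfold_locales (rule l2_riesz)
  show "banach_space (quotient_space (bidual_space james_space) (canonical_image james_space))"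
    using Wb.banach_space by (simp add: W_def)
  show "\<not> finite_dimensional (quotient_space (bidual_space james_space) (canonical_image james_space))"
    using W.finite_dimensional_imp l2_span_finite_neq by (auto simp: W_def)
  show "reflexive_space (quotient_space (bidual_space james_space) (canonical_image james_space))"
    using Wh.reflexive by (simp add: W_def)
  show "separable_space (norm_topology (quotient_space (bidual_space james_space) (canonical_image james_space)))"
    using l2_countable_dense W.separable by (auto simp: W_def)

  show "\<not> (\<exists>M. submodule M real_ring (dual_space james_space) \<and>
      closedin (norm_topology (dual_space james_space)) M \<and> norming james_space M \<and>
      infinite_codimension (dual_space james_space) M)"
  proof
    assume "\<exists>M. submodule M real_ring (dual_space james_space) \<and>
      closedin (norm_topology (dual_space james_space)) M \<and> norming james_space M \<and>
      infinite_codimension (dual_space james_space) M"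
    then obtain M where M: "submodule M real_ring (dual_space james_space)"
      "closedin (norm_topology (dual_space james_space)) M" "norming james_space M"
      "infinite_codimension (dual_space james_space) M" by blast
    interpret M: submodule M real_ring "dual_space james_space" by (rule M(1))
    \<comment> \<open>The subspace is pulled back to the typed dual. Linearity, closedness and the
      norming suprema transfer because \<open>Y.dual_rep\<close> is a linear isometric bijection
      onto the dual.\<close>
    define N where "N = {f. Y.dual_rep f \<in> M}"
    have MN: "M = Y.dual_rep ` N" using M.subset by (force simp: N_def D.carrier_eq)
    have "subspace N"
    proof (rule subspaceI)
      show "0 \<in> N" using M.one_closed by (simp add: N_def D.rep_zero)
      show "f + g \<in> N" if "f \<in> N" "g \<in> N" for f g
        using M.m_closed that by (simp add: N_def D.rep_add)
      show "a *\<^sub>R f \<in> N" if "f \<in> N" for a f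
        using M.smult_closed that by (simp add: N_def D.rep_scale real_ring_def)
    qed
    moreover have "closed N"
      unfolding closed_sequential_limits
    proof (intro allI impI, elim conjE)
      fix u f assume u: "\<forall>n. u n \<in> N" "u \<longlonglongrightarrow> f"
      have "Y.dual_rep f \<in> M"
        by (rule limitin_closedin[OF D.limitin_rep[THEN iffD2, OF u(2)] M(2)])
          (use u(1) in \<open>auto simp: N_def\<close>)
      then show "f \<in> N" by (simp add: N_def)
    qed
    moreover obtain c where c: "c > 0" and nrm:
      "\<And>a. a \<in> carrier james_space \<Longrightarrow> c * vnorm james_space a \<le>
        Sup (insert 0 {\<bar>f a\<bar> / vnorm (dual_space james_space) f | f. f \<in> M \<and> f \<noteq> \<zero>\<^bsub>dual_space james_space\<^esub>})"
      using M(3) unfolding norming_def by blast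
    moreover have "c * norm x \<le> Sup (insert 0 {\<bar>f (jcoords x)\<bar> / vnorm (dual_space james_space) f | f.
        f \<in> M \<and> f \<noteq> \<zero>\<^bsub>dual_space james_space\<^esub>})" for x
      using nrm[OF Y.rep_carrier[of x]] unfolding Y.rep_norm .
    moreover have "{\<bar>f (jcoords x)\<bar> / vnorm (dual_space james_space) f | f. f \<in> M \<and> f \<noteq> \<zero>\<^bsub>dual_space james_space\<^esub>}
        = {\<bar>blinfun_apply f x\<bar> / norm f | f. f \<in> N \<and> f \<noteq> 0}" for x
    proof (intro equalityI subsetI)
      fix r assume "r \<in> {\<bar>f (jcoords x)\<bar> / vnorm (dual_space james_space) f | f. f \<in> M \<and> f \<noteq> \<zero>\<^bsub>dual_space james_space\<^esub>}"
      then obtain g where "g \<in> N" "Y.dual_rep g \<noteq> \<zero>\<^bsub>dual_space james_space\<^esub>"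
        "r = \<bar>Y.dual_rep g (jcoords x)\<bar> / vnorm (dual_space james_space) (Y.dual_rep g)"
        unfolding MN by blast
      then have "r = \<bar>blinfun_apply g x\<bar> / norm g" "g \<in> N" "g \<noteq> 0" using D.rep_zero by auto
      then show "r \<in> {\<bar>blinfun_apply f x\<bar> / norm f | f. f \<in> N \<and> f \<noteq> 0}" by blast
    next
      fix r assume "r \<in> {\<bar>blinfun_apply f x\<bar> / norm f | f. f \<in> N \<and> f \<noteq> 0}"
      then obtain g where g: "r = \<bar>blinfun_apply g x\<bar> / norm g" "g \<in> N" "g \<noteq> 0" by blast
      then have "Y.dual_rep g \<in> M" "Y.dual_rep g \<noteq> \<zero>\<^bsub>dual_space james_space\<^esub>"
        "r = \<bar>Y.dual_rep g (jcoords x)\<bar> / vnorm (dual_space james_space) (Y.dual_rep g)"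
        by (auto simp: N_def simp flip: D.rep_zero)
      then show "r \<in> {\<bar>f (jcoords x)\<bar> / vnorm (dual_space james_space) f | f. f \<in> M \<and> f \<noteq> \<zero>\<^bsub>dual_space james_space\<^esub>}"
        by blast
    qed
    ultimately obtain B where "finite B" "span (B \<union> N) = UNIV"
      using norming_imp_finite_codim[of N c] by auto
    then show False
      using D.finite_dimensional_quotient[OF \<open>subspace N\<close>] M(4) by (simp add: MN)
  qed
qed

end
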